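(* Let $T>0$. Let $\sigma$ be a function on $\mathbb{R}$ with $\sigma(x)\neq 0$ for all $x\in(0,\infty)$, $\sigma(x)=0$ for all $x\in(-\infty,0]$, and $\sigma^{-2}\in L^1_{loc}(0,\infty)$, i.e. $\int_a^b\sigma^{-2}(x)\,dx<\infty$ for every $[a,b]\subset(0,\infty)$. Assume further that $\sigma:[0,\infty)\to[0,\infty)$ is locally H\"older continuous with exponent $1/2$. Let $g:[0,\infty)\to[0,\infty)$ be of at most linear growth, i.e. $g(x)\le C(1+x)$ for all $x\ge 0$, for some constant $C>0$. Then the Cauchy problem $$u_t+\tfrac12\sigma^2(x)\,u_{xx}=0 \text{ on } (0,\infty)\times[0,T),\qquad u(0,t)=g(0)\ \text{ for } t\le T,\qquad u(x,T)=g(x),$$ has a unique classical solution in the class of functions of at most linear growth if and only if $$\int_1^\infty \frac{x}{\sigma^2(x)}\,dx=\infty.$$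
   Context: Points are written $(x,t)$ with $x\in[0,\infty)$, $t\in[0,T]$. A solution $u:[0,\infty)\times[0,T]\to\mathbb{R}$ of the Cauchy problem is said to be a classical solution if $u\in C^{2,1}((0,\infty)\times[0,T))$ (twice continuously differentiable in $x$ and once in $t$). A function $f:[0,\infty)\times[0,T]\to\mathbb{R}$ is of at most linear growth if there is a constant $C>0$ with $|f(x,t)|\le C(1+x)$ for all $(x,t)\in[0,\infty)\times[0,T]$. Locally H\"older continuous with exponent $1/2$ means that for every compact $K\subset[0,\infty)$ there is a constant $L_K$ with $|\sigma(x)-\sigma(y)|\le L_K|x-y|^{1/2}$ for all $x,y\in K$.
   Formalization: A classical solution is also required to be continuous on [0,∞)×[0,T], so that the boundary and terminal data are attained, and g is assumed continuous on [0,∞); without these the equivalence fails (e.g. σ(x)=x⁺ with g=0, respectively with g the indicator of [1,∞)). *)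

theory Defs
  imports "HOL-Analysis.Analysis"
begin

definition locally_Holder_on :: "real set \<Rightarrow> real \<Rightarrow> (real \<Rightarrow> real) \<Rightarrow> bool" where
  "locally_Holder_on S \<alpha> f \<longleftrightarrow>
     (\<forall>K. compact K \<and> K \<subseteq> S \<longrightarrow>
        (\<exists>L. \<forall>x\<in>K. \<forall>y\<in>K. \<bar>f x - f y\<bar> \<le> L * \<bar>x - y\<bar> powr \<alpha>))"

definition L1_loc_pos :: "(real \<Rightarrow> real) \<Rightarrow> bool" where
  "L1_loc_pos f \<longleftrightarrow> (\<forall>a b. 0 < a \<and> a \<le> b \<longrightarrow> set_integrable lborel {a..b} f)"

definition linear_growth :: "real \<Rightarrow> (real \<Rightarrow> real \<Rightarrow> real) \<Rightarrow> bool" where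
  "linear_growth T f \<longleftrightarrow>
     (\<exists>C>0. \<forall>x\<ge>0. \<forall>t\<in>{0..T}. \<bar>f x t\<bar> \<le> C * (1 + x))"

text \<open>
  \<open>C21_derivs T u ux uxx ut\<close> says that \<open>u\<close> is of class C^{2,1} on
  the strip \<open>{0<..} \<times> {0..<T}\<close>, with the named partial derivatives. At \<open>t = 0\<close> the time derivative is one-sided. The partial derivatives are
  determined by \<open>u\<close> on the strip.
\<close>
definition C21_derivs ::
  "real \<Rightarrow> (real \<Rightarrow> real \<Rightarrow> real) \<Rightarrow> (real \<Rightarrow> real \<Rightarrow> real) \<Rightarrow>
   (real \<Rightarrow> real \<Rightarrow> real) \<Rightarrow> (real \<Rightarrow> real \<Rightarrow> real) \<Rightarrow> bool" where
  "C21_derivs T u ux uxx ut \<longleftrightarrow>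
     (\<forall>x>0. \<forall>t\<in>{0..<T}.
        ((\<lambda>y. u y t) has_real_derivative ux x t) (at x) \<and>
        ((\<lambda>y. ux y t) has_real_derivative uxx x t) (at x) \<and>
        ((\<lambda>s. u x s) has_real_derivative ut x t) (at t within {0..<T})) \<and>
     (\<forall>f\<in>{u, ux, uxx, ut}. continuous_on ({0<..} \<times> {0..<T}) (\<lambda>(x, t). f x t))"

text \<open>
  The data are attained continuously: \<open>u\<close> is continuous on the whole closed domain. Without
  this the values of \<open>u\<close> on the boundary would be unrelated to those in the interior, and
  uniqueness would fail for every \<open>\<sigma>\<close>.
\<close>
definition classical_solution ::
  "real \<Rightarrow> (real \<Rightarrow> real) \<Rightarrow> (real \<Rightarrow> real) \<Rightarrow> (real \<Rightarrow> real \<Rightarrow> real) \<Rightarrow> bool" where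
  "classical_solution T \<sigma> g u \<longleftrightarrow>
     continuous_on ({0..} \<times> {0..T}) (\<lambda>(x, t). u x t) \<and>
     (\<exists>ux uxx ut. C21_derivs T u ux uxx ut \<and>
        (\<forall>x>0. \<forall>t\<in>{0..<T}. ut x t + 1/2 * (\<sigma> x)\<^sup>2 * uxx x t = 0)) \<and>
     (\<forall>t\<in>{0..T}. u 0 t = g 0) \<and>
     (\<forall>x\<ge>0. u x T = g x)"

text \<open>Functions are total in HOL, so uniqueness means equality on the closed domain.\<close>
definition has_unique_linear_growth_solution ::
  "real \<Rightarrow> (real \<Rightarrow> real) \<Rightarrow> (real \<Rightarrow> real) \<Rightarrow> bool" where
  "has_unique_linear_growth_solution T \<sigma> g \<longleftrightarrow>
     (\<exists>u. classical_solution T \<sigma> g u \<and> linear_growth T u \<and>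
        (\<forall>v. classical_solution T \<sigma> g v \<and> linear_growth T v \<longrightarrow>
           (\<forall>x\<ge>0. \<forall>t\<in>{0..T}. v x t = u x t)))"

end

theory Submission
  imports Defs "HOL-Real_Asymp.Real_Asymp"
begin

text \<open>
  Throughout, \<open>a = \<sigma>\<^sup>2 / 2\<close> and time is reversed.

  Existence. On a compact subinterval of \<open>(0, \<infinity>)\<close> the equation \<open>u_t = a u_xx\<close> is solved by the semigroup
  \<open>lim (1 - (t / 2^k) L)^(-2^k)\<close> of \<open>L = a d^2/dx^2\<close>. Neither the semigroup nor the interior bound of
  \<open>u_t\<close> by \<open>sup |u|\<close>, which is an energy estimate, needs more than continuity of \<open>a\<close>, because \<open>a\<close> does
  not depend on time. Solutions on \<open>[1/n, n]\<close> with boundary values \<open>g\<close> are compared by the maximum principle: near \<open>0\<close> with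
  affine functions, which are solutions for every \<open>a\<close>, and at \<open>n\<close> with a positive \<open>\<psi>\<close> satisfying \<open>a \<psi>'' \<le> \<kappa> \<psi>\<close>.
  If \<open>g\<close> lies between a convex \<open>b_l\<close> and a concave \<open>b_u\<close> with \<open>b_u - b_l = o(\<psi>)\<close>, they form a locally uniform Cauchy sequence.

  If the integral diverges, then \<open>\<psi>\<close> with \<open>\<psi>'' = (x - 1)\<^sup>+ / \<sigma>\<^sup>2\<close> grows superlinearly; this gives existence, and uniqueness
  by comparison. If it converges, the solution \<open>\<theta>\<close> of \<open>a \<theta>'' = \<phi> := (x - 1)\<^sup>+\<close> with \<open>\<theta>(0) = 0\<close> and \<open>\<theta>'(\<infinity>) = 0\<close>
  is \<open>o(x)\<close>. Let \<open>U_\<phi>\<close> and \<open>U_\<theta>\<close> be the solutions with data \<open>\<phi>\<close> and \<open>\<theta>\<close>. Then \<open>\<integral>\<^sub>0\<^sup>t U_\<phi> ds + \<theta> - U_\<theta>\<close> is a solution with zero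
  data which behaves like \<open>t x\<close> at infinity.
\<close>

subsection \<open>Calculus of twice differentiable functions\<close>

text \<open>The coefficient may degenerate at \<open>0\<close> and has no growth bound. Regularity
  reduces to the single bound of \<open>u_t\<close>: as \<open>u_xx = u_t / a\<close>, control of
  \<open>u\<close> and \<open>u_t\<close> controls everything else. Applied to differences of
  approximating solutions, the bound turns uniform convergence of \<open>u\<close> into uniform
  convergence of \<open>u_t\<close>, so limits are taken along Cauchy sequences and no compactness
  argument occurs.

  Why the last function of the overview is a solution: \<open>Y\<close>, the integral of
  \<open>U_\<phi>\<close> over \<open>[0, t]\<close>, satisfies \<open>Y_t = U_\<phi>\<close> and
  \<open>a Y'' = U_\<phi> - \<phi>\<close>. Hence \<open>Y + \<theta>\<close> solves the equation
  with data \<open>\<theta>\<close>, just as \<open>U_\<theta>\<close> does. But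
  \<open>U_\<phi>\<close> stays above \<open>x - 1\<close>, whereas \<open>\<theta>\<close> and
  \<open>U_\<theta>\<close> are \<open>o(x)\<close>, so the two solutions differ. A
  \<open>\<theta>\<close> with \<open>\<theta>'(\<infinity>) = 0\<close> exists because
  \<open>\<phi> / a\<close> is integrable at infinity; the cut of \<open>\<phi>\<close> at
  \<open>1\<close> keeps out the possibly non-integrable singularity of \<open>x / a\<close> at
  \<open>0\<close>.\<close>

lemma second_derivative_nonpos_at_local_max:
  fixes f f' :: "real \<Rightarrow> real"
  assumes "d > 0"
    and f': "\<And>y. \<bar>y - x\<bar> < d \<Longrightarrow> (f has_real_derivative f' y) (at y)"
    and f'': "(f' has_real_derivative D) (at x)"
    and max: "\<And>y. \<bar>y - x\<bar> < d \<Longrightarrow> f y \<le> f x"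
  shows "D \<le> 0"
proof (rule ccontr)
  assume "\<not> D \<le> 0"
  then have "D > 0" by simp
  have "f' x = 0"
    using DERIV_local_max[OF f'[of x] \<open>d > 0\<close>] max \<open>d > 0\<close> by (simp add: abs_minus_commute)
  then obtain e where e: "e > 0" "\<And>h. 0 < h \<Longrightarrow> h < e \<Longrightarrow> 0 < f' (x + h)"
    using DERIV_pos_inc_right[OF f'' \<open>D > 0\<close>] by auto
  define h where "h = min d e / 2"
  have h: "0 < h" "h < d" "h < e" using \<open>d > 0\<close> e(1) by (auto simp: h_def)
  obtain z where z: "x < z" "z < x + h" "f (x + h) - f x = (x + h - x) * f' z"
    using MVT2[of x "x + h" f f'] f' h by (auto simp: abs_if)
  moreover have "f' z > 0" using e(2)[of "z - x"] z h by auto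
  ultimately have "f (x + h) > f x" using h(1) by (simp add: algebra_simps)
  with max[of "x + h"] h show False by auto
qed

text \<open>Some point carries the slope of the chord, and the bound on \<open>f''\<close> moves it
  to every other point. Used wherever convergence or time regularity of \<open>u_x\<close> is
  deduced from that of \<open>u\<close> and \<open>u_xx\<close>.\<close>

lemma derivative_interpolation:
  fixes f f' f'' :: "real \<Rightarrow> real"
  assumes ab: "\<alpha> < \<beta>"
    and f': "\<And>x. x \<in> {\<alpha>..\<beta>} \<Longrightarrow> (f has_real_derivative f' x) (at x within {\<alpha>..\<beta>})"
    and f'': "\<And>x. x \<in> {\<alpha>..\<beta>} \<Longrightarrow> (f' has_real_derivative f'' x) (at x within {\<alpha>..\<beta>})"
    and A: "\<And>x. x \<in> {\<alpha>..\<beta>} \<Longrightarrow> \<bar>f x\<bar> \<le> A" and B: "\<And>x. x \<in> {\<alpha>..\<beta>} \<Longrightarrow> \<bar>f'' x\<bar> \<le> B"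
    and x: "x \<in> {\<alpha>..\<beta>}"
  shows "\<bar>f' x\<bar> \<le> 2 * A / (\<beta> - \<alpha>) + B * (\<beta> - \<alpha>)"
proof -
  obtain z where z: "\<alpha> < z" "z < \<beta>" "f \<beta> - f \<alpha> = (\<beta> - \<alpha>) * f' z"
    using mvt_simple[of \<alpha> \<beta> f "\<lambda>x. (*) (f' x)"] ab f'
    by (auto simp: has_field_derivative_def mult.commute)
  have "\<bar>f' z\<bar> = \<bar>f \<beta> - f \<alpha>\<bar> / (\<beta> - \<alpha>)"
    using z ab by (simp add: abs_mult)
  also have "\<dots> \<le> 2 * A / (\<beta> - \<alpha>)"
    using A[of \<alpha>] A[of \<beta>] ab by (intro divide_right_mono) auto
  finally have 1: "\<bar>f' z\<bar> \<le> 2 * A / (\<beta> - \<alpha>)" .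
  have "\<bar>f' x - f' z\<bar> \<le> B * \<bar>x - z\<bar>"
    using field_differentiable_bound[of "{\<alpha>..\<beta>}" f' f'' B x z] f'' B x z by auto
  also have "\<dots> \<le> B * (\<beta> - \<alpha>)"
    using x z B[OF x] by (intro mult_left_mono) auto
  finally show ?thesis using 1 by linarith
qed

text \<open>Rolle's theorem gives a zero of \<open>f'\<close>; the bound then passes from
  \<open>f''\<close> to \<open>f'\<close> and from there to \<open>f\<close>. The constant is crude,
  but it feeds a contraction argument in which only its finiteness matters.\<close>

lemma bounded_by_second_derivative:
  fixes f f' f'' :: "real \<Rightarrow> real"
  assumes ab: "\<alpha> < \<beta>"
    and f': "\<And>x. x \<in> {\<alpha>..\<beta>} \<Longrightarrow> (f has_real_derivative f' x) (at x within {\<alpha>..\<beta>})"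
    and f'': "\<And>x. x \<in> {\<alpha>..\<beta>} \<Longrightarrow> (f' has_real_derivative f'' x) (at x within {\<alpha>..\<beta>})"
    and ends: "f \<alpha> = 0" "f \<beta> = 0" and B: "\<And>x. x \<in> {\<alpha>..\<beta>} \<Longrightarrow> \<bar>f'' x\<bar> \<le> B"
    and x: "x \<in> {\<alpha>..\<beta>}"
  shows "\<bar>f x\<bar> \<le> B * (\<beta> - \<alpha>)\<^sup>2"
proof -
  obtain z where z: "\<alpha> < z" "z < \<beta>" "f \<beta> - f \<alpha> = (\<beta> - \<alpha>) * f' z"
    using mvt_simple[of \<alpha> \<beta> f "\<lambda>x. (*) (f' x)"] ab f'
    by (auto simp: has_field_derivative_def mult.commute)
  then have z0: "f' z = 0" using ends ab by simp
  have B0: "B \<ge> 0" using B[OF x] by linarith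
  have f'b: "\<bar>f' y\<bar> \<le> B * (\<beta> - \<alpha>)" if y: "y \<in> {\<alpha>..\<beta>}" for y
  proof -
    have "\<bar>f' y - f' z\<bar> \<le> B * \<bar>y - z\<bar>"
      using field_differentiable_bound[of "{\<alpha>..\<beta>}" f' f'' B y z] f'' B y z by auto
    also have "\<dots> \<le> B * (\<beta> - \<alpha>)"
      using y z B0 by (intro mult_left_mono) auto
    finally show ?thesis using z0 by simp
  qed
  have "\<bar>f x - f \<alpha>\<bar> \<le> (B * (\<beta> - \<alpha>)) * \<bar>x - \<alpha>\<bar>"
    using field_differentiable_bound[of "{\<alpha>..\<beta>}" f f' "B * (\<beta> - \<alpha>)" x \<alpha>] f' f'b x ab by auto
  also have "\<dots> \<le> (B * (\<beta> - \<alpha>)) * (\<beta> - \<alpha>)"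
    using x B0 ab by (intro mult_left_mono) auto
  finally show ?thesis using ends by (simp add: power2_eq_square mult.assoc)
qed

text \<open>The offset \<open>N\<close> is for approximating solutions that live on growing
  intervals and reach a given point only eventually.\<close>

lemma derivative_uniform_limit:
  fixes F F' :: "nat \<Rightarrow> real \<Rightarrow> real"
  assumes F: "\<And>n x. n \<ge> N \<Longrightarrow> x \<in> {\<alpha>..\<beta>} \<Longrightarrow> (F n has_real_derivative F' n x) (at x within {\<alpha>..\<beta>})"
    and G: "\<And>x. x \<in> {\<alpha>..\<beta>} \<Longrightarrow> (\<lambda>n. F n x) \<longlonglongrightarrow> G x" and H: "uniform_limit {\<alpha>..\<beta>} F' H sequentially"
    and x: "x \<in> {\<alpha>..\<beta>}"
  shows "(G has_real_derivative H x) (at x within {\<alpha>..\<beta>})"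
proof -
  have G': "(\<lambda>n. F (n + N) x) \<longlonglongrightarrow> G x" if "x \<in> {\<alpha>..\<beta>}" for x using G[OF that] by (rule LIMSEQ_ignore_initial_segment)
  have "\<exists>g. \<forall>x\<in>{\<alpha>..\<beta>}. (\<lambda>n. F (n + N) x) \<longlonglongrightarrow> g x \<and> (g has_derivative (\<lambda>t. H x * t)) (at x within {\<alpha>..\<beta>})"
  proof (rule has_derivative_sequence[where f'="\<lambda>n x t. F' (n + N) x * t"])
    show "(\<lambda>n. F (n + N) x) \<longlonglongrightarrow> G x" "x \<in> {\<alpha>..\<beta>}" using G' x by auto
    fix e :: real assume "e > 0"
    have "\<forall>\<^sub>F n in sequentially. \<forall>x\<in>{\<alpha>..\<beta>}. dist (F' (n + N) x) (H x) < e"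
      using uniform_limitD[OF H \<open>e > 0\<close>] by (rule sequentially_offset)
    then show "\<forall>\<^sub>F n in sequentially. \<forall>x\<in>{\<alpha>..\<beta>}. \<forall>t. norm (F' (n + N) x * t - H x * t) \<le> e * norm t"
    proof eventually_elim
      case (elim n)
      have "\<bar>F' (n + N) x * t - H x * t\<bar> \<le> e * \<bar>t\<bar>" if "x \<in> {\<alpha>..\<beta>}" for x t
        using elim that
        by (auto simp: dist_real_def abs_mult left_diff_distrib[symmetric] intro!: mult_right_mono dest: less_imp_le)
      then show ?case by simp
    qed
  qed (use F in \<open>auto simp: has_field_derivative_def\<close>)
  then obtain g where g: "\<And>x. x \<in> {\<alpha>..\<beta>} \<Longrightarrow> (\<lambda>n. F (n + N) x) \<longlonglongrightarrow> g x"
    "\<And>x. x \<in> {\<alpha>..\<beta>} \<Longrightarrow> (g has_real_derivative H x) (at x within {\<alpha>..\<beta>})"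
    unfolding has_field_derivative_def by blast
  have "g x = G x" if "x \<in> {\<alpha>..\<beta>}" for x using LIMSEQ_unique g(1) G' that by blast
  then show ?thesis
    using has_field_derivative_transform_within[OF g(2)[OF x] zero_less_one x] by blast
qed

text \<open>By \<open>derivative_interpolation\<close>, convergence of \<open>f n\<close> and
  \<open>f'' n\<close> makes \<open>f' n\<close> uniformly Cauchy, so the first derivatives need no
  estimate of their own.\<close>

lemma C2_uniform_limit:
  fixes f f' f'' :: "nat \<Rightarrow> real \<Rightarrow> real"
  assumes ab: "\<alpha> < \<beta>"
    and f': "\<And>n x. x \<in> {\<alpha>..\<beta>} \<Longrightarrow> (f n has_real_derivative f' n x) (at x within {\<alpha>..\<beta>})"
    and f'': "\<And>n x. x \<in> {\<alpha>..\<beta>} \<Longrightarrow> (f' n has_real_derivative f'' n x) (at x within {\<alpha>..\<beta>})"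
    and lim: "uniform_limit {\<alpha>..\<beta>} f g sequentially"
    and lim'': "uniform_limit {\<alpha>..\<beta>} f'' h sequentially"
  obtains g' where "\<And>x. x \<in> {\<alpha>..\<beta>} \<Longrightarrow> (g has_real_derivative g' x) (at x within {\<alpha>..\<beta>})"
    "\<And>x. x \<in> {\<alpha>..\<beta>} \<Longrightarrow> (g' has_real_derivative h x) (at x within {\<alpha>..\<beta>})"
    "uniform_limit {\<alpha>..\<beta>} f' g' sequentially"
proof -
  have "uniformly_Cauchy_on {\<alpha>..\<beta>} f'"
  proof (rule uniformly_Cauchy_onI)
    fix e :: real assume "e > 0"
    \<comment> \<open>\<open>d * K\<close> is the interpolation bound for differences of size
      \<open>d\<close>; the choice of \<open>d\<close> makes it \<open>e / 2\<close>.\<close>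
    define K where "K = 2 / (\<beta> - \<alpha>) + (\<beta> - \<alpha>)"
    define d where "d = e / (2 * K)"
    have K: "K > 0" using ab by (simp add: add_pos_pos K_def)
    have d: "d > 0" using \<open>e > 0\<close> K by (simp add: d_def)
    have de: "d * K < e" using \<open>e > 0\<close> K by (simp add: d_def)
    have 1: "uniformly_Cauchy_on {\<alpha>..\<beta>} f" "uniformly_Cauchy_on {\<alpha>..\<beta>} f''"
      using lim lim'' by (auto intro!: uniformly_convergent_Cauchy simp: uniformly_convergent_on_def)
    obtain M1 where M1: "\<And>m n x. m \<ge> M1 \<Longrightarrow> n \<ge> M1 \<Longrightarrow> x \<in> {\<alpha>..\<beta>} \<Longrightarrow> dist (f m x) (f n x) < d"
      using d 1(1) unfolding uniformly_Cauchy_on_def by metis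
    obtain M2 where M2: "\<And>m n x. m \<ge> M2 \<Longrightarrow> n \<ge> M2 \<Longrightarrow> x \<in> {\<alpha>..\<beta>} \<Longrightarrow> dist (f'' m x) (f'' n x) < d"
      using d 1(2) unfolding uniformly_Cauchy_on_def by metis
    have "dist (f' m x) (f' n x) < e" if mn: "m \<ge> max M1 M2" "n \<ge> max M1 M2" and x: "x \<in> {\<alpha>..\<beta>}" for m n x
    proof -
      have "\<bar>f' m x - f' n x\<bar> \<le> 2 * d / (\<beta> - \<alpha>) + d * (\<beta> - \<alpha>)"
      proof (rule derivative_interpolation[where f="\<lambda>x. f m x - f n x" and f''="\<lambda>x. f'' m x - f'' n x", OF ab _ _ _ _ x])
        show "\<bar>f m y - f n y\<bar> \<le> d" if "y \<in> {\<alpha>..\<beta>}" for y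
          using M1[of m n y] mn that by (simp add: dist_real_def)
        show "\<bar>f'' m y - f'' n y\<bar> \<le> d" if "y \<in> {\<alpha>..\<beta>}" for y
          using M2[of m n y] mn that by (simp add: dist_real_def)
      qed (auto intro!: derivative_intros f' f'')
      also have "\<dots> = d * K" by (simp add: algebra_simps K_def)
      finally show ?thesis using de by (simp add: dist_real_def)
    qed
    then show "\<exists>M. \<forall>x\<in>{\<alpha>..\<beta>}. \<forall>m\<ge>M. \<forall>n\<ge>M. dist (f' m x) (f' n x) < e" by blast
  qed
  then obtain g' where g': "uniform_limit {\<alpha>..\<beta>} f' g' sequentially"
    by (meson Cauchy_uniformly_convergent uniformly_convergent_on_def)
  have key: "(G has_real_derivative H x) (at x within {\<alpha>..\<beta>})"
    if "\<And>n x. x \<in> {\<alpha>..\<beta>} \<Longrightarrow> (F n has_real_derivative F' n x) (at x within {\<alpha>..\<beta>})"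
      and "uniform_limit {\<alpha>..\<beta>} F G sequentially" "uniform_limit {\<alpha>..\<beta>} F' H sequentially" "x \<in> {\<alpha>..\<beta>}"
    for F F' :: "nat \<Rightarrow> real \<Rightarrow> real" and G H x
    by (rule derivative_uniform_limit[OF that(1) tendsto_uniform_limitI[OF that(2)] that(3,4)])
  show ?thesis
    by (rule that[of g']) (use key[OF f' lim g'] key[OF f'' g' lim''] g' in auto)
qed

text \<open>Compactness of \<open>K\<close> gives one neighbourhood of \<open>t\<close> that works
  for all \<open>x\<close>. This turns joint continuity into the uniform convergence that
  \<open>C2_uniform_limit\<close> asks for.\<close>

lemma continuous_on_Times_imp_uniform_limit:
  fixes u :: "real \<Rightarrow> real \<Rightarrow> real"
  assumes u: "continuous_on (K \<times> S) (\<lambda>(x, t). u x t)" and K: "compact K"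
    and s: "\<And>n. s n \<in> S" "t \<in> S" "s \<longlonglongrightarrow> t"
  shows "uniform_limit K (\<lambda>n x. u x (s n)) (\<lambda>x. u x t) sequentially"
proof (rule uniform_limitI)
  fix e :: real assume "e > 0"
  have c: "continuous_on (S \<times> K) (\<lambda>(t, x). u x t)"
    using continuous_on_compose2[OF u continuous_on_swap[of "S \<times> K"]]
    by (simp add: split_beta image_subset_iff)
  have "e / 2 > 0" using \<open>e > 0\<close> by simp
  from continuous_on_prod_compactE[OF c K s(2) this] obtain X where
    X: "t \<in> X" "open X" "\<forall>r\<in>X \<inter> S. \<forall>x\<in>K. dist (u x r) (u x t) \<le> e / 2" by auto
  have "\<forall>\<^sub>F n in sequentially. s n \<in> X"
    using topological_tendstoD[OF s(3) X(2,1)] .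
  then show "\<forall>\<^sub>F n in sequentially. \<forall>x\<in>K. dist (u x (s n)) (u x t) < e"
    by eventually_elim (use X(3) s \<open>e > 0\<close> in force)
qed

text \<open>Along times \<open>snd (s n)\<close> the sections of \<open>u\<close> and
  \<open>uxx\<close> converge uniformly near \<open>x\<close>, hence by
  \<open>C2_uniform_limit\<close> so do those of \<open>ux\<close>.\<close>

lemma continuous_on_partial_derivative:
  fixes u ux uxx :: "real \<Rightarrow> real \<Rightarrow> real"
  assumes d: "\<And>x t. x > 0 \<Longrightarrow> t \<in> J \<Longrightarrow> ((\<lambda>y. u y t) has_real_derivative ux x t) (at x)"
    "\<And>x t. x > 0 \<Longrightarrow> t \<in> J \<Longrightarrow> ((\<lambda>y. ux y t) has_real_derivative uxx x t) (at x)"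
    and c: "continuous_on ({0<..} \<times> J) (\<lambda>(x, t). u x t)"
      "continuous_on ({0<..} \<times> J) (\<lambda>(x, t). uxx x t)"
  shows "continuous_on ({0<..} \<times> J) (\<lambda>(x, t). ux x t)"
  unfolding continuous_on_sequentially
proof (intro allI ballI impI, elim conjE)
  fix z :: "real \<times> real" and s :: "nat \<Rightarrow> real \<times> real"
  assume z: "z \<in> {0<..} \<times> J" and s: "\<forall>n. s n \<in> {0<..} \<times> J" "s \<longlonglongrightarrow> z"
  obtain x t where xt: "z = (x, t)" "x > 0" "t \<in> J" using z by auto
  define \<alpha> \<beta> where "\<alpha> = x / 2" and "\<beta> = 2 * x"
  have ab: "0 < \<alpha>" "\<alpha> < x" "x < \<beta>" "\<alpha> < \<beta>" using xt by (auto simp: \<alpha>_def \<beta>_def)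
  have sub: "{\<alpha>..\<beta>} \<times> J \<subseteq> {0<..} \<times> J" using ab by auto
  have sJ: "\<And>n. snd (s n) \<in> J" using s by (metis mem_Times_iff)
  have s2: "(\<lambda>n. snd (s n)) \<longlonglongrightarrow> t" and s1: "(\<lambda>n. fst (s n)) \<longlonglongrightarrow> x"
    using tendsto_snd[OF s(2)] tendsto_fst[OF s(2)] xt by auto
  have L: "uniform_limit {\<alpha>..\<beta>} (\<lambda>n x. u x (snd (s n))) (\<lambda>x. u x t) sequentially"
    "uniform_limit {\<alpha>..\<beta>} (\<lambda>n x. uxx x (snd (s n))) (\<lambda>x. uxx x t) sequentially"
    by (rule continuous_on_Times_imp_uniform_limit[OF continuous_on_subset[OF c(1) sub] _ sJ xt(3) s2]
          continuous_on_Times_imp_uniform_limit[OF continuous_on_subset[OF c(2) sub] _ sJ xt(3) s2]; simp)+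
  obtain g' where g': "\<And>x. x \<in> {\<alpha>..\<beta>} \<Longrightarrow> ((\<lambda>x. u x t) has_real_derivative g' x) (at x within {\<alpha>..\<beta>})"
    "uniform_limit {\<alpha>..\<beta>} (\<lambda>n x. ux x (snd (s n))) g' sequentially"
    "\<And>x. x \<in> {\<alpha>..\<beta>} \<Longrightarrow> (g' has_real_derivative uxx x t) (at x within {\<alpha>..\<beta>})"
  proof (rule C2_uniform_limit[OF ab(4) _ _ L])
    show "((\<lambda>x. u x (snd (s n))) has_real_derivative ux y (snd (s n))) (at y within {\<alpha>..\<beta>})"
      "((\<lambda>x. ux x (snd (s n))) has_real_derivative uxx y (snd (s n))) (at y within {\<alpha>..\<beta>})"
      if "y \<in> {\<alpha>..\<beta>}" for n y
      using d[of y "snd (s n)"] that ab sJ by (auto intro: has_field_derivative_at_within)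
  qed blast
  have "continuous_on {\<alpha>..\<beta>} g'" by (rule DERIV_continuous_on[OF g'(3)])
  then have "isCont g' x" by (rule continuous_on_interior) (use ab(2,3) in simp)
  then have lg: "(\<lambda>n. g' (fst (s n))) \<longlonglongrightarrow> g' x" using s1 by (rule isCont_tendsto_compose)
  have ev: "\<forall>\<^sub>F n in sequentially. fst (s n) \<in> {\<alpha><..<\<beta>}"
    using topological_tendstoD[OF s1, of "{\<alpha><..<\<beta>}"] ab by auto
  have gx: "g' x = ux x t"
  proof -
    have "at x within {\<alpha>..\<beta>} = at x" by (rule at_within_interior) (use ab in auto)
    then show ?thesis using g'(1)[of x] d(1)[OF xt(2,3)] ab by (auto intro: DERIV_unique)
  qed
  \<comment> \<open>The space points move as well: uniform convergence handles the change of time at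
    the moving point, continuity of the limit \<open>g'\<close> handles the change of point.\<close>
  have "(\<lambda>n. ux (fst (s n)) (snd (s n)) - g' (fst (s n))) \<longlonglongrightarrow> 0"
  proof (rule tendstoI)
    fix e :: real assume "e > 0"
    from uniform_limitD[OF g'(2) this] ev
    show "\<forall>\<^sub>F n in sequentially. dist (ux (fst (s n)) (snd (s n)) - g' (fst (s n))) 0 < e"
      by eventually_elim (auto simp: dist_real_def)
  qed
  from tendsto_add[OF this lg] gx
  show "((\<lambda>(x, t). ux x t) \<circ> s) \<longlonglongrightarrow> (case z of (x, t) \<Rightarrow> ux x t)"
    by (simp add: split_beta xt o_def)
qed

subsection \<open>The parabolic maximum principle\<close>

text \<open>Subtracting \<open>\<epsilon> * t\<close> makes the inequality strict: at a positive
  maximum off the parabolic boundary the second space derivative is nonpositive, while the time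
  derivative of \<open>z\<close> is at least \<open>\<epsilon>\<close>. Then
  \<open>\<epsilon>\<close> tends to 0. The final time \<open>S\<close> is included, with a
  one-sided derivative.\<close>

lemma parabolic_maximum_principle:
  fixes z zx zxx zt :: "real \<Rightarrow> real \<Rightarrow> real" and a :: "real \<Rightarrow> real"
  assumes cont: "continuous_on ({\<alpha>..\<beta>} \<times> {0..S}) (\<lambda>(x, t). z x t)"
    and zx: "\<And>x t. \<alpha> < x \<Longrightarrow> x < \<beta> \<Longrightarrow> 0 < t \<Longrightarrow> t \<le> S \<Longrightarrow> ((\<lambda>y. z y t) has_real_derivative zx x t) (at x)"
    and zxx: "\<And>x t. \<alpha> < x \<Longrightarrow> x < \<beta> \<Longrightarrow> 0 < t \<Longrightarrow> t \<le> S \<Longrightarrow> ((\<lambda>y. zx y t) has_real_derivative zxx x t) (at x)"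
    and zt: "\<And>x t. \<alpha> < x \<Longrightarrow> x < \<beta> \<Longrightarrow> 0 < t \<Longrightarrow> t \<le> S \<Longrightarrow> ((\<lambda>s. z x s) has_real_derivative zt x t) (at t within {0<..S})"
    and sub: "\<And>x t. \<alpha> < x \<Longrightarrow> x < \<beta> \<Longrightarrow> 0 < t \<Longrightarrow> t \<le> S \<Longrightarrow> zt x t \<le> a x * zxx x t"
    and a: "\<And>x. \<alpha> < x \<Longrightarrow> x < \<beta> \<Longrightarrow> a x \<ge> 0"
    and left: "\<And>t. 0 \<le> t \<Longrightarrow> t \<le> S \<Longrightarrow> z \<alpha> t \<le> 0" and right: "\<And>t. 0 \<le> t \<Longrightarrow> t \<le> S \<Longrightarrow> z \<beta> t \<le> 0"
    and init: "\<And>x. \<alpha> \<le> x \<Longrightarrow> x \<le> \<beta> \<Longrightarrow> z x 0 \<le> 0"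
    and x: "x \<in> {\<alpha>..\<beta>}" and t: "t \<in> {0..S}"
  shows "z x t \<le> 0"
proof -
  have "z x t \<le> \<epsilon> * t" if "\<epsilon> > 0" for \<epsilon>
  proof -
    define w where "w = (\<lambda>(x, t). z x t - \<epsilon> * t)"
    have "continuous_on ({\<alpha>..\<beta>} \<times> {0..S}) w"
      using cont unfolding w_def by (auto simp: split_beta intro!: continuous_intros)
    moreover have "compact ({\<alpha>..\<beta>} \<times> {0..S})" by (intro compact_Times) auto
    moreover have "{\<alpha>..\<beta>} \<times> {0..S} \<noteq> {}" using x t by auto
    ultimately obtain p where p: "p \<in> {\<alpha>..\<beta>} \<times> {0..S}" "\<And>q. q \<in> {\<alpha>..\<beta>} \<times> {0..S} \<Longrightarrow> w q \<le> w p"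
      using continuous_attains_sup by metis
    obtain x0 t0 where p0: "p = (x0, t0)" "x0 \<in> {\<alpha>..\<beta>}" "t0 \<in> {0..S}" using p(1) by auto
    have max: "z y s - \<epsilon> * s \<le> z x0 t0 - \<epsilon> * t0" if "y \<in> {\<alpha>..\<beta>}" "s \<in> {0..S}" for y s
      using p(2)[of "(y, s)"] that by (simp add: w_def p0)
    have "z x0 t0 - \<epsilon> * t0 \<le> 0"
    proof (rule ccontr)
      assume "\<not> ?thesis"
      then have pos: "z x0 t0 - \<epsilon> * t0 > 0" by simp
      then have zpos: "z x0 t0 > 0" using \<open>\<epsilon> > 0\<close> p0 by (smt (verit) atLeastAtMost_iff mult_nonneg_nonneg)
      have t0: "0 < t0" "t0 \<le> S" using zpos init[of x0] p0 by (auto simp: less_le)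
      have x0: "\<alpha> < x0" "x0 < \<beta>" using zpos left[of t0] right[of t0] p0 by (auto simp: less_le)
      have 1: "zxx x0 t0 \<le> 0"
      proof (rule second_derivative_nonpos_at_local_max)
        show "min (x0 - \<alpha>) (\<beta> - x0) > 0" using x0 by simp
        show "((\<lambda>y. z y t0) has_real_derivative zx y t0) (at y)" if "\<bar>y - x0\<bar> < min (x0 - \<alpha>) (\<beta> - x0)" for y
          using zx[of y t0] that t0 by auto
        show "((\<lambda>y. zx y t0) has_real_derivative zxx x0 t0) (at x0)" using zxx x0 t0 by auto
        show "z y t0 \<le> z x0 t0" if "\<bar>y - x0\<bar> < min (x0 - \<alpha>) (\<beta> - x0)" for y
          using max[of y t0] that t0 by (auto simp: abs_if split: if_splits)
      qed
      have d: "((\<lambda>s. z x0 s - \<epsilon> * s) has_real_derivative zt x0 t0 - \<epsilon>) (at t0 within {0<..S})"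
        using zt[OF x0 t0] by (auto intro!: derivative_eq_intros)
      \<comment> \<open>Only earlier times \<open>t0 - h\<close> are compared, so a maximum at
        \<open>t0 = S\<close> is covered.\<close>
      have "zt x0 t0 - \<epsilon> \<ge> 0"
      proof (rule ccontr)
        assume "\<not> ?thesis"
        then obtain d where d: "d > 0" "\<And>h. h > 0 \<Longrightarrow> t0 - h \<in> {0<..S} \<Longrightarrow> h < d \<Longrightarrow>
            z x0 t0 - \<epsilon> * t0 < z x0 (t0 - h) - \<epsilon> * (t0 - h)"
          using has_real_derivative_neg_dec_left[OF d] by auto
        define h where "h = min d t0 / 2"
        have "0 < h" "h < d" "h < t0" using d(1) t0 by (auto simp: h_def)
        then show False using d(2)[of h] max[of x0 "t0 - h"] t0 p0 by auto
      qed
      then have "zt x0 t0 > 0" using \<open>\<epsilon> > 0\<close> by simp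
      moreover have "zt x0 t0 \<le> a x0 * zxx x0 t0" using sub x0 t0 by auto
      moreover have "a x0 * zxx x0 t0 \<le> 0" using a[of x0] x0 1 by (simp add: mult_nonneg_nonpos)
      ultimately show False by simp
    qed
    then show ?thesis using max[OF x t] by simp
  qed
  then have "z x t \<le> 0 + e" if "e > 0" for e
  proof -
    define \<epsilon> where "\<epsilon> = e / (\<bar>t\<bar> + 1)"
    have "\<epsilon> > 0" using that by (simp add: \<epsilon>_def)
    then have "z x t \<le> \<epsilon> * t" by fact
    also have "\<dots> \<le> \<epsilon> * (\<bar>t\<bar> + 1)" using \<open>\<epsilon> > 0\<close> by (intro mult_left_mono) auto
    also have "\<dots> = e" by (simp add: \<epsilon>_def)
    finally show ?thesis by simp
  qed
  then show ?thesis by (rule field_le_epsilon)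
qed

text \<open>\<open>v\<close> stands for \<open>u_t\<close>, and the second space derivative is
  written \<open>v / a\<close>, so the equation is built in. Derivatives are taken within
  \<open>X\<close> and \<open>J\<close>, hence one-sided at included end points. Joint continuity is
  kept separate.\<close>

definition heat_solution ::
  "(real \<Rightarrow> real) \<Rightarrow> real set \<Rightarrow> real set \<Rightarrow> (real \<Rightarrow> real \<Rightarrow> real) \<Rightarrow> (real \<Rightarrow> real \<Rightarrow> real) \<Rightarrow> (real \<Rightarrow> real \<Rightarrow> real) \<Rightarrow> bool"
where
  "heat_solution a X J u ux v \<longleftrightarrow> (\<forall>x\<in>X. \<forall>t\<in>J.
     ((\<lambda>y. u y t) has_real_derivative ux x t) (at x within X) \<and>
     ((\<lambda>y. ux y t) has_real_derivative v x t / a x) (at x within X) \<and>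
     ((\<lambda>s. u x s) has_real_derivative v x t) (at t within J))"

lemma heat_solutionD:
  assumes "heat_solution a X J u ux v" "x \<in> X" "t \<in> J"
  shows "((\<lambda>y. u y t) has_real_derivative ux x t) (at x within X)"
    "((\<lambda>y. ux y t) has_real_derivative v x t / a x) (at x within X)"
    "((\<lambda>s. u x s) has_real_derivative v x t) (at t within J)"
  using assms(1)[unfolded heat_solution_def, rule_format, OF assms(2,3)] by simp_all

lemma heat_solutionI:
  assumes "\<And>x t. x \<in> X \<Longrightarrow> t \<in> J \<Longrightarrow> ((\<lambda>y. u y t) has_real_derivative ux x t) (at x within X)"
    "\<And>x t. x \<in> X \<Longrightarrow> t \<in> J \<Longrightarrow> ((\<lambda>y. ux y t) has_real_derivative v x t / a x) (at x within X)"
    "\<And>x t. x \<in> X \<Longrightarrow> t \<in> J \<Longrightarrow> ((\<lambda>s. u x s) has_real_derivative v x t) (at t within J)"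
  shows "heat_solution a X J u ux v"
  unfolding heat_solution_def by (intro ballI conjI assms)

lemma heat_solution_subset:
  assumes "heat_solution a X J u ux v" "X' \<subseteq> X" "J' \<subseteq> J"
  shows "heat_solution a X' J' u ux v"
proof (rule heat_solutionI)
  fix x t assume xt: "x \<in> X'" "t \<in> J'"
  then have xt': "x \<in> X" "t \<in> J" using assms by auto
  note D = heat_solutionD[OF assms(1) xt']
  show "((\<lambda>y. u y t) has_real_derivative ux x t) (at x within X')"
    "((\<lambda>y. ux y t) has_real_derivative v x t / a x) (at x within X')"
    "((\<lambda>s. u x s) has_real_derivative v x t) (at t within J')"
    by (rule DERIV_subset[OF D(1) assms(2)] DERIV_subset[OF D(2) assms(2)] DERIV_subset[OF D(3) assms(3)])+
qed

lemma heat_solution_uminus: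
  assumes "heat_solution a X J u ux v"
  shows "heat_solution a X J (\<lambda>x t. - u x t) (\<lambda>x t. - ux x t) (\<lambda>x t. - v x t)"
proof (rule heat_solutionI)
  fix x t assume xt: "x \<in> X" "t \<in> J"
  note D = heat_solutionD[OF assms xt]
  show "((\<lambda>y. - u y t) has_real_derivative - ux x t) (at x within X)"
    "((\<lambda>y. - ux y t) has_real_derivative - v x t / a x) (at x within X)"
    "((\<lambda>s. - u x s) has_real_derivative - v x t) (at t within J)"
    using D[THEN DERIV_minus] by simp_all
qed

lemma heat_solution_add:
  assumes "heat_solution a X J u ux v" "heat_solution a X J u' ux' v'"
  shows "heat_solution a X J (\<lambda>x t. u x t + u' x t) (\<lambda>x t. ux x t + ux' x t) (\<lambda>x t. v x t + v' x t)"
proof (rule heat_solutionI)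
  fix x t assume xt: "x \<in> X" "t \<in> J"
  note D = heat_solutionD[OF assms(1) xt] and D' = heat_solutionD[OF assms(2) xt]
  show "((\<lambda>y. u y t + u' y t) has_real_derivative ux x t + ux' x t) (at x within X)"
    "((\<lambda>y. ux y t + ux' y t) has_real_derivative (v x t + v' x t) / a x) (at x within X)"
    "((\<lambda>s. u x s + u' x s) has_real_derivative v x t + v' x t) (at t within J)"
    unfolding add_divide_distrib by (rule DERIV_add D D')+
qed

lemma heat_solution_diff:
  assumes "heat_solution a X J u ux v" "heat_solution a X J u' ux' v'"
  shows "heat_solution a X J (\<lambda>x t. u x t - u' x t) (\<lambda>x t. ux x t - ux' x t) (\<lambda>x t. v x t - v' x t)"
  using heat_solution_add[OF assms(1) heat_solution_uminus[OF assms(2)]] by simp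

text \<open>\<open>b + \<delta> * exp (\<kappa> * t) * \<psi>\<close> is a supersolution: a concave
  \<open>b\<close> is one by itself, and the growth of the exponential pays for
  \<open>a * \<psi>'' \<le> \<kappa> * \<psi>\<close>. In applications \<open>b\<close> bounds the
  data, and \<open>\<psi>\<close> absorbs what is unknown at a far boundary.\<close>

lemma comparison_upper:
  assumes sol: "heat_solution a {\<alpha><..<\<beta>} {0<..S} u ux v" and apos: "\<And>x. \<alpha> < x \<Longrightarrow> x < \<beta> \<Longrightarrow> a x > 0"
    and cu: "continuous_on ({\<alpha>..\<beta>} \<times> {0..S}) (\<lambda>(x, t). u x t)"
    and b: "\<And>x. \<alpha> < x \<Longrightarrow> x < \<beta> \<Longrightarrow> (b has_real_derivative b' x) (at x)"
      "\<And>x. \<alpha> < x \<Longrightarrow> x < \<beta> \<Longrightarrow> (b' has_real_derivative b'' x) (at x)"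
      "\<And>x. \<alpha> < x \<Longrightarrow> x < \<beta> \<Longrightarrow> b'' x \<le> 0" and cb: "continuous_on {\<alpha>..\<beta>} b"
    and p: "\<And>x. \<alpha> < x \<Longrightarrow> x < \<beta> \<Longrightarrow> (\<psi> has_real_derivative \<psi>' x) (at x)"
      "\<And>x. \<alpha> < x \<Longrightarrow> x < \<beta> \<Longrightarrow> (\<psi>' has_real_derivative \<psi>'' x) (at x)"
      "\<And>x. \<alpha> < x \<Longrightarrow> x < \<beta> \<Longrightarrow> a x * \<psi>'' x \<le> \<kappa> * \<psi> x" and cp: "continuous_on {\<alpha>..\<beta>} \<psi>"
    and ppos: "\<And>x. \<alpha> \<le> x \<Longrightarrow> x \<le> \<beta> \<Longrightarrow> \<psi> x \<ge> 0" and k: "\<kappa> \<ge> 0" and d: "\<delta> \<ge> 0"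
    and left: "\<And>t. 0 \<le> t \<Longrightarrow> t \<le> S \<Longrightarrow> u \<alpha> t \<le> b \<alpha> + \<delta> * \<psi> \<alpha>"
    and right: "\<And>t. 0 \<le> t \<Longrightarrow> t \<le> S \<Longrightarrow> u \<beta> t \<le> b \<beta> + \<delta> * \<psi> \<beta>"
    and init: "\<And>x. \<alpha> \<le> x \<Longrightarrow> x \<le> \<beta> \<Longrightarrow> u x 0 \<le> b x + \<delta> * \<psi> x"
    and x: "x \<in> {\<alpha>..\<beta>}" and t: "t \<in> {0..S}"
  shows "u x t \<le> b x + \<delta> * exp (\<kappa> * t) * \<psi> x"
proof -
  \<comment> \<open>The boundary hypotheses carry no exponential; it is at least 1, so inserting it
    only enlarges their right-hand sides.\<close>
  have E: "\<delta> * \<psi> y \<le> \<delta> * exp (\<kappa> * s) * \<psi> y" if "\<alpha> \<le> y" "y \<le> \<beta>" "0 \<le> s" for y s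
  proof -
    have "1 \<le> exp (\<kappa> * s)" using k that by simp
    then have "1 * (\<delta> * \<psi> y) \<le> exp (\<kappa> * s) * (\<delta> * \<psi> y)"
      using d ppos that by (intro mult_right_mono) auto
    then show ?thesis by (simp add: mult_ac)
  qed
  have "u x t - b x - \<delta> * exp (\<kappa> * t) * \<psi> x \<le> 0"
  proof (rule parabolic_maximum_principle[where z="\<lambda>x t. u x t - b x - \<delta> * exp (\<kappa> * t) * \<psi> x"
        and zx="\<lambda>x t. ux x t - b' x - \<delta> * exp (\<kappa> * t) * \<psi>' x"
        and zxx="\<lambda>x t. v x t / a x - b'' x - \<delta> * exp (\<kappa> * t) * \<psi>'' x"
        and zt="\<lambda>x t. v x t - \<delta> * (\<kappa> * exp (\<kappa> * t)) * \<psi> x" and a = a and S=S, OF _ _ _ _ _ _ _ _ _ x t])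
    have "continuous_on ({\<alpha>..\<beta>} \<times> {0..S}) (\<lambda>z. b (fst z))" "continuous_on ({\<alpha>..\<beta>} \<times> {0..S}) (\<lambda>z. \<psi> (fst z))"
      by (rule continuous_on_compose2[OF cb] continuous_on_compose2[OF cp]; auto intro!: continuous_intros)+
    then show "continuous_on ({\<alpha>..\<beta>} \<times> {0..S}) (\<lambda>(x, t). u x t - b x - \<delta> * exp (\<kappa> * t) * \<psi> x)"
      using cu by (auto simp: split_beta intro!: continuous_intros)
  next
    fix x t assume xt: "\<alpha> < x" "x < \<beta>" "0 < t" "t \<le> S"
    have at: "at x within {\<alpha><..<\<beta>} = at x" by (rule at_within_open) (use xt in auto)
    have s: "((\<lambda>y. u y t) has_real_derivative ux x t) (at x)" "((\<lambda>y. ux y t) has_real_derivative v x t / a x) (at x)"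
        "((\<lambda>s. u x s) has_real_derivative v x t) (at t within {0<..S})"
      using heat_solutionD[OF sol, of x t] xt at by simp_all
    show "((\<lambda>y. u y t - b y - \<delta> * exp (\<kappa> * t) * \<psi> y) has_real_derivative ux x t - b' x - \<delta> * exp (\<kappa> * t) * \<psi>' x) (at x)"
      using xt by (auto intro!: derivative_eq_intros s b p)
    show "((\<lambda>y. ux y t - b' y - \<delta> * exp (\<kappa> * t) * \<psi>' y) has_real_derivative v x t / a x - b'' x - \<delta> * exp (\<kappa> * t) * \<psi>'' x) (at x)"
      using xt by (auto intro!: derivative_eq_intros s b p)
    show "((\<lambda>t. u x t - b x - \<delta> * exp (\<kappa> * t) * \<psi> x) has_real_derivative v x t - \<delta> * (\<kappa> * exp (\<kappa> * t)) * \<psi> x) (at t within {0<..S})"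
      by (auto intro!: derivative_eq_intros s)
    have "\<delta> * exp (\<kappa> * t) * (a x * \<psi>'' x) \<le> \<delta> * exp (\<kappa> * t) * (\<kappa> * \<psi> x)"
      using p(3)[OF xt(1,2)] d by (intro mult_left_mono) auto
    moreover have "a x * b'' x \<le> 0" using b(3)[OF xt(1,2)] apos[OF xt(1,2)] by (simp add: mult_nonneg_nonpos)
    ultimately show "v x t - \<delta> * (\<kappa> * exp (\<kappa> * t)) * \<psi> x \<le> a x * (v x t / a x - b'' x - \<delta> * exp (\<kappa> * t) * \<psi>'' x)"
      using apos[OF xt(1,2)] by (simp add: algebra_simps)
  next
    show "0 \<le> a x" if "\<alpha> < x" "x < \<beta>" for x using apos that by (simp add: less_imp_le)
    have ab: "\<alpha> \<le> \<beta>" using x by auto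
    show "u \<alpha> t - b \<alpha> - \<delta> * exp (\<kappa> * t) * \<psi> \<alpha> \<le> 0" if "0 \<le> t" "t \<le> S" for t
      using left[OF that] E[of \<alpha> t] that ab by auto
    show "u \<beta> t - b \<beta> - \<delta> * exp (\<kappa> * t) * \<psi> \<beta> \<le> 0" if "0 \<le> t" "t \<le> S" for t
      using right[OF that] E[of \<beta> t] that ab by auto
    show "u x 0 - b x - \<delta> * exp (\<kappa> * 0) * \<psi> x \<le> 0" if "\<alpha> \<le> x" "x \<le> \<beta>" for x
      using init[OF that] by simp
  qed
  then show ?thesis by simp
qed

lemma comparison_concave:
  assumes sol: "heat_solution a {\<alpha><..<\<beta>} {0<..S} u ux v" and apos: "\<And>x. \<alpha> < x \<Longrightarrow> x < \<beta> \<Longrightarrow> a x > 0"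
    and cu: "continuous_on ({\<alpha>..\<beta>} \<times> {0..S}) (\<lambda>(x, t). u x t)"
    and b: "\<And>x. \<alpha> < x \<Longrightarrow> x < \<beta> \<Longrightarrow> (b has_real_derivative b' x) (at x)"
      "\<And>x. \<alpha> < x \<Longrightarrow> x < \<beta> \<Longrightarrow> (b' has_real_derivative b'' x) (at x)"
      "\<And>x. \<alpha> < x \<Longrightarrow> x < \<beta> \<Longrightarrow> b'' x \<le> 0" and cb: "continuous_on {\<alpha>..\<beta>} b"
    and left: "\<And>t. 0 \<le> t \<Longrightarrow> t \<le> S \<Longrightarrow> u \<alpha> t \<le> b \<alpha>"
    and right: "\<And>t. 0 \<le> t \<Longrightarrow> t \<le> S \<Longrightarrow> u \<beta> t \<le> b \<beta>"
    and init: "\<And>x. \<alpha> \<le> x \<Longrightarrow> x \<le> \<beta> \<Longrightarrow> u x 0 \<le> b x"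
    and x: "x \<in> {\<alpha>..\<beta>}" and t: "t \<in> {0..S}"
  shows "u x t \<le> b x"
  using comparison_upper[OF sol apos cu b cb, where \<delta>=0 and \<kappa>=0 and \<psi>="\<lambda>_. 0" and \<psi>'="\<lambda>_. 0" and \<psi>''="\<lambda>_. 0"]
    left right init x t by auto

subsection \<open>Semigroups generated by contractive resolvents\<close>

lemma funpow_linear:
  fixes A :: "'a::real_vector \<Rightarrow> 'a"
  assumes "linear A" shows "linear (A ^^ n)"
proof (induction n)
  case (Suc n)
  show ?case unfolding funpow.simps by (rule linear_compose[OF Suc assms])
qed (simp add: linear_iff)

lemma funpow_contraction:
  fixes A :: "'a::real_normed_vector \<Rightarrow> 'a"
  assumes "\<And>x. norm (A x) \<le> norm x"
  shows "norm ((A ^^ n) x) \<le> norm x"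
  by (induction n) (auto intro: order_trans[OF assms])

lemma funpow_commute:
  assumes "\<And>x. A (C x) = C (A x)"
  shows "(A ^^ n) (C x) = C ((A ^^ n) x)"
  by (induction n) (auto simp: assms)

text \<open>Telescoping: each of the \<open>n\<close> exchanges of a factor \<open>A\<close> for a
  factor \<open>C\<close> costs at most \<open>norm (A x - C x)\<close>, since the other factors
  commute and are contractions.\<close>

lemma funpow_diff_contraction:
  fixes A C :: "'a::real_normed_vector \<Rightarrow> 'a"
  assumes A: "linear A" "\<And>x. norm (A x) \<le> norm x" and C: "linear C" "\<And>x. norm (C x) \<le> norm x"
    and comm: "\<And>x. A (C x) = C (A x)"
  shows "norm ((A ^^ n) x - (C ^^ n) x) \<le> n * norm (A x - C x)"
proof (induction n)
  case (Suc n)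
  have "(A ^^ Suc n) x - (C ^^ Suc n) x = (A ^^ n) (A x - C x) + C ((A ^^ n) x - (C ^^ n) x)"
    using funpow_commute[of A C, OF comm, of n x]
    by (simp add: funpow_swap1 linear_diff[OF funpow_linear[OF A(1)]] linear_diff[OF C(1)])
  then have "norm ((A ^^ Suc n) x - (C ^^ Suc n) x) \<le> norm ((A ^^ n) (A x - C x)) + norm (C ((A ^^ n) x - (C ^^ n) x))"
    by (simp only: norm_triangle_ineq)
  also have "\<dots> \<le> norm (A x - C x) + n * norm (A x - C x)"
    using funpow_contraction[of A, OF A(2)] order_trans[OF C(2) Suc] by (intro add_mono)
  finally show ?case by (simp add: algebra_simps)
qed simp

text \<open>A discrete Taylor formula. The hypothesis on \<open>x\<close> is the resolvent identity
  for two step sizes that differ by \<open>e\<close>. With \<open>n * e\<close> equal to a fixed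
  time difference, the remainder is quadratic in that difference and does not deteriorate as
  \<open>n\<close> grows.\<close>

lemma funpow_diff_contraction_second_order:
  fixes A C :: "'a::real_normed_vector \<Rightarrow> 'a"
  assumes A: "linear A" "\<And>x. norm (A x) \<le> norm x" and C: "linear C" "\<And>x. norm (C x) \<le> norm x"
    and comm: "\<And>x. A (C x) = C (A x)"
    and x: "A x - C x = e *\<^sub>R A (C w)" and w: "norm (A w - C w) \<le> \<bar>e\<bar> * m"
  shows "norm ((A ^^ n) x - (C ^^ n) x - (n * e) *\<^sub>R (C ^^ Suc n) w) \<le> (real n)\<^sup>2 * (e\<^sup>2 * m)"
proof (induction n)
  case (Suc n)
  let ?T = "\<lambda>n. (A ^^ n) x - (C ^^ n) x - (n * e) *\<^sub>R (C ^^ Suc n) w"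
  have m: "0 \<le> e\<^sup>2 * m"
  proof -
    have "0 \<le> \<bar>e\<bar> * m" using w norm_ge_zero order_trans by blast
    then have "0 \<le> \<bar>e\<bar> * (\<bar>e\<bar> * m)" by (rule mult_nonneg_nonneg[OF abs_ge_zero])
    moreover have "\<bar>e\<bar> * (\<bar>e\<bar> * m) = e\<^sup>2 * m" by (simp add: power2_eq_square mult.assoc[symmetric])
    ultimately show ?thesis by (simp only:)
  qed
  have AC: "(A ^^ n) (C y) = C ((A ^^ n) y)" for y using funpow_commute[of A C, OF comm] .
  have "(A ^^ Suc n) x = (A ^^ n) (A x)" by (simp add: funpow_swap1)
  also have "A x = C x + e *\<^sub>R A (C w)" using x by (simp add: algebra_simps)
  also have "(A ^^ n) (C x + e *\<^sub>R A (C w)) = C ((A ^^ n) x) + e *\<^sub>R (A ^^ Suc n) (C w)"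
    unfolding linear_add[OF funpow_linear[OF A(1)]] linear_scale[OF funpow_linear[OF A(1)]] AC
    by (simp add: funpow_swap1)
  finally have "?T (Suc n) = C (?T n) + e *\<^sub>R ((A ^^ Suc n) (C w) - (C ^^ Suc n) (C w))"
    by (simp add: linear_diff[OF C(1)] linear_add[OF C(1)] linear_scale[OF C(1)] funpow_swap1 algebra_simps)
  then have "norm (?T (Suc n)) \<le> norm (C (?T n)) + norm (e *\<^sub>R ((A ^^ Suc n) (C w) - (C ^^ Suc n) (C w)))"
    by (simp only: norm_triangle_ineq)
  also have "norm (C (?T n)) \<le> (real n)\<^sup>2 * (e\<^sup>2 * m)" using order_trans[OF C(2) Suc] .
  also have "norm (e *\<^sub>R ((A ^^ Suc n) (C w) - (C ^^ Suc n) (C w))) \<le> \<bar>e\<bar> * (Suc n * (\<bar>e\<bar> * m))"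
  proof -
    have "norm ((A ^^ Suc n) (C w) - (C ^^ Suc n) (C w)) \<le> Suc n * norm (A (C w) - C (C w))"
      by (rule funpow_diff_contraction) (use A C comm in auto)
    also have "A (C w) - C (C w) = C (A w - C w)" by (simp add: comm linear_diff[OF C(1)])
    also have "Suc n * norm (C (A w - C w)) \<le> Suc n * (\<bar>e\<bar> * m)"
      using order_trans[OF C(2) w] by (intro mult_left_mono) auto
    finally show ?thesis by (simp add: mult_left_mono)
  qed
  finally have "norm (?T (Suc n)) \<le> (real n)\<^sup>2 * (e\<^sup>2 * m) + \<bar>e\<bar> * (Suc n * (\<bar>e\<bar> * m))" by simp
  also have "\<bar>e\<bar> * (Suc n * (\<bar>e\<bar> * m)) = Suc n * (e\<^sup>2 * m)" by (simp add: power2_eq_square)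
  also have "(real n)\<^sup>2 * (e\<^sup>2 * m) + Suc n * (e\<^sup>2 * m) = ((real n)\<^sup>2 + Suc n) * (e\<^sup>2 * m)"
    by (simp add: algebra_simps)
  \<comment> \<open>The induction closes because \<open>n^2 + n + 1\<close> is at most
    \<open>(n + 1)^2\<close>.\<close>
  also have "\<dots> \<le> (real (Suc n))\<^sup>2 * (e\<^sup>2 * m)"
    using m by (intro mult_right_mono) (auto simp: power2_eq_square algebra_simps)
  finally show ?case .
qed simp

text \<open>\<open>J h\<close> plays the role of \<open>(1 - h L)\<^sup>-\<^sup>1\<close> for an unbounded operator \<open>L\<close>; its domain is the
  range of \<open>J l\<close>, and \<open>B = L \<circ> J l\<close> is bounded.\<close>

locale resolvent_family =
  fixes J :: "real \<Rightarrow> 'a::banach \<Rightarrow> 'a" and l :: real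
  assumes l: "l > 0"
    and lin: "h \<ge> 0 \<Longrightarrow> linear (J h)"
    and contr: "h \<ge> 0 \<Longrightarrow> norm (J h x) \<le> norm x"
    and J0: "J 0 x = x"
    and comm: "h \<ge> 0 \<Longrightarrow> k \<ge> 0 \<Longrightarrow> J h (J k x) = J k (J h x)"
    and resolvent: "h \<ge> 0 \<Longrightarrow> k \<ge> 0 \<Longrightarrow>
      J h (J l x) - J k (J l x) = (h - k) *\<^sub>R J h (J k ((J l x - x) /\<^sub>R l))"
begin

abbreviation "R \<equiv> J l"
definition "B x = (R x - x) /\<^sub>R l"
text \<open>Backward Euler with \<open>2 ^ k\<close> steps. Dyadic numbers of steps make each
  refinement a comparison of two steps \<open>J h\<close> with one step
  \<open>J (2 * h)\<close>.\<close>

definition "euler t k = J (t / 2 ^ k) ^^ (2 ^ k)"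
text \<open>\<open>lim\<close> is meaningful only where the scheme converges. This is shown for
  arguments \<open>R (R y)\<close>, and \<open>P\<close> is used only for those.\<close>

definition "P t x = lim (\<lambda>k. euler t k x)"

lemma l0: "l \<ge> 0" using l by simp

lemma R_diff: "R (x - y) = R x - R y" and R_scale: "R (c *\<^sub>R x) = c *\<^sub>R R x"
  using lin[OF l0] by (simp_all add: linear_diff linear_scale)

lemma BR: "B (R x) = R (B x)"
  by (simp add: B_def R_scale R_diff)

lemma J_diff: "h \<ge> 0 \<Longrightarrow> k \<ge> 0 \<Longrightarrow> J h (R x) - J k (R x) = (h - k) *\<^sub>R J h (J k (B x))"
  using resolvent by (simp add: B_def)

lemma norm_J_diff: assumes "h \<ge> 0" "k \<ge> 0" shows "norm (J h (R x) - J k (R x)) \<le> \<bar>h - k\<bar> * norm (B x)"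
proof -
  have "norm (J h (J k (B x))) \<le> norm (B x)" using contr[OF assms(1)] contr[OF assms(2)] order_trans by blast
  then show ?thesis using assms by (simp add: J_diff mult_left_mono)
qed

text \<open>\<open>R (R y)\<close> lies in the domain of \<open>L^2\<close>, and \<open>?w\<close>
  is \<open>L\<close> applied to it. There two steps of size \<open>h\<close> and one of size
  \<open>2 * h\<close> differ only in second order, by repeated use of the resolvent
  identity.\<close>

lemma J_halving:
  assumes h: "h \<ge> 0"
  shows "norm ((J h ^^ 2) (R (R y)) - J (2 * h) (R (R y))) \<le> h\<^sup>2 * norm (B (B y))"
proof -
  let ?x = "R (R y)" and ?w = "R (B y)"
  have "J h ?x - J (2 * h) ?x = - h *\<^sub>R J h (J (2 * h) ?w)"
    using J_diff[of h "2 * h" "R y"] h by (simp add: BR)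
  moreover have "J h ?x - ?x = h *\<^sub>R J h ?w"
    using J_diff[of h 0 "R y"] h by (simp add: BR J0)
  then have "J h (J h ?x - ?x) = J h (h *\<^sub>R J h ?w)" by simp
  then have "J h (J h ?x) - J h ?x = h *\<^sub>R J h (J h ?w)"
    using lin[OF h] by (simp add: linear_diff linear_scale)
  ultimately have "J h (J h ?x) - J (2 * h) ?x = h *\<^sub>R J h (J h ?w) - h *\<^sub>R J h (J (2 * h) ?w)"
    by (simp add: algebra_simps)
  also have "\<dots> = h *\<^sub>R J h (J h ?w - J (2 * h) ?w)"
    using lin[OF h] by (simp add: linear_diff scaleR_diff_right)
  finally have "norm (J h (J h ?x) - J (2 * h) ?x) = h * norm (J h (J h ?w - J (2 * h) ?w))"
    using h by simp
  also have "\<dots> \<le> h * norm (J h ?w - J (2 * h) ?w)" using h contr[OF h] by (intro mult_left_mono) auto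
  also have "\<dots> \<le> h * (\<bar>h - 2 * h\<bar> * norm (B (B y)))"
    using h norm_J_diff[of h "2 * h"] by (intro mult_left_mono) auto
  finally show ?thesis using h by (simp add: numeral_2_eq_2 power2_eq_square)
qed

lemma euler_linear: "t \<ge> 0 \<Longrightarrow> linear (euler t k)"
  unfolding euler_def by (intro funpow_linear lin) auto

lemma euler_contr: "t \<ge> 0 \<Longrightarrow> norm (euler t k x) \<le> norm x"
  unfolding euler_def by (intro funpow_contraction contr) auto

lemma euler_comm: "t \<ge> 0 \<Longrightarrow> h \<ge> 0 \<Longrightarrow> euler t k (J h x) = J h (euler t k x)"
  unfolding euler_def by (intro funpow_commute comm) auto

text \<open>\<open>2 ^ k\<close> halvings with \<open>h = t / 2 ^ Suc k\<close> cost
  \<open>2 ^ k * h\<^sup>2\<close>, which is a summable geometric sequence in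
  \<open>k\<close>.\<close>

lemma euler_step:
  assumes t: "t \<ge> 0"
  shows "norm (euler t (Suc k) (R (R y)) - euler t k (R (R y))) \<le> t\<^sup>2 * norm (B (B y)) * (1/2) ^ k"
proof -
  define h where "h = t / 2 ^ Suc k"
  have h: "h \<ge> 0" "2 * h = t / 2 ^ k" using t by (auto simp: h_def)
  have "euler t (Suc k) = (J h ^^ 2) ^^ (2 ^ k)"
    unfolding euler_def h_def by (simp add: funpow_mult mult.commute)
  then have "norm (euler t (Suc k) (R (R y)) - euler t k (R (R y)))
     = norm (((J h ^^ 2) ^^ (2 ^ k)) (R (R y)) - (J (2 * h) ^^ (2 ^ k)) (R (R y)))"
    by (simp add: euler_def h(2))
  also have "\<dots> \<le> (2 ^ k) * norm ((J h ^^ 2) (R (R y)) - J (2 * h) (R (R y)))"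
    using funpow_diff_contraction[of "J h ^^ 2" "J (2 * h)" "2 ^ k" "R (R y)"]
      funpow_linear[OF lin] funpow_contraction[of "J h", OF contr] lin contr h
      funpow_commute[of "J h" "J (2 * h)" 2] comm by simp
  also have "\<dots> \<le> 2 ^ k * (h\<^sup>2 * norm (B (B y)))"
    by (intro mult_left_mono J_halving h) auto
  also have "2 ^ k * h\<^sup>2 = t\<^sup>2 * (1/2) ^ k / 4"
    by (simp add: h_def field_simps power2_eq_square)
  then have "2 ^ k * (h\<^sup>2 * norm (B (B y))) = (t\<^sup>2 * (1/2) ^ k / 4) * norm (B (B y))"
    by (simp only: mult.assoc[symmetric])
  also have "\<dots> \<le> t\<^sup>2 * norm (B (B y)) * (1/2) ^ k" by (simp add: field_simps)
  finally show ?thesis by simp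
qed

lemma euler_tendsto:
  assumes t: "t \<ge> 0"
  shows "(\<lambda>k. euler t k (R (R y))) \<longlonglongrightarrow> P t (R (R y))"
proof -
  let ?x = "R (R y)"
  have "summable (\<lambda>k. euler t (Suc k) ?x - euler t k ?x)"
    by (rule summable_comparison_test'[where N=0, OF _ euler_step[OF t]]) (auto intro: summable_mult)
  then have "convergent (\<lambda>n. \<Sum>k<n. euler t (Suc k) ?x - euler t k ?x)"
    by (simp add: summable_iff_convergent)
  also have "(\<lambda>n. \<Sum>k<n. euler t (Suc k) ?x - euler t k ?x) = (\<lambda>n. euler t n ?x - euler t 0 ?x)"
    by (rule ext) (rule sum_lessThan_telescope)
  finally have "convergent (\<lambda>n. euler t n ?x - euler t 0 ?x)" .
  then have "convergent (\<lambda>n. (euler t n ?x - euler t 0 ?x) + euler t 0 ?x)"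
    by (intro convergent_add convergent_const)
  then show ?thesis by (simp add: P_def convergent_LIMSEQ_iff)
qed

lemma P_0: "P 0 (R (R y)) = R (R y)"
proof -
  have "(J 0 ^^ n) x = x" for n x by (induction n) (auto simp: J0)
  then show ?thesis by (simp add: P_def euler_def)
qed

lemma R_tendsto: "(f \<longlongrightarrow> x) F \<Longrightarrow> ((\<lambda>n. R (f n)) \<longlongrightarrow> R x) F"
  by (rule bounded_linear.tendsto[OF bounded_linear_intro[where K=1]])
    (use lin[OF l0] contr[OF l0] in \<open>auto simp: linear_add linear_scale\<close>)

lemma P_R: assumes t: "t \<ge> 0" shows "P t (R (R (R y))) = R (P t (R (R y)))"
proof (rule LIMSEQ_unique[OF euler_tendsto[OF t]])
  show "(\<lambda>k. euler t k (R (R (R y)))) \<longlonglongrightarrow> R (P t (R (R y)))"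
    unfolding euler_comm[OF t l0, of _ "R (R y)"] by (rule R_tendsto[OF euler_tendsto[OF t]])
qed

text \<open>\<open>L\<close> commutes with the semigroup; this later identifies the time derivative
  with \<open>a\<close> times the second space derivative.\<close>

lemma P_B: assumes t: "t \<ge> 0" shows "P t (R (R (B y))) = B (P t (R (R y)))"
proof -
  have "(\<lambda>k. (R (euler t k (R (R y))) - euler t k (R (R y))) /\<^sub>R l) \<longlonglongrightarrow> (R (P t (R (R y))) - P t (R (R y))) /\<^sub>R l"
    by (intro tendsto_intros R_tendsto euler_tendsto[OF t])
  moreover have "euler t k (R (R (B y))) = (R (euler t k (R (R y))) - euler t k (R (R y))) /\<^sub>R l" for k
  proof -
    have "R (R (B y)) = (R (R (R y)) - R (R y)) /\<^sub>R l" by (simp only: BR[symmetric]) (simp add: B_def)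
    then show ?thesis
      using euler_linear[OF t, of k] by (simp only: linear_diff linear_scale euler_comm[OF t l0])
  qed
  ultimately have "(\<lambda>k. euler t k (R (R (B y)))) \<longlonglongrightarrow> B (P t (R (R y)))" by (simp add: B_def)
  then show ?thesis by (rule LIMSEQ_unique[OF euler_tendsto[OF t]])
qed

text \<open>Differentiability in time with derivative \<open>P s (L x)\<close>, since
  \<open>L (R (R (R y))) = R (R (B y))\<close>. The estimate is proved for the Euler scheme with a
  bound that does not involve \<open>k\<close>, and only then passed to the limit.\<close>

lemma P_taylor:
  assumes t: "t \<ge> 0" and s: "s \<ge> 0"
  shows "norm (P t (R (R (R y))) - P s (R (R (R y))) - (t - s) *\<^sub>R P s (R (R (B y)))) \<le> (t - s)\<^sup>2 * norm (R (B (B y)))"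
proof -
  let ?x = "R (R (R y))" and ?w = "R (R (B y))"
  let ?m = "norm (R (B (B y)))"
  have wB: "B (R (B y)) = R (B (B y))" by (simp add: BR)
  have step: "norm (euler t k ?x - euler s k ?x - (t - s) *\<^sub>R J (s / 2 ^ k) (euler s k ?w)) \<le> (t - s)\<^sup>2 * ?m" for k
  proof -
    define N where "N = (2::nat) ^ k"
    have N: "real N > 0" "real N = 2 ^ k" by (auto simp: N_def)
    define h e where "h = s / N" and "e = (t - s) / N"
    have hh: "t / N \<ge> 0" "h \<ge> 0" "t / N - h = e" using t s N by (auto simp: h_def e_def diff_divide_distrib)
    have "norm ((J (t / N) ^^ N) ?x - (J h ^^ N) ?x - (N * e) *\<^sub>R (J h ^^ Suc N) ?w) \<le> (real N)\<^sup>2 * (e\<^sup>2 * ?m)"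
    proof (rule funpow_diff_contraction_second_order)
      show "J (t / N) ?x - J h ?x = e *\<^sub>R J (t / N) (J h ?w)"
        using J_diff[OF hh(1,2), of "R (R y)"] hh(3) by (simp add: BR)
      show "norm (J (t / N) ?w - J h ?w) \<le> \<bar>e\<bar> * ?m"
        using norm_J_diff[OF hh(1,2), of "R (B y)"] hh(3) wB by simp
    qed (use lin contr comm hh in auto)
    moreover have "N * e = t - s" "(real N)\<^sup>2 * e\<^sup>2 = (t - s)\<^sup>2" using N by (auto simp: e_def field_simps)
    ultimately show ?thesis
      by (simp add: euler_def h_def N_def mult.assoc[symmetric])
  qed
  \<comment> \<open>The discrete formula has one surplus factor \<open>J (s / 2 ^ k)\<close>, which
    tends to the identity on the domain.\<close>
  have "(\<lambda>k. J (s / 2 ^ k) (euler s k ?w) - euler s k ?w) \<longlonglongrightarrow> 0"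
  proof (rule Lim_null_comparison)
    show "\<forall>\<^sub>F k in sequentially. norm (J (s / 2 ^ k) (euler s k ?w) - euler s k ?w) \<le> (s / 2 ^ k) * ?m"
    proof (rule always_eventually, rule allI)
      fix k
      have sk: "s / 2 ^ k \<ge> 0" using s by simp
      have "J (s / 2 ^ k) (euler s k ?w) - euler s k ?w = euler s k (J (s / 2 ^ k) ?w - J 0 ?w)"
        using euler_linear[OF s, of k] by (simp add: linear_diff euler_comm[OF s sk] J0)
      also have "norm \<dots> \<le> norm (J (s / 2 ^ k) ?w - J 0 ?w)" using euler_contr[OF s] .
      also have "\<dots> \<le> \<bar>s / 2 ^ k - 0\<bar> * norm (B (R (B y)))"
        using norm_J_diff[OF sk, of 0 "R (B y)"] by simp
      finally show "norm (J (s / 2 ^ k) (euler s k ?w) - euler s k ?w) \<le> (s / 2 ^ k) * ?m"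
        using s by (simp add: wB)
    qed
    have "(\<lambda>k. s * (1/2) ^ k * ?m) \<longlonglongrightarrow> s * 0 * ?m" by (intro tendsto_intros LIMSEQ_power_zero) auto
    then show "(\<lambda>k. (s / 2 ^ k) * ?m) \<longlonglongrightarrow> 0" by (simp add: power_divide)
  qed
  from tendsto_add[OF this euler_tendsto[OF s, of "B y"]]
  have "(\<lambda>k. J (s / 2 ^ k) (euler s k ?w)) \<longlonglongrightarrow> P s ?w" by simp
  then have "(\<lambda>k. euler t k ?x - euler s k ?x - (t - s) *\<^sub>R J (s / 2 ^ k) (euler s k ?w))
      \<longlonglongrightarrow> P t ?x - P s ?x - (t - s) *\<^sub>R P s ?w"
    by (intro tendsto_intros euler_tendsto t s)
  then show ?thesis by (rule Lim_norm_ubound[rotated]) (use step in auto)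
qed

end

subsection \<open>The resolvent of a uniformly elliptic operator on a compact interval\<close>

instance bcontfun :: (metric_space, banach) banach ..

definition second_derivative_on :: "real set \<Rightarrow> (real \<Rightarrow> real) \<Rightarrow> (real \<Rightarrow> real) \<Rightarrow> bool" where
  "second_derivative_on X u q \<longleftrightarrow> (\<exists>u'. \<forall>x\<in>X.
     (u has_real_derivative u' x) (at x within X) \<and> (u' has_real_derivative q x) (at x within X))"

lemma second_derivative_onI:
  assumes "\<And>x. x \<in> X \<Longrightarrow> (u has_real_derivative u' x) (at x within X)"
    "\<And>x. x \<in> X \<Longrightarrow> (u' has_real_derivative q x) (at x within X)"
  shows "second_derivative_on X u q"
  unfolding second_derivative_on_def by (intro exI[of _ u'] ballI conjI assms)

lemma second_derivative_onE:
  assumes "second_derivative_on X u q"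
  obtains u' where "\<And>x. x \<in> X \<Longrightarrow> (u has_real_derivative u' x) (at x within X)"
    "\<And>x. x \<in> X \<Longrightarrow> (u' has_real_derivative q x) (at x within X)"
  using assms unfolding second_derivative_on_def by blast

lemma second_derivative_on_cong:
  "second_derivative_on X u q \<Longrightarrow> (\<And>x. x \<in> X \<Longrightarrow> q x = q' x) \<Longrightarrow> second_derivative_on X u q'"
  by (auto simp: second_derivative_on_def)

lemma second_derivative_on_cong':
  assumes "second_derivative_on X u q" "\<And>x. x \<in> X \<Longrightarrow> u x = w x"
  shows "second_derivative_on X w q"
proof -
  obtain u' where u': "\<And>x. x \<in> X \<Longrightarrow> (u has_real_derivative u' x) (at x within X)"
    "\<And>x. x \<in> X \<Longrightarrow> (u' has_real_derivative q x) (at x within X)"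
    using second_derivative_onE[OF assms(1)] by blast
  have "(w has_real_derivative u' x) (at x within X)" if "x \<in> X" for x
    using has_field_derivative_transform_within[OF u'(1)[OF that] zero_less_one that] assms(2) by blast
  then show ?thesis using u'(2) unfolding second_derivative_on_def by blast
qed

lemma second_derivative_on_lincomb:
  assumes "second_derivative_on X u p" "second_derivative_on X w q"
  shows "second_derivative_on X (\<lambda>x. c * u x + d * w x) (\<lambda>x. c * p x + d * q x)"
proof -
  obtain u' where u': "\<And>x. x \<in> X \<Longrightarrow> (u has_real_derivative u' x) (at x within X)"
    "\<And>x. x \<in> X \<Longrightarrow> (u' has_real_derivative p x) (at x within X)"
    using second_derivative_onE[OF assms(1)] by blast
  obtain w' where "\<And>x. x \<in> X \<Longrightarrow> (w has_real_derivative w' x) (at x within X)"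
    "\<And>x. x \<in> X \<Longrightarrow> (w' has_real_derivative q x) (at x within X)"
    using second_derivative_onE[OF assms(2)] by blast
  with u' show ?thesis
    by (intro second_derivative_onI[of _ _ "\<lambda>x. c * u' x + d * w' x"] DERIV_add DERIV_cmult)
qed

section \<open>The Dirichlet problem for \<open>u - h * a * u'' = f\<close> on a compact
  interval\<close>

locale interval_operator =
  fixes \<alpha> \<beta> :: real and a :: "real \<Rightarrow> real"
  assumes ab: "\<alpha> < \<beta>" and a_cont: "continuous_on {\<alpha>..\<beta>} a" and a_pos: "\<And>x. x \<in> {\<alpha>..\<beta>} \<Longrightarrow> a x > 0"
begin

abbreviation "D2 \<equiv> second_derivative_on {\<alpha>..\<beta>}"

text \<open>Functions on the interval with zero boundary values are modelled as bounded continuous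
  functions on the whole line, extended by zero. This provides a ready Banach space in which
  equality is equality on the interval.\<close>

definition vanishing :: "(real \<Rightarrow>\<^sub>C real) \<Rightarrow> bool" where
  "vanishing u \<longleftrightarrow> (\<forall>x. x \<notin> {\<alpha><..<\<beta>} \<longrightarrow> u x = 0)"

text \<open>The resolvent equation \<open>u - h * a * u'' = f\<close> solved for \<open>u''\<close>,
  with Dirichlet conditions.\<close>

definition bvp :: "real \<Rightarrow> (real \<Rightarrow>\<^sub>C real) \<Rightarrow> (real \<Rightarrow>\<^sub>C real) \<Rightarrow> bool" where
  "bvp h f u \<longleftrightarrow> vanishing u \<and> D2 u (\<lambda>x. (u x - f x) / (h * a x))"

lemma vanishing_lincomb: "vanishing u \<Longrightarrow> vanishing w \<Longrightarrow> vanishing (c *\<^sub>R u + d *\<^sub>R w)"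
  by (auto simp: vanishing_def)

lemma bvp_lincomb:
  assumes "bvp h f u" "bvp h g w"
  shows "bvp h (c *\<^sub>R f + d *\<^sub>R g) (c *\<^sub>R u + d *\<^sub>R w)"
proof -
  have "D2 (\<lambda>x. c * u x + d * w x) (\<lambda>x. c * ((u x - f x) / (h * a x)) + d * ((w x - g x) / (h * a x)))"
    using assms by (intro second_derivative_on_lincomb) (auto simp: bvp_def)
  moreover have "(\<lambda>x. c * u x + d * w x) = apply_bcontfun (c *\<^sub>R u + d *\<^sub>R w)" by auto
  ultimately have "D2 (c *\<^sub>R u + d *\<^sub>R w) (\<lambda>x. c * ((u x - f x) / (h * a x)) + d * ((w x - g x) / (h * a x)))"
    by metis
  then have "D2 (c *\<^sub>R u + d *\<^sub>R w) (\<lambda>x. ((c *\<^sub>R u + d *\<^sub>R w) x - (c *\<^sub>R f + d *\<^sub>R g) x) / (h * a x))"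
    by (rule second_derivative_on_cong) (simp add: add_divide_distrib[symmetric] algebra_simps)
  then show ?thesis using assms vanishing_lincomb by (auto simp: bvp_def)
qed

text \<open>At an interior maximum \<open>u''\<close> is nonpositive, so the equation gives
  \<open>u \<le> f\<close> there. The bound does not involve \<open>h\<close>, which the
  continuation in \<open>h\<close> exploits.\<close>

lemma bvp_upper:
  assumes h: "h > 0" and u: "bvp h f u"
  shows "u x \<le> norm f"
proof (cases "x \<in> {\<alpha>..\<beta>}")
  case True
  obtain x0 where x0: "x0 \<in> {\<alpha>..\<beta>}" "\<And>y. y \<in> {\<alpha>..\<beta>} \<Longrightarrow> u y \<le> u x0"
    using continuous_attains_sup[of "{\<alpha>..\<beta>}" "apply_bcontfun u"] ab by auto
  have "u x0 \<le> norm f"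
  proof (cases "x0 \<in> {\<alpha><..<\<beta>}")
    case x0': True
    obtain u' where u': "\<And>x. x \<in> {\<alpha>..\<beta>} \<Longrightarrow> (u has_real_derivative u' x) (at x within {\<alpha>..\<beta>})"
      "\<And>x. x \<in> {\<alpha>..\<beta>} \<Longrightarrow> (u' has_real_derivative (u x - f x) / (h * a x)) (at x within {\<alpha>..\<beta>})"
      using second_derivative_onE[OF conjunct2[OF u[unfolded bvp_def]]] by blast
    have at: "at y within {\<alpha>..\<beta>} = at y" if "\<alpha> < y" "y < \<beta>" for y
      by (rule at_within_interior) (use that in auto)
    have "(u x0 - f x0) / (h * a x0) \<le> 0"
    proof (rule second_derivative_nonpos_at_local_max)
      show "min (x0 - \<alpha>) (\<beta> - x0) > 0" using x0' by simp
      show "(u has_real_derivative u' y) (at y)" if "\<bar>y - x0\<bar> < min (x0 - \<alpha>) (\<beta> - x0)" for y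
        using u'(1)[of y] at[of y] that by (auto simp: abs_if split: if_splits)
      show "(u' has_real_derivative (u x0 - f x0) / (h * a x0)) (at x0)"
        using u'(2)[of x0] at[of x0] x0' by auto
      show "u y \<le> u x0" if "\<bar>y - x0\<bar> < min (x0 - \<alpha>) (\<beta> - x0)" for y
        using x0(2)[of y] that by (auto simp: abs_if split: if_splits)
    qed
    moreover have "h * a x0 > 0" using h a_pos x0 by simp
    ultimately have "u x0 \<le> f x0" by (simp add: divide_le_0_iff)
    also have "f x0 \<le> norm f" using norm_bounded[of f x0] by simp
    finally show ?thesis .
  qed (use u in \<open>auto simp: bvp_def vanishing_def\<close>)
  then show ?thesis using x0(2)[OF True] by simp
qed (use u in \<open>auto simp: bvp_def vanishing_def\<close>)

lemma bvp_norm: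
  assumes "h > 0" "bvp h f u" shows "norm u \<le> norm f"
proof (rule norm_bound)
  fix x
  have "bvp h (-1 *\<^sub>R f + 0 *\<^sub>R f) (-1 *\<^sub>R u + 0 *\<^sub>R u)" using assms(2) by (intro bvp_lincomb)
  from bvp_upper[OF assms(1) this, of x] bvp_upper[OF assms, of x]
  show "norm (u x) \<le> norm f" by simp
qed

lemma bvp_norm_diff:
  assumes "h > 0" "bvp h f u" "bvp h g w" shows "norm (u - w) \<le> norm (f - g)"
  using bvp_norm[OF assms(1) bvp_lincomb[OF assms(2,3), of 1 "-1"]] by simp

lemma bvp_unique: "h > 0 \<Longrightarrow> bvp h f u \<Longrightarrow> bvp h f w \<Longrightarrow> u = w"
  using bvp_norm_diff[of h f u f w] by simp

lemma extend_vanishing: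
  assumes "continuous_on {\<alpha>..\<beta>} f" "f \<alpha> = 0" "f \<beta> = 0"
  obtains g where "vanishing g" "\<And>x. x \<in> {\<alpha>..\<beta>} \<Longrightarrow> apply_bcontfun g x = f x"
proof -
  have c: "continuous_on UNIV (\<lambda>x. f (max \<alpha> (min \<beta> x)))"
    by (rule continuous_on_compose2[OF assms(1)]) (use ab in \<open>auto intro!: continuous_intros\<close>)
  have "bounded (f ` {\<alpha>..\<beta>})"
    using compact_continuous_image[OF assms(1)] compact_imp_bounded by auto
  then obtain M where M: "\<And>x. x \<in> {\<alpha>..\<beta>} \<Longrightarrow> norm (f x) \<le> M" unfolding bounded_iff by blast
  have "(\<lambda>x. f (max \<alpha> (min \<beta> x))) \<in> bcontfun"
    by (rule bcontfun_normI[OF c, of M]) (use M ab in auto)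
  then obtain g where g: "(\<lambda>x. f (max \<alpha> (min \<beta> x))) = apply_bcontfun g" by (rule bcontfunE)
  have gx: "apply_bcontfun g x = f (max \<alpha> (min \<beta> x))" for x using fun_cong[OF g, of x] by simp
  show ?thesis
  proof
    show "vanishing g"
      unfolding vanishing_def gx
    proof (intro allI impI)
      fix x assume "x \<notin> {\<alpha><..<\<beta>}"
      then have "max \<alpha> (min \<beta> x) = \<alpha> \<or> max \<alpha> (min \<beta> x) = \<beta>" using ab by auto
      then show "f (max \<alpha> (min \<beta> x)) = 0" using assms by auto
    qed
    show "apply_bcontfun g x = f x" if "x \<in> {\<alpha>..\<beta>}" for x
      using that unfolding gx by (simp add: max_absorb2 min_absorb2)
  qed
qed

lemma dirichlet:
  assumes q: "continuous_on {\<alpha>..\<beta>} q"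
  obtains u where "vanishing u" "D2 u q"
proof -
  define Q1 where "Q1 = (\<lambda>x. integral {\<alpha>..x} q)"
  have Q1: "(Q1 has_real_derivative q x) (at x within {\<alpha>..\<beta>})" if "x \<in> {\<alpha>..\<beta>}" for x
    unfolding Q1_def by (rule integral_has_real_derivative[OF q that])
  have Q1c: "continuous_on {\<alpha>..\<beta>} Q1" by (rule DERIV_continuous_on[OF Q1])
  define Q2 where "Q2 = (\<lambda>x. integral {\<alpha>..x} Q1)"
  have Q2: "(Q2 has_real_derivative Q1 x) (at x within {\<alpha>..\<beta>})" if "x \<in> {\<alpha>..\<beta>}" for x
    unfolding Q2_def by (rule integral_has_real_derivative[OF Q1c that])
  define c where "c = Q2 \<beta> / (\<beta> - \<alpha>)"
  define u where "u = (\<lambda>x. Q2 x - c * (x - \<alpha>))"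
  have u: "(u has_real_derivative (Q1 x - c)) (at x within {\<alpha>..\<beta>})" if "x \<in> {\<alpha>..\<beta>}" for x
    unfolding u_def by (rule derivative_eq_intros Q2[OF that] refl | simp)+
  have u': "((\<lambda>x. Q1 x - c) has_real_derivative q x) (at x within {\<alpha>..\<beta>})" if "x \<in> {\<alpha>..\<beta>}" for x
    by (rule derivative_eq_intros Q1[OF that] refl | simp)+
  have D: "D2 u q" by (rule second_derivative_onI[OF u u'])
  have "continuous_on {\<alpha>..\<beta>} u" by (rule DERIV_continuous_on[OF u])
  moreover have "u \<alpha> = 0" "u \<beta> = 0" using ab by (auto simp: u_def Q2_def c_def)
  ultimately obtain g where g: "vanishing g" "\<And>x. x \<in> {\<alpha>..\<beta>} \<Longrightarrow> apply_bcontfun g x = u x"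
    using extend_vanishing by blast
  have "D2 g q" by (rule second_derivative_on_cong'[OF D]) (simp add: g(2))
  then show ?thesis using that g(1) by blast
qed

lemma vanishing_norm_le:
  assumes u: "vanishing u" "D2 u q" and B: "\<And>x. x \<in> {\<alpha>..\<beta>} \<Longrightarrow> \<bar>q x\<bar> \<le> B"
  shows "norm u \<le> B * (\<beta> - \<alpha>)\<^sup>2"
proof (rule norm_bound)
  fix x
  obtain u' where u': "\<And>x. x \<in> {\<alpha>..\<beta>} \<Longrightarrow> (u has_real_derivative u' x) (at x within {\<alpha>..\<beta>})"
      "\<And>x. x \<in> {\<alpha>..\<beta>} \<Longrightarrow> (u' has_real_derivative q x) (at x within {\<alpha>..\<beta>})"
    using second_derivative_onE[OF u(2)] by blast
  show "norm (u x) \<le> B * (\<beta> - \<alpha>)\<^sup>2"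
  proof (cases "x \<in> {\<alpha>..\<beta>}")
    case True
    then show ?thesis
      using bounded_by_second_derivative[OF ab u' _ _ B True] u(1) by (auto simp: vanishing_def)
  next
    case False
    have "0 \<le> B" using B[of \<alpha>] ab by simp
    then show ?thesis using u(1) False by (auto simp: vanishing_def)
  qed
qed

text \<open>For large \<open>k\<close> the unknown enters \<open>u'' = (u - f) / (k * a)\<close>
  with a small factor, and solving with a given \<open>w\<close> on the right-hand side is a
  contraction.\<close>

lemma bvp_exists_large:
  obtains h where "h > 0" "\<And>k f. k \<ge> h \<Longrightarrow> \<exists>u. bvp k f u"
proof -
  obtain x0 where x0: "x0 \<in> {\<alpha>..\<beta>}" "\<And>y. y \<in> {\<alpha>..\<beta>} \<Longrightarrow> a x0 \<le> a y"
    using continuous_attains_inf[OF _ _ a_cont] ab by auto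
  define m where "m = a x0"
  have m: "m > 0" "\<And>y. y \<in> {\<alpha>..\<beta>} \<Longrightarrow> m \<le> a y" using x0 a_pos by (auto simp: m_def)
  \<comment> \<open>\<open>vanishing_norm_le\<close> bounds the Lipschitz constant of
    \<open>\<Phi>\<close> by \<open>(\<beta> - \<alpha>)\<^sup>2 / (k * m)\<close>; this
    \<open>h\<close> makes it at most one half.\<close>
  define h where "h = 2 * (\<beta> - \<alpha>)\<^sup>2 / m"
  have h: "h > 0" using m ab by (simp add: h_def)
  have "\<exists>u. bvp k f u" if k: "k \<ge> h" for k f
  proof -
    have kp: "k > 0" using h k by simp
    define \<Phi> where "\<Phi> = (\<lambda>w. SOME u. vanishing u \<and> D2 u (\<lambda>x. (apply_bcontfun w x - f x) / (k * a x)))"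
    have \<Phi>: "vanishing (\<Phi> w) \<and> D2 (\<Phi> w) (\<lambda>x. (w x - f x) / (k * a x))" for w
    proof -
      have "continuous_on {\<alpha>..\<beta>} (\<lambda>x. (w x - f x) / (k * a x))"
        using kp by (intro continuous_intros a_cont) (auto simp: less_imp_neq[OF a_pos, symmetric])
      from dirichlet[OF this] show ?thesis unfolding \<Phi>_def by (metis (mono_tags, lifting) someI_ex)
    qed
    have "\<exists>!u. \<Phi> u = u"
    proof (rule banach_fix_type[of "1/2"])
      show "\<forall>v w. dist (\<Phi> v) (\<Phi> w) \<le> 1 / 2 * dist v w"
      proof (intro allI)
        fix v w
        have "norm (1 *\<^sub>R \<Phi> v + (-1) *\<^sub>R \<Phi> w) \<le> (norm (v - w) / (k * m)) * (\<beta> - \<alpha>)\<^sup>2"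
        proof (rule vanishing_norm_le)
          show "vanishing (1 *\<^sub>R \<Phi> v + (-1) *\<^sub>R \<Phi> w)" using \<Phi> by (intro vanishing_lincomb) auto
          have "D2 (\<lambda>x. 1 * \<Phi> v x + (-1) * \<Phi> w x) (\<lambda>x. 1 * ((v x - f x) / (k * a x)) + (-1) * ((w x - f x) / (k * a x)))"
            using \<Phi> by (intro second_derivative_on_lincomb) auto
          moreover have "(\<lambda>x. 1 * \<Phi> v x + (-1) * \<Phi> w x) = apply_bcontfun (1 *\<^sub>R \<Phi> v + (-1) *\<^sub>R \<Phi> w)" by auto
          ultimately show "D2 (1 *\<^sub>R \<Phi> v + (-1) *\<^sub>R \<Phi> w) (\<lambda>x. 1 * ((v x - f x) / (k * a x)) + (-1) * ((w x - f x) / (k * a x)))"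
            by metis
          fix x assume x: "x \<in> {\<alpha>..\<beta>}"
          have "1 * ((v x - f x) / (k * a x)) + (-1) * ((w x - f x) / (k * a x)) = (v - w) x / (k * a x)"
            by (simp add: diff_divide_distrib)
          then have "\<bar>1 * ((v x - f x) / (k * a x)) + (-1) * ((w x - f x) / (k * a x))\<bar> = \<bar>(v - w) x\<bar> / (k * a x)"
            using kp a_pos[OF x] by (simp only: abs_divide) simp
          also have "\<dots> \<le> norm (v - w) / (k * m)"
            using norm_bounded[of "v - w" x] kp m(1) m(2)[OF x] by (intro frac_le mult_left_mono) auto
          finally show "\<bar>1 * ((v x - f x) / (k * a x)) + (-1) * ((w x - f x) / (k * a x))\<bar> \<le> norm (v - w) / (k * m)" .
        qed
        also have "\<dots> = norm (v - w) * ((\<beta> - \<alpha>)\<^sup>2 / (k * m))" by simp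
        also have "\<dots> \<le> norm (v - w) * (1 / 2)"
        proof (rule mult_left_mono)
          have "2 * (\<beta> - \<alpha>)\<^sup>2 \<le> k * m" using k m(1) by (simp add: h_def divide_le_eq)
          then show "(\<beta> - \<alpha>)\<^sup>2 / (k * m) \<le> 1 / 2" using kp m(1) by (simp add: divide_le_eq)
        qed simp
        finally show "dist (\<Phi> v) (\<Phi> w) \<le> 1 / 2 * dist v w" by (simp add: dist_norm)
      qed
    qed auto
    then obtain u where u: "\<Phi> u = u" by blast
    have "bvp k f u" using \<Phi>[of u] by (simp add: u bvp_def)
    then show ?thesis by blast
  qed
  with h show ?thesis using that by blast
qed

text \<open>Method of continuity: the contraction works because \<open>norm u \<le> norm f\<close> holds uniformly in \<open>k\<close>.\<close>

lemma bvp_continuation: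
  assumes k: "k > 0" and solve: "\<And>f. \<exists>u. bvp k f u" and h: "h > k / 2"
  shows "\<exists>u. bvp h f u"
proof -
  have h0: "h > 0" using k h by simp
  \<comment> \<open>The equation with step \<open>h\<close> is the one with step \<open>k\<close>
    and right-hand side \<open>(k / h) f + (1 - k / h) u\<close>. The resulting map contracts by
    \<open>|1 - k / h|\<close>, which is below 1 exactly for \<open>h > k / 2\<close>.\<close>
  define \<Phi> where "\<Phi> = (\<lambda>w. SOME u. bvp k ((k / h) *\<^sub>R f + (1 - k / h) *\<^sub>R w) u)"
  have \<Phi>: "bvp k ((k / h) *\<^sub>R f + (1 - k / h) *\<^sub>R w) (\<Phi> w)" for w
    unfolding \<Phi>_def using solve by (metis someI_ex)
  have "\<exists>!u. \<Phi> u = u"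
  proof (rule banach_fix_type)
    show "0 \<le> \<bar>1 - k / h\<bar>" by simp
    have "k / h < 2" using h h0 by (simp add: divide_less_eq)
    moreover have "k / h > 0" using k h0 by simp
    ultimately show "\<bar>1 - k / h\<bar> < 1" by (simp add: abs_less_iff)
    show "\<forall>v w. dist (\<Phi> v) (\<Phi> w) \<le> \<bar>1 - k / h\<bar> * dist v w"
    proof (intro allI)
      fix v w
      have "norm (\<Phi> v - \<Phi> w) \<le> norm (((k / h) *\<^sub>R f + (1 - k / h) *\<^sub>R v) - ((k / h) *\<^sub>R f + (1 - k / h) *\<^sub>R w))"
        by (rule bvp_norm_diff[OF k \<Phi> \<Phi>])
      also have "((k / h) *\<^sub>R f + (1 - k / h) *\<^sub>R v) - ((k / h) *\<^sub>R f + (1 - k / h) *\<^sub>R w) = (1 - k / h) *\<^sub>R (v - w)"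
        by (simp add: scaleR_diff_right)
      finally show "dist (\<Phi> v) (\<Phi> w) \<le> \<bar>1 - k / h\<bar> * dist v w" by (simp add: dist_norm)
    qed
  qed
  then obtain u where u: "\<Phi> u = u" by blast
  have 1: "vanishing u" "D2 u (\<lambda>x. (u x - ((k / h) *\<^sub>R f + (1 - k / h) *\<^sub>R u) x) / (k * a x))"
    using \<Phi>[of u] by (simp_all add: u bvp_def)
  have "D2 u (\<lambda>x. (u x - f x) / (h * a x))"
  proof (rule second_derivative_on_cong[OF 1(2)])
    fix x assume "x \<in> {\<alpha>..\<beta>}"
    have "u x - ((k / h) *\<^sub>R f + (1 - k / h) *\<^sub>R u) x = (k / h) * (u x - f x)" by (simp add: algebra_simps)
    then show "(u x - ((k / h) *\<^sub>R f + (1 - k / h) *\<^sub>R u) x) / (k * a x) = (u x - f x) / (h * a x)"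
      using k h0 by simp
  qed
  with 1 show ?thesis by (auto simp: bvp_def)
qed

text \<open>One continuation reaches every step above half of a solvable one, so a factor
  \<open>2/3\<close> can be iterated, and its powers fall below any positive
  \<open>h\<close>.\<close>

lemma bvp_exists:
  assumes "h > 0" shows "\<exists>u. bvp h f u"
proof -
  obtain h0 where h0: "h0 > 0" "\<And>k f. k \<ge> h0 \<Longrightarrow> \<exists>u. bvp k f u" using bvp_exists_large by blast
  have *: "\<forall>k f. k \<ge> h0 * (2/3) ^ n \<longrightarrow> (\<exists>u. bvp k f u)" for n
  proof (induction n)
    case (Suc n)
    show ?case
    proof (intro allI impI)
      fix k f assume k: "h0 * (2/3) ^ Suc n \<le> k"
      let ?k = "h0 * (2/3) ^ n"
      have "?k > 0" using h0(1) by simp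
      moreover from this have "k > ?k / 2" using k by simp
      ultimately show "\<exists>u. bvp k f u" using bvp_continuation[of ?k k f] Suc by blast
    qed
  qed (use h0 in auto)
  have "(\<lambda>n. h0 * (2/3) ^ n) \<longlonglongrightarrow> h0 * 0" by (intro tendsto_intros LIMSEQ_power_zero) auto
  then have "\<forall>\<^sub>F n in sequentially. h0 * (2/3) ^ n < h" using assms by (intro order_tendstoD) auto
  then obtain n where "h0 * (2/3) ^ n < h" by (auto simp: eventually_sequentially)
  then show ?thesis using * less_imp_le by blast
qed

text \<open>At \<open>h = 0\<close> the equation in \<open>bvp\<close> would divide by zero; the
  identity, which \<open>resolvent_family\<close> demands there, is put in by hand.\<close>

definition Res :: "real \<Rightarrow> (real \<Rightarrow>\<^sub>C real) \<Rightarrow> (real \<Rightarrow>\<^sub>C real)" where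
  "Res h f = (if h = 0 then f else THE u. bvp h f u)"

lemma Res_eqI:
  assumes h: "h > 0" and u: "bvp h f u" shows "Res h f = u"
proof -
  have "(THE u. bvp h f u) = u" by (rule the_equality, rule u, rule bvp_unique[OF h _ u])
  then show ?thesis using h by (simp add: Res_def)
qed

lemma bvp_Res: assumes h: "h > 0" shows "bvp h f (Res h f)"
proof -
  obtain u where u: "bvp h f u" using bvp_exists[OF h] by blast
  then show ?thesis by (simp add: Res_eqI[OF h u])
qed

lemma D2_lincomb:
  assumes "D2 (apply_bcontfun u) p" "D2 (apply_bcontfun w) q"
    and "\<And>x. x \<in> {\<alpha>..\<beta>} \<Longrightarrow> c * p x + d * q x = r x"
  shows "D2 (apply_bcontfun (c *\<^sub>R u + d *\<^sub>R w)) r"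
proof -
  have "D2 (\<lambda>x. c * u x + d * w x) (\<lambda>x. c * p x + d * q x)"
    by (rule second_derivative_on_lincomb[OF assms(1,2)])
  moreover have "(\<lambda>x. c * u x + d * w x) = apply_bcontfun (c *\<^sub>R u + d *\<^sub>R w)" by auto
  ultimately have "D2 (apply_bcontfun (c *\<^sub>R u + d *\<^sub>R w)) (\<lambda>x. c * p x + d * q x)" by metis
  then show ?thesis by (rule second_derivative_on_cong) (rule assms(3))
qed

text \<open>The partial fraction form of a product of resolvents. It is symmetric in
  \<open>h\<close> and \<open>k\<close>, whence they commute.\<close>

lemma Res_comm_formula:
  assumes "h > 0" "k > 0" "h \<noteq> k"
  shows "Res h (Res k f) = (h / (h - k)) *\<^sub>R Res h f + (- k / (h - k)) *\<^sub>R Res k f"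
proof (rule Res_eqI[OF assms(1)])
  have u: "vanishing (Res h f)" "D2 (Res h f) (\<lambda>x. (Res h f x - f x) / (h * a x))"
    and v: "vanishing (Res k f)" "D2 (Res k f) (\<lambda>x. (Res k f x - f x) / (k * a x))"
    using bvp_Res[of h f] bvp_Res[of k f] assms by (auto simp: bvp_def)
  have "D2 ((h / (h - k)) *\<^sub>R Res h f + (- k / (h - k)) *\<^sub>R Res k f)
      (\<lambda>x. (((h / (h - k)) *\<^sub>R Res h f + (- k / (h - k)) *\<^sub>R Res k f) x - Res k f x) / (h * a x))"
  proof (rule D2_lincomb[OF u(2) v(2)])
    fix x assume "x \<in> {\<alpha>..\<beta>}"
    then have "a x \<noteq> 0" "h - k \<noteq> 0" using a_pos[of x] assms by auto
    then show "h / (h - k) * ((Res h f x - f x) / (h * a x)) + - k / (h - k) * ((Res k f x - f x) / (k * a x)) =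
      (((h / (h - k)) *\<^sub>R Res h f + (- k / (h - k)) *\<^sub>R Res k f) x - Res k f x) / (h * a x)"
      using assms(1,2) by (simp add: divide_simps) (simp add: algebra_simps)
  qed
  then show "bvp h (Res k f) ((h / (h - k)) *\<^sub>R Res h f + (- k / (h - k)) *\<^sub>R Res k f)"
    unfolding bvp_def using vanishing_lincomb[OF u(1) v(1)] by blast
qed

lemma Res_comm:
  assumes "h \<ge> 0" "k \<ge> 0" shows "Res h (Res k f) = Res k (Res h f)"
proof (cases "h = 0 \<or> k = 0 \<or> h = k")
  case False
  then have hk: "h > 0" "k > 0" "h \<noteq> k" "k \<noteq> h" using assms by auto
  have "k / (k - h) = - k / (h - k)" "- h / (k - h) = h / (h - k)" using hk by (auto simp: divide_simps algebra_simps)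
  then show ?thesis
    using Res_comm_formula[OF hk(1-3), of f] Res_comm_formula[OF hk(2,1,4), of f] by (simp add: add.commute)
qed (auto simp: Res_def)

lemma Res_linear: "h \<ge> 0 \<Longrightarrow> linear (Res h)"
proof (cases "h = 0")
  case False
  assume "h \<ge> 0" with False have h: "h > 0" by simp
  have "Res h (c *\<^sub>R f + d *\<^sub>R g) = c *\<^sub>R Res h f + d *\<^sub>R Res h g" for c d f g
    by (rule Res_eqI[OF h bvp_lincomb[OF bvp_Res[OF h] bvp_Res[OF h]]])
  from this[of 1 _ 1] this[of _ _ 0] show ?thesis by (auto simp: linear_iff)
qed (simp add: Res_def linear_iff)

lemma Res_contraction: "h \<ge> 0 \<Longrightarrow> norm (Res h f) \<le> norm f"
  using bvp_norm[OF _ bvp_Res] by (cases "h = 0") (auto simp: Res_def)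

text \<open>The hypotheses express that \<open>f\<close> lies in the domain of \<open>L\<close> and
  \<open>L f = z\<close>. Then \<open>Res h f - f\<close> solves the resolvent equation with
  right-hand side \<open>h z\<close>.\<close>

lemma Res_minus_domain:
  fixes f z :: "real \<Rightarrow>\<^sub>C real"
  assumes h: "h > 0" and f: "vanishing f" "D2 f (\<lambda>x. z x / a x)"
  shows "Res h f - f = h *\<^sub>R Res h z"
proof -
  have u: "vanishing (Res h f)" "D2 (Res h f) (\<lambda>x. (Res h f x - f x) / (h * a x))"
    using bvp_Res[of h f] h by (auto simp: bvp_def)
  have "Res h (h *\<^sub>R z) = 1 *\<^sub>R Res h f + (-1) *\<^sub>R f"
  proof (rule Res_eqI[OF h])
    have "D2 (1 *\<^sub>R Res h f + (-1) *\<^sub>R f) (\<lambda>x. ((1 *\<^sub>R Res h f + (-1) *\<^sub>R f) x - (h *\<^sub>R z) x) / (h * a x))"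
    proof (rule D2_lincomb[OF u(2) f(2)])
      fix x assume "x \<in> {\<alpha>..\<beta>}"
      then have "a x \<noteq> 0" using a_pos[of x] by auto
      then show "1 * ((Res h f x - f x) / (h * a x)) + - 1 * (z x / a x) =
          ((1 *\<^sub>R Res h f + (-1) *\<^sub>R f) x - (h *\<^sub>R z) x) / (h * a x)"
        using h by (simp add: divide_simps)
    qed
    then show "bvp h (h *\<^sub>R z) (1 *\<^sub>R Res h f + (-1) *\<^sub>R f)"
      unfolding bvp_def using vanishing_lincomb[OF u(1) f(1)] by blast
  qed
  then show ?thesis using Res_linear[of h] h by (simp add: linear_scale)
qed

text \<open>With \<open>f = Res l x\<close> and \<open>z = L f\<close> one has
  \<open>L (Res k f) = Res k z\<close>, so \<open>Res_minus_domain\<close> applies to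
  \<open>f\<close> and to \<open>Res k f\<close>. Equating the two expressions for
  \<open>Res h (Res k f)\<close> gives the identity.\<close>

lemma Res_identity:
  assumes h: "h \<ge> 0" and k: "k \<ge> 0" and l: "l > 0"
  shows "Res h (Res l x) - Res k (Res l x) = (h - k) *\<^sub>R Res h (Res k ((Res l x - x) /\<^sub>R l))"
proof -
  define f z where "f = Res l x" and "z = (f - x) /\<^sub>R l"
  have f: "vanishing f" "D2 f (\<lambda>y. z y / a y)"
    using bvp_Res[OF l, of x] second_derivative_on_cong[of _ f "\<lambda>y. (f y - x y) / (l * a y)" "\<lambda>y. z y / a y"]
    by (auto simp: bvp_def f_def z_def divide_simps)
  have 0: "Res m f - f = m *\<^sub>R Res m z" if "m > 0" for m
    by (rule Res_minus_domain[OF that f])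
  have "Res h f - Res k f = (h - k) *\<^sub>R Res h (Res k z)"
  proof (cases "h = 0 \<or> k = 0")
    case True
    then show ?thesis using 0[of h] 0[of k] h k
      by (cases "h = 0"; cases "k = 0") (auto simp: Res_def[of 0] less_le algebra_simps)
  next
    case False
    then have hk: "h > 0" "k > 0" using h k by auto
    have y: "Res k f = f + k *\<^sub>R Res k z" using 0[OF hk(2)] by (simp add: algebra_simps)
    have "Res h (Res k f) = Res h f + k *\<^sub>R Res h (Res k z)"
      using Res_linear[OF h] by (simp add: y linear_add linear_scale)
    moreover have "vanishing (Res k f)" "D2 (Res k f) (\<lambda>x. Res k z x / a x)"
    proof -
      show "vanishing (Res k f)" using bvp_Res[OF hk(2), of f] by (simp add: bvp_def)
      have "D2 (Res k f) (\<lambda>x. (Res k f x - f x) / (k * a x))" using bvp_Res[OF hk(2), of f] by (simp add: bvp_def)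
      then show "D2 (Res k f) (\<lambda>x. Res k z x / a x)"
        by (rule second_derivative_on_cong) (use y hk in simp)
    qed
    then have "Res h (Res k f) - Res k f = h *\<^sub>R Res h (Res k z)" by (rule Res_minus_domain[OF hk(1)])
    ultimately show ?thesis by (simp add: algebra_simps)
  qed
  then show ?thesis by (simp add: f_def z_def)
qed

lemma resolvent_family_Res: "l > 0 \<Longrightarrow> resolvent_family Res l"
  by (rule resolvent_family.intro) (simp_all add: Res_linear Res_contraction Res_comm Res_identity Res_def[of 0])

lemma Res_tendsto_of_smooth:
  assumes f: "vanishing f" "D2 f q" "continuous_on {\<alpha>..\<beta>} q"
  obtains C where "\<And>h. h > 0 \<Longrightarrow> norm (Res h f - f) \<le> h * C"
proof -
  have "continuous_on {\<alpha>..\<beta>} (\<lambda>x. a x * q x)" by (intro continuous_intros a_cont f)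
  then have "continuous_on (cbox \<alpha> \<beta>) (\<lambda>x. a x * q x)" by simp
  then obtain z where "\<And>x. x \<in> cbox \<alpha> \<beta> \<Longrightarrow> apply_bcontfun z x = a x * q x"
    by (rule continuous_on_cbox_bcontfunE) blast
  then have z: "\<And>x. x \<in> {\<alpha>..\<beta>} \<Longrightarrow> apply_bcontfun z x = a x * q x" by simp
  have D: "D2 f (\<lambda>x. z x / a x)"
    by (rule second_derivative_on_cong[OF f(2)]) (use z a_pos in force)
  have "norm (Res h f - f) \<le> h * norm z" if "h > 0" for h
    using Res_minus_domain[OF that f(1) D] Res_contraction[of h z] that by (simp add: mult_left_mono)
  then show ?thesis using that by blast
qed

text \<open>A Weierstrass polynomial minus the chord through its end values: since \<open>g\<close>
  vanishes at the ends, the chord is at most \<open>e / 2\<close> in size.\<close>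

lemma smooth_dense:
  assumes g: "vanishing g" and e: "e > 0"
  obtains f q where "vanishing f" "D2 f q" "continuous_on {\<alpha>..\<beta>} q" "norm (f - g) \<le> e"
proof -
  obtain p where p: "real_polynomial_function p" "\<And>x. x \<in> {\<alpha>..\<beta>} \<Longrightarrow> \<bar>g x - p x\<bar> < e / 2"
    using Stone_Weierstrass_real_polynomial_function[of "{\<alpha>..\<beta>}" "apply_bcontfun g" "e / 2"] e by auto
  obtain p' where p': "real_polynomial_function p'" "\<And>x. (p has_real_derivative p' x) (at x)"
    using has_real_derivative_polynomial_function[OF p(1)] by auto
  obtain p'' where p'': "real_polynomial_function p''" "\<And>x. (p' has_real_derivative p'' x) (at x)"
    using has_real_derivative_polynomial_function[OF p'(1)] by auto
  define c where "c = (p \<beta> - p \<alpha>) / (\<beta> - \<alpha>)"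
  define w where "w = (\<lambda>x. p x - (p \<alpha> + c * (x - \<alpha>)))"
  have w': "(w has_real_derivative p' x - c) (at x within {\<alpha>..\<beta>})" for x
    unfolding w_def by (rule derivative_eq_intros has_field_derivative_at_within[OF p'(2)] refl | simp)+
  have w'': "((\<lambda>x. p' x - c) has_real_derivative p'' x) (at x within {\<alpha>..\<beta>})" for x
    by (rule derivative_eq_intros has_field_derivative_at_within[OF p''(2)] refl | simp)+
  have D: "D2 w p''" by (rule second_derivative_onI[OF w' w''])
  have "continuous_on {\<alpha>..\<beta>} w" by (rule DERIV_continuous_on[OF w'])
  moreover have "w \<alpha> = 0" "w \<beta> = 0" using ab by (auto simp: w_def c_def)
  ultimately obtain f where f: "vanishing f" "\<And>x. x \<in> {\<alpha>..\<beta>} \<Longrightarrow> apply_bcontfun f x = w x"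
    using extend_vanishing by blast
  have ga: "g \<alpha> = 0" "g \<beta> = 0" using g by (auto simp: vanishing_def)
  have lin: "\<bar>p \<alpha> + c * (x - \<alpha>)\<bar> \<le> e / 2" if x: "x \<in> {\<alpha>..\<beta>}" for x
  proof -
    define s where "s = (x - \<alpha>) / (\<beta> - \<alpha>)"
    have s: "0 \<le> s" "s \<le> 1" using x ab by (auto simp: s_def)
    have "c * (x - \<alpha>) = (p \<beta> - p \<alpha>) * s" by (simp add: c_def s_def)
    then have "p \<alpha> + c * (x - \<alpha>) = (1 - s) * p \<alpha> + s * p \<beta>" by (simp add: algebra_simps)
    also have "\<bar>\<dots>\<bar> \<le> (1 - s) * \<bar>p \<alpha>\<bar> + s * \<bar>p \<beta>\<bar>"
      using s abs_triangle_ineq[of "(1 - s) * p \<alpha>" "s * p \<beta>"] by (simp add: abs_mult)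
    also have "\<dots> \<le> (1 - s) * (e / 2) + s * (e / 2)"
      using p(2)[of \<alpha>] p(2)[of \<beta>] ga ab s by (intro add_mono mult_left_mono) auto
    also have "\<dots> = e / 2" by (simp add: algebra_simps add_divide_distrib[symmetric])
    finally show ?thesis .
  qed
  show ?thesis
  proof
    show "vanishing f" by fact
    show "D2 f p''" by (rule second_derivative_on_cong'[OF D]) (simp add: f(2))
    show "continuous_on {\<alpha>..\<beta>} p''" using continuous_on_polymonial_function p''(1) real_polynomial_function_eq by blast
    show "norm (f - g) \<le> e"
    proof (rule norm_bound)
      fix x
      show "norm ((f - g) x) \<le> e"
      proof (cases "x \<in> {\<alpha>..\<beta>}")
        case True
        then have "norm ((f - g) x) = \<bar>p x - (p \<alpha> + c * (x - \<alpha>)) - g x\<bar>" by (simp add: f(2) w_def)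
        then show ?thesis using p(2)[OF True] lin[OF True] by linarith
      next
        case False
        then show ?thesis using f(1) g e by (auto simp: vanishing_def)
      qed
    qed
  qed
qed

text \<open>The resolvents tend strongly to the identity: at rate \<open>l\<close> on smooth
  functions, by density and contractivity on all vanishing ones. Powers are taken because several
  factors \<open>Res l\<close> are needed to make initial data smooth enough.\<close>

lemma Res_funpow_approx:
  assumes g: "vanishing g" and e: "e > 0"
  obtains l where "l > 0" "norm ((Res l ^^ n) g - g) \<le> e"
proof -
  obtain f q where f: "vanishing f" "D2 f q" "continuous_on {\<alpha>..\<beta>} q" "norm (f - g) \<le> e / 3"
    using smooth_dense[OF g, of "e / 3"] e by auto
  obtain C where C: "\<And>h. h > 0 \<Longrightarrow> norm (Res h f - f) \<le> h * C"
    by (rule Res_tendsto_of_smooth[OF f(1-3)]) blast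
  \<comment> \<open>Makes \<open>n * l * C\<close> at most \<open>e / 3\<close>; the added ones
    avoid division by zero.\<close>
  define l where "l = e / (3 * (real n + 1) * (\<bar>C\<bar> + 1))"
  have l: "l > 0" using e by (simp add: l_def)
  have l0: "l \<ge> 0" using l by simp
  note con = funpow_contraction[of "Res l", OF Res_contraction[OF l0]]
  have "norm ((Res l ^^ n) f - (id ^^ n) f) \<le> n * norm (Res l f - id f)"
    by (rule funpow_diff_contraction[OF Res_linear[OF l0] Res_contraction[OF l0]]) (auto simp: linear_iff)
  moreover have "(id ^^ n) f = f" by (induction n) auto
  ultimately have "norm ((Res l ^^ n) f - f) \<le> n * norm (Res l f - f)" by simp
  also have "\<dots> \<le> n * (l * C)" using C[OF l] by (intro mult_left_mono) auto
  also have "\<dots> \<le> (real n + 1) * (l * (\<bar>C\<bar> + 1))"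
  proof -
    have "n * (l * C) \<le> n * (l * (\<bar>C\<bar> + 1))" using l0 by (intro mult_left_mono) auto
    also have "\<dots> \<le> (real n + 1) * (l * (\<bar>C\<bar> + 1))" using l0 by (intro mult_right_mono) auto
    finally show ?thesis .
  qed
  also have "\<dots> = e / 3" using e by (simp add: l_def divide_simps)
  finally have 1: "norm ((Res l ^^ n) f - f) \<le> e / 3" .
  have 2: "norm ((Res l ^^ n) g - (Res l ^^ n) f) \<le> e / 3"
    using con[of n "g - f"] f(4) linear_diff[OF funpow_linear[OF Res_linear[OF l0]], of n g f]
    by (simp add: norm_minus_commute)
  have "(Res l ^^ n) g - g = ((Res l ^^ n) g - (Res l ^^ n) f) + ((Res l ^^ n) f - f) + (f - g)" by simp
  also have "norm \<dots> \<le> e / 3 + e / 3 + e / 3"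
    using 1 2 f(4) by (intro norm_triangle_le add_mono) auto
  finally show ?thesis using that l by simp
qed

end

subsection \<open>Smooth solutions on a compact interval\<close>

lemma has_real_derivative_quadratic:
  fixes f :: "real \<Rightarrow> real"
  assumes "\<And>s. s \<in> A \<Longrightarrow> \<bar>f s - f t - (s - t) * d\<bar> \<le> K * (s - t)\<^sup>2"
  shows "(f has_real_derivative d) (at t within A)"
proof -
  have "((\<lambda>s. (f s - f t) / (s - t) - d) \<longlongrightarrow> 0) (at t within A)"
  proof (rule Lim_null_comparison)
    have "norm ((f s - f t) / (s - t) - d) \<le> K * \<bar>s - t\<bar>" if "s \<in> A" "s \<noteq> t" for s
    proof -
      have "(f s - f t) / (s - t) - d = (f s - f t - (s - t) * d) / (s - t)" using that by (simp add: field_simps)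
      then have "norm ((f s - f t) / (s - t) - d) = \<bar>f s - f t - (s - t) * d\<bar> / \<bar>s - t\<bar>" by (simp only: real_norm_def abs_divide)
      also have "\<dots> \<le> K * (s - t)\<^sup>2 / \<bar>s - t\<bar>" using assms[OF that(1)] by (intro divide_right_mono) auto
      also have "\<dots> = K * \<bar>s - t\<bar>" 
      proof -
        define r where "r = \<bar>s - t\<bar>"
        have "(s - t)\<^sup>2 = r * r" "r \<noteq> 0" using that by (simp_all add: power2_eq_square r_def)
        then show ?thesis unfolding r_def[symmetric] by simp
      qed
      finally show ?thesis .
    qed
    then show "\<forall>\<^sub>F s in at t within A. norm ((f s - f t) / (s - t) - d) \<le> K * \<bar>s - t\<bar>"
      unfolding eventually_at_filter by (intro always_eventually) auto
    have "((\<lambda>s. K * \<bar>s - t\<bar>) \<longlongrightarrow> K * \<bar>t - t\<bar>) (at t within A)" by (intro tendsto_intros)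
    then show "((\<lambda>s. K * \<bar>s - t\<bar>) \<longlongrightarrow> 0) (at t within A)" by simp
  qed
  then have "((\<lambda>s. (f s - f t) / (s - t)) \<longlongrightarrow> d) (at t within A)" by (rule LIM_zero_cancel)
  then show ?thesis by (simp add: has_field_derivative_iff)
qed

text \<open>The bound has the shape that a first order Taylor estimate with quadratic remainder
  delivers. Its constant may depend on \<open>t\<close>, since continuity is checked at one time
  after the other.\<close>

lemma continuous_on_Times_Lipschitz:
  fixes f :: "real \<Rightarrow> real \<Rightarrow> real"
  assumes c: "\<And>t. t \<in> J \<Longrightarrow> continuous_on X (\<lambda>x. f x t)"
    and K: "\<And>t. t \<in> J \<Longrightarrow> \<exists>K. \<forall>s\<in>J. \<forall>x\<in>X. \<bar>f x s - f x t\<bar> \<le> K * (\<bar>s - t\<bar> + (s - t)\<^sup>2)"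
  shows "continuous_on (X \<times> J) (\<lambda>(x, t). f x t)"
  unfolding continuous_on_def
proof (clarify)
  fix x t assume xt: "x \<in> X" "t \<in> J"
  let ?F = "at (x, t) within X \<times> J"
  obtain K where K: "\<And>s x. s \<in> J \<Longrightarrow> x \<in> X \<Longrightarrow> \<bar>f x s - f x t\<bar> \<le> K * (\<bar>s - t\<bar> + (s - t)\<^sup>2)" using K xt by blast
  have sn: "(snd \<longlongrightarrow> t) ?F" and fs: "(fst \<longlongrightarrow> x) ?F"
    using tendsto_snd[OF tendsto_ident_at, of "(x,t)" "X \<times> J"] tendsto_fst[OF tendsto_ident_at, of "(x,t)" "X \<times> J"] by simp_all
  have ev: "\<forall>\<^sub>F p in ?F. p \<in> X \<times> J" by (simp add: eventually_at_filter)
  have 1: "((\<lambda>p. f (fst p) (snd p) - f (fst p) t) \<longlongrightarrow> 0) ?F"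
  proof (rule Lim_null_comparison)
    show "\<forall>\<^sub>F p in ?F. norm (f (fst p) (snd p) - f (fst p) t) \<le> K * (\<bar>snd p - t\<bar> + (snd p - t)\<^sup>2)"
      using ev by eventually_elim (auto simp: K)
    have "((\<lambda>p. K * (\<bar>snd p - t\<bar> + (snd p - t)\<^sup>2)) \<longlongrightarrow> K * (\<bar>t - t\<bar> + (t - t)\<^sup>2)) ?F"
      by (intro tendsto_intros sn)
    then show "((\<lambda>p. K * (\<bar>snd p - t\<bar> + (snd p - t)\<^sup>2)) \<longlongrightarrow> 0) ?F" by simp
  qed
  have 2: "((\<lambda>p. f (fst p) t) \<longlongrightarrow> f x t) ?F"
    by (rule continuous_on_tendsto_compose[OF c[OF xt(2)] fs xt(1)]) (use ev in eventually_elim, auto)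
  from tendsto_add[OF 1 2] show "((\<lambda>(x, t). f x t) \<longlongrightarrow> f x t) ?F" by (simp add: case_prod_beta')
qed

text \<open>\<open>v\<close>, \<open>vx\<close>, \<open>w\<close>, \<open>wx\<close> stand for
  \<open>u_t\<close>, \<open>u_tx\<close>, \<open>u_tt\<close>, \<open>u_ttx\<close>. With this
  regularity the energies of the interior estimate can be differentiated in time under the integral
  and their fluxes integrated in space.\<close>

definition smooth_heat ::
  "(real \<Rightarrow> real) \<Rightarrow> real set \<Rightarrow> real \<Rightarrow> (real \<Rightarrow> real \<Rightarrow> real) \<Rightarrow> (real \<Rightarrow> real \<Rightarrow> real) \<Rightarrow> (real \<Rightarrow> real \<Rightarrow> real) \<Rightarrow>
   (real \<Rightarrow> real \<Rightarrow> real) \<Rightarrow> (real \<Rightarrow> real \<Rightarrow> real) \<Rightarrow> (real \<Rightarrow> real \<Rightarrow> real) \<Rightarrow> bool"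
where
  "smooth_heat a X S u ux v vx w wx \<longleftrightarrow>
     heat_solution a X {0..S} u ux v \<and> heat_solution a X {0..S} v vx w \<and>
     (\<forall>x\<in>X. \<forall>t\<in>{0..S}. ((\<lambda>s. ux x s) has_real_derivative vx x t) (at t within {0..S}) \<and>
        ((\<lambda>s. vx x s) has_real_derivative wx x t) (at t within {0..S}) \<and>
        ((\<lambda>y. w y t) has_real_derivative wx x t) (at x within X)) \<and>
     (\<forall>f\<in>{u, ux, v, vx, w, wx}. continuous_on (X \<times> {0..S}) (\<lambda>(x, t). f x t))"

lemma smooth_heatI:
  assumes "heat_solution a X {0..S} u ux v" "heat_solution a X {0..S} v vx w"
    and "\<And>x t. x \<in> X \<Longrightarrow> t \<in> {0..S} \<Longrightarrow> ((\<lambda>s. ux x s) has_real_derivative vx x t) (at t within {0..S})"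
    and "\<And>x t. x \<in> X \<Longrightarrow> t \<in> {0..S} \<Longrightarrow> ((\<lambda>s. vx x s) has_real_derivative wx x t) (at t within {0..S})"
    and "\<And>x t. x \<in> X \<Longrightarrow> t \<in> {0..S} \<Longrightarrow> ((\<lambda>y. w y t) has_real_derivative wx x t) (at x within X)"
    and "continuous_on (X \<times> {0..S}) (\<lambda>(x, t). u x t)" "continuous_on (X \<times> {0..S}) (\<lambda>(x, t). ux x t)"
      "continuous_on (X \<times> {0..S}) (\<lambda>(x, t). v x t)" "continuous_on (X \<times> {0..S}) (\<lambda>(x, t). vx x t)"
      "continuous_on (X \<times> {0..S}) (\<lambda>(x, t). w x t)" "continuous_on (X \<times> {0..S}) (\<lambda>(x, t). wx x t)"
  shows "smooth_heat a X S u ux v vx w wx"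
  unfolding smooth_heat_def using assms by (intro conjI ballI) (auto simp only: insert_iff empty_iff)

lemma smooth_heatD:
  assumes "smooth_heat a X S u ux v vx w wx"
  shows "heat_solution a X {0..S} u ux v" "heat_solution a X {0..S} v vx w"
    and "\<And>x t. x \<in> X \<Longrightarrow> t \<in> {0..S} \<Longrightarrow> ((\<lambda>s. ux x s) has_real_derivative vx x t) (at t within {0..S})"
    and "\<And>x t. x \<in> X \<Longrightarrow> t \<in> {0..S} \<Longrightarrow> ((\<lambda>s. vx x s) has_real_derivative wx x t) (at t within {0..S})"
    and "\<And>x t. x \<in> X \<Longrightarrow> t \<in> {0..S} \<Longrightarrow> ((\<lambda>y. w y t) has_real_derivative wx x t) (at x within X)"
    and "continuous_on (X \<times> {0..S}) (\<lambda>(x, t). u x t)" "continuous_on (X \<times> {0..S}) (\<lambda>(x, t). ux x t)"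
      "continuous_on (X \<times> {0..S}) (\<lambda>(x, t). v x t)" "continuous_on (X \<times> {0..S}) (\<lambda>(x, t). vx x t)"
      "continuous_on (X \<times> {0..S}) (\<lambda>(x, t). w x t)" "continuous_on (X \<times> {0..S}) (\<lambda>(x, t). wx x t)"
  using assms unfolding smooth_heat_def by simp_all

lemma smooth_heat_diff:
  assumes 1: "smooth_heat a X S u ux v vx w wx" and 2: "smooth_heat a X S u' ux' v' vx' w' wx'"
  shows "smooth_heat a X S (\<lambda>x t. u x t - u' x t) (\<lambda>x t. ux x t - ux' x t) (\<lambda>x t. v x t - v' x t)
    (\<lambda>x t. vx x t - vx' x t) (\<lambda>x t. w x t - w' x t) (\<lambda>x t. wx x t - wx' x t)"
proof -
  note A = smooth_heatD[OF 1] and B = smooth_heatD[OF 2]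
  have c: "continuous_on (X \<times> {0..S}) (\<lambda>(x, t). f x t - g x t)"
    if "continuous_on (X \<times> {0..S}) (\<lambda>(x, t). f x t)" "continuous_on (X \<times> {0..S}) (\<lambda>(x, t). g x t)"
    for f g :: "real \<Rightarrow> real \<Rightarrow> real"
    using continuous_on_diff[OF that] by (simp add: split_beta)
  show ?thesis
    by (rule smooth_heatI[OF heat_solution_diff[OF A(1) B(1)] heat_solution_diff[OF A(2) B(2)]
        DERIV_diff[OF A(3) B(3)] DERIV_diff[OF A(4) B(4)] DERIV_diff[OF A(5) B(5)]
        c[OF A(6) B(6)] c[OF A(7) B(7)] c[OF A(8) B(8)] c[OF A(9) B(9)] c[OF A(10) B(10)] c[OF A(11) B(11)]])
qed

lemma smooth_heat_subset:
  assumes 1: "smooth_heat a X S u ux v vx w wx" and X: "Y \<subseteq> X"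
  shows "smooth_heat a Y S u ux v vx w wx"
proof -
  note A = smooth_heatD[OF 1]
  have sub: "Y \<times> {0..S} \<subseteq> X \<times> {0..S}" using X by auto
  show ?thesis
  proof (rule smooth_heatI)
    show "((\<lambda>y. w y t) has_real_derivative wx x t) (at x within Y)" if "x \<in> Y" "t \<in> {0..S}" for x t
      by (rule DERIV_subset[OF A(5) X]) (use that X in auto)
  qed (use X A(3,4) in \<open>auto intro: heat_solution_subset[OF A(1) X] heat_solution_subset[OF A(2) X]
      continuous_on_subset[OF A(6) sub] continuous_on_subset[OF A(7) sub] continuous_on_subset[OF A(8) sub]
      continuous_on_subset[OF A(9) sub] continuous_on_subset[OF A(10) sub] continuous_on_subset[OF A(11) sub]\<close>)
qed

lemma smooth_heat_add_affine:
  assumes 1: "smooth_heat a X S u ux v vx w wx"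
  shows "smooth_heat a X S (\<lambda>x t. u x t + (p + q * x)) (\<lambda>x t. ux x t + q) v vx w wx"
proof -
  note A = smooth_heatD[OF 1]
  have "heat_solution a X {0..S} (\<lambda>x t. p + q * x) (\<lambda>x t. q) (\<lambda>x t. 0)"
    by (rule heat_solutionI) (auto intro!: derivative_eq_intros)
  from heat_solution_add[OF A(1) this]
  have H: "heat_solution a X {0..S} (\<lambda>x t. u x t + (p + q * x)) (\<lambda>x t. ux x t + q) v" by simp
  have c1: "continuous_on (X \<times> {0..S}) (\<lambda>(x, t). u x t + (p + q * x))"
    and c2: "continuous_on (X \<times> {0..S}) (\<lambda>(x, t). ux x t + q)"
    using A(6,7) by (auto simp: split_beta intro!: continuous_intros)
  have d: "((\<lambda>s. ux x s + q) has_real_derivative vx x t) (at t within {0..S})" if "x \<in> X" "t \<in> {0..S}" for x t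
    using DERIV_add[OF A(3)[OF that] DERIV_const[of q]] by simp
  show ?thesis by (rule smooth_heatI[OF H A(2) d A(4,5) c1 c2 A(8-11)])
qed

section \<open>From the semigroup to smooth solutions\<close>

context interval_operator
begin

text \<open>One constant for all functions, depending on the length of the interval and the minimum
  of \<open>a\<close>. This uniformity makes it applicable to time increments.\<close>

lemma derivative_bound:
  obtains C where "C \<ge> 0"
    "\<And>f f' q A x. (\<And>x. x \<in> {\<alpha>..\<beta>} \<Longrightarrow> (f has_real_derivative f' x) (at x within {\<alpha>..\<beta>})) \<Longrightarrow>
      (\<And>x. x \<in> {\<alpha>..\<beta>} \<Longrightarrow> (f' has_real_derivative q x / a x) (at x within {\<alpha>..\<beta>})) \<Longrightarrow>
      (\<And>x. x \<in> {\<alpha>..\<beta>} \<Longrightarrow> \<bar>f x\<bar> \<le> A) \<Longrightarrow> (\<And>x. x \<in> {\<alpha>..\<beta>} \<Longrightarrow> \<bar>q x\<bar> \<le> A) \<Longrightarrow> x \<in> {\<alpha>..\<beta>} \<Longrightarrow> \<bar>f' x\<bar> \<le> C * A"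
proof -
  obtain x0 where x0: "x0 \<in> {\<alpha>..\<beta>}" "\<And>y. y \<in> {\<alpha>..\<beta>} \<Longrightarrow> a x0 \<le> a y"
    using continuous_attains_inf[OF _ _ a_cont] ab by auto
  define m where "m = a x0"
  have m: "m > 0" "\<And>y. y \<in> {\<alpha>..\<beta>} \<Longrightarrow> m \<le> a y" using x0 a_pos by (auto simp: m_def)
  show ?thesis
  proof
    show "2 / (\<beta> - \<alpha>) + (\<beta> - \<alpha>) / m \<ge> 0" using m ab by simp
    fix f f' q :: "real \<Rightarrow> real" and A x
    assume f: "\<And>x. x \<in> {\<alpha>..\<beta>} \<Longrightarrow> (f has_real_derivative f' x) (at x within {\<alpha>..\<beta>})"
      "\<And>x. x \<in> {\<alpha>..\<beta>} \<Longrightarrow> (f' has_real_derivative q x / a x) (at x within {\<alpha>..\<beta>})"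
      "\<And>x. x \<in> {\<alpha>..\<beta>} \<Longrightarrow> \<bar>f x\<bar> \<le> A" "\<And>x. x \<in> {\<alpha>..\<beta>} \<Longrightarrow> \<bar>q x\<bar> \<le> A" and x: "x \<in> {\<alpha>..\<beta>}"
    have "\<bar>q y / a y\<bar> \<le> A / m" if "y \<in> {\<alpha>..\<beta>}" for y
      using f(4)[OF that] m(1) m(2)[OF that] by (auto simp: abs_divide intro!: frac_le)
    from derivative_interpolation[OF ab f(1,2,3) this x]
    show "\<bar>f' x\<bar> \<le> (2 / (\<beta> - \<alpha>) + (\<beta> - \<alpha>) / m) * A" by (simp add: algebra_simps)
  qed
qed

text \<open>\<open>F j t\<close> plays the role of the \<open>j\<close>-th time derivative of
  \<open>u\<close>: by \<open>D\<close>, \<open>F (Suc j)\<close> is \<open>a\<close> times the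
  second space derivative of \<open>F j\<close>; by \<open>T\<close>, it is the time derivative.
  \<open>derivative_bound\<close> transfers time regularity from \<open>F j\<close> and
  \<open>F (Suc j)\<close> to the space derivative \<open>Fx j\<close>.\<close>

lemma smooth_heat_of_family:
  fixes F :: "nat \<Rightarrow> real \<Rightarrow> real \<Rightarrow>\<^sub>C real"
  assumes D: "\<And>j t. j \<le> 2 \<Longrightarrow> t \<ge> 0 \<Longrightarrow> D2 (F j t) (\<lambda>x. F (Suc j) t x / a x)"
    and T: "\<And>j t s. j \<le> 3 \<Longrightarrow> t \<ge> 0 \<Longrightarrow> s \<ge> 0 \<Longrightarrow> norm (F j t - F j s - (t - s) *\<^sub>R F (Suc j) s) \<le> (t - s)\<^sup>2 * M"
  obtains ux vx wx where "smooth_heat a {\<alpha>..\<beta>} S (\<lambda>x t. F 0 t x) ux (\<lambda>x t. F 1 t x) vx (\<lambda>x t. F 2 t x) wx"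
proof -
  have "\<exists>u'. \<forall>x\<in>{\<alpha>..\<beta>}. (F j t has_real_derivative u' x) (at x within {\<alpha>..\<beta>}) \<and>
      (u' has_real_derivative F (Suc j) t x / a x) (at x within {\<alpha>..\<beta>})" if "j \<le> 2" "t \<ge> 0" for j t
    using D[OF that] unfolding second_derivative_on_def .
  then obtain Fx where Fx: "\<And>j t x. j \<le> 2 \<Longrightarrow> t \<ge> 0 \<Longrightarrow> x \<in> {\<alpha>..\<beta>} \<Longrightarrow> (F j t has_real_derivative Fx j t x) (at x within {\<alpha>..\<beta>})"
    "\<And>j t x. j \<le> 2 \<Longrightarrow> t \<ge> 0 \<Longrightarrow> x \<in> {\<alpha>..\<beta>} \<Longrightarrow> (Fx j t has_real_derivative F (Suc j) t x / a x) (at x within {\<alpha>..\<beta>})"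
    by metis
  obtain C where C: "C \<ge> 0"
    "\<And>f f' q A x. (\<And>x. x \<in> {\<alpha>..\<beta>} \<Longrightarrow> (f has_real_derivative f' x) (at x within {\<alpha>..\<beta>})) \<Longrightarrow>
      (\<And>x. x \<in> {\<alpha>..\<beta>} \<Longrightarrow> (f' has_real_derivative q x / a x) (at x within {\<alpha>..\<beta>})) \<Longrightarrow>
      (\<And>x. x \<in> {\<alpha>..\<beta>} \<Longrightarrow> \<bar>f x\<bar> \<le> A) \<Longrightarrow> (\<And>x. x \<in> {\<alpha>..\<beta>} \<Longrightarrow> \<bar>q x\<bar> \<le> A) \<Longrightarrow> x \<in> {\<alpha>..\<beta>} \<Longrightarrow> \<bar>f' x\<bar> \<le> C * A"
    using derivative_bound by blast
  have M: "M \<ge> 0"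
    using order_trans[OF norm_ge_zero T[of 0 1 0]] by simp
  have T': "\<bar>F j t x - F j s x - (t - s) * F (Suc j) s x\<bar> \<le> M * (t - s)\<^sup>2"
    if "j \<le> 3" "t \<ge> 0" "s \<ge> 0" for j t s x
    using order_trans[OF norm_bounded[of "F j t - F j s - (t - s) *\<^sub>R F (Suc j) s" x] T[OF that]] by (simp add: mult.commute)
  have Lip: "\<bar>F j t x - F j s x\<bar> \<le> (norm (F (Suc j) s) + M) * (\<bar>t - s\<bar> + (t - s)\<^sup>2)"
    if "j \<le> 3" "t \<ge> 0" "s \<ge> 0" for j t s x
  proof -
    have "\<bar>F j t x - F j s x\<bar> \<le> \<bar>t - s\<bar> * norm (F (Suc j) s) + M * (t - s)\<^sup>2"
    proof -
      have "\<bar>(t - s) * F (Suc j) s x\<bar> \<le> \<bar>t - s\<bar> * norm (F (Suc j) s)"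
        using norm_bounded[of "F (Suc j) s" x] by (simp add: abs_mult mult_left_mono)
      with T'[OF that, of x] show ?thesis by linarith
    qed
    also have "\<dots> \<le> (norm (F (Suc j) s) + M) * (\<bar>t - s\<bar> + (t - s)\<^sup>2)"
      using M by (simp add: algebra_simps)
    finally show ?thesis .
  qed
  have cF: "continuous_on ({\<alpha>..\<beta>} \<times> {0..S}) (\<lambda>(x, t). F j t x)" if "j \<le> 3" for j
  proof (rule continuous_on_Times_Lipschitz)
    show "\<exists>K. \<forall>s\<in>{0..S}. \<forall>x\<in>{\<alpha>..\<beta>}. \<bar>F j s x - F j t x\<bar> \<le> K * (\<bar>s - t\<bar> + (s - t)\<^sup>2)" if "t \<in> {0..S}" for t
      using Lip[OF \<open>j \<le> 3\<close>, of _ t] that by (intro exI[of _ "norm (F (Suc j) t) + M"]) auto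
  qed auto
  have cFx: "continuous_on ({\<alpha>..\<beta>} \<times> {0..S}) (\<lambda>(x, t). Fx j t x)" if j: "j \<le> 2" for j
  proof (rule continuous_on_Times_Lipschitz)
    fix t assume t: "t \<in> {0..S}"
    show "continuous_on {\<alpha>..\<beta>} (\<lambda>x. Fx j t x)"
      by (rule DERIV_continuous_on[OF Fx(2)]) (use j t in auto)
    define K where "K = norm (F (Suc j) t) + M + (norm (F (Suc (Suc j)) t) + M)"
    have "\<bar>Fx j s x - Fx j t x\<bar> \<le> C * (K * (\<bar>s - t\<bar> + (s - t)\<^sup>2))" if s: "s \<in> {0..S}" and x: "x \<in> {\<alpha>..\<beta>}" for s x
    proof (rule C(2)[OF _ _ _ _ x])
      have st: "s \<ge> 0" "t \<ge> 0" using s t by auto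
      fix x assume x: "x \<in> {\<alpha>..\<beta>}"
      show "((\<lambda>x. F j s x - F j t x) has_real_derivative Fx j s x - Fx j t x) (at x within {\<alpha>..\<beta>})"
        by (intro DERIV_diff Fx j st x)
      show "((\<lambda>x. Fx j s x - Fx j t x) has_real_derivative (F (Suc j) s x - F (Suc j) t x) / a x) (at x within {\<alpha>..\<beta>})"
        unfolding diff_divide_distrib by (intro DERIV_diff Fx j st x)
      have K: "norm (F (Suc j) t) + M \<le> K" "norm (F (Suc (Suc j)) t) + M \<le> K" using M by (auto simp: K_def)
      show "\<bar>F j s x - F j t x\<bar> \<le> K * (\<bar>s - t\<bar> + (s - t)\<^sup>2)"
        by (rule order_trans[OF Lip mult_right_mono[OF K(1)]]) (use j st in auto)
      show "\<bar>F (Suc j) s x - F (Suc j) t x\<bar> \<le> K * (\<bar>s - t\<bar> + (s - t)\<^sup>2)"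
        by (rule order_trans[OF Lip mult_right_mono[OF K(2)]]) (use j st in auto)
    qed
    then show "\<exists>K. \<forall>s\<in>{0..S}. \<forall>x\<in>{\<alpha>..\<beta>}. \<bar>Fx j s x - Fx j t x\<bar> \<le> K * (\<bar>s - t\<bar> + (s - t)\<^sup>2)"
      by (intro exI[of _ "C * K"]) (auto simp: mult.assoc)
  qed
  have dF: "((\<lambda>s. F j s x) has_real_derivative F (Suc j) t x) (at t within {0..S})" if "j \<le> 3" "t \<in> {0..S}" for j t x
    by (rule has_real_derivative_quadratic[where K=M], rule T') (use that in auto)
  have dFx: "((\<lambda>s. Fx j s x) has_real_derivative Fx (Suc j) t x) (at t within {0..S})"
    if j: "j \<le> 1" and t: "t \<in> {0..S}" and x: "x \<in> {\<alpha>..\<beta>}" for j t x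
  proof (rule has_real_derivative_quadratic)
    fix s assume s: "s \<in> {0..S}"
    have st: "s \<ge> 0" "t \<ge> 0" using s t by auto
    have j': "j \<le> 2" "Suc j \<le> 2" using j by auto
    \<comment> \<open>The Taylor remainder of \<open>Fx j\<close> in time is the space derivative of
      the remainder of \<open>F j\<close>, so it inherits a quadratic bound.\<close>
    have "\<bar>Fx j s x - Fx j t x - (s - t) * Fx (Suc j) t x\<bar> \<le> C * (M * (s - t)\<^sup>2)"
    proof (rule C(2)[OF _ _ _ _ x])
      fix x assume x: "x \<in> {\<alpha>..\<beta>}"
      show "((\<lambda>x. F j s x - F j t x - (s - t) * F (Suc j) t x) has_real_derivative Fx j s x - Fx j t x - (s - t) * Fx (Suc j) t x) (at x within {\<alpha>..\<beta>})"
        by (intro DERIV_diff DERIV_cmult Fx j' st x)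
      have "((\<lambda>x. Fx j s x - Fx j t x - (s - t) * Fx (Suc j) t x) has_real_derivative
          F (Suc j) s x / a x - F (Suc j) t x / a x - (s - t) * (F (Suc (Suc j)) t x / a x)) (at x within {\<alpha>..\<beta>})"
        by (intro DERIV_diff DERIV_cmult Fx j' st x)
      then show "((\<lambda>x. Fx j s x - Fx j t x - (s - t) * Fx (Suc j) t x) has_real_derivative
          (F (Suc j) s x - F (Suc j) t x - (s - t) * F (Suc (Suc j)) t x) / a x) (at x within {\<alpha>..\<beta>})"
        by (simp add: diff_divide_distrib)
      show "\<bar>F j s x - F j t x - (s - t) * F (Suc j) t x\<bar> \<le> M * (s - t)\<^sup>2" by (rule T') (use j st in auto)
      show "\<bar>F (Suc j) s x - F (Suc j) t x - (s - t) * F (Suc (Suc j)) t x\<bar> \<le> M * (s - t)\<^sup>2" by (rule T') (use j st in auto)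
    qed
    then show "\<bar>Fx j s x - Fx j t x - (s - t) * Fx (Suc j) t x\<bar> \<le> C * M * (s - t)\<^sup>2" by (simp add: mult.assoc)
  qed
  have H: "heat_solution a {\<alpha>..\<beta>} {0..S} (\<lambda>x t. F j t x) (\<lambda>x t. Fx j t x) (\<lambda>x t. F (Suc j) t x)" if "j \<le> 2" for j
    by (rule heat_solutionI) (use Fx dF that in auto)
  have "smooth_heat a {\<alpha>..\<beta>} S (\<lambda>x t. F 0 t x) (\<lambda>x t. Fx 0 t x) (\<lambda>x t. F 1 t x) (\<lambda>x t. Fx 1 t x) (\<lambda>x t. F 2 t x) (\<lambda>x t. Fx 2 t x)"
  proof (rule smooth_heatI)
    show "heat_solution a {\<alpha>..\<beta>} {0..S} (\<lambda>x t. F 0 t x) (\<lambda>x t. Fx 0 t x) (\<lambda>x t. F 1 t x)" using H[of 0] by simp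
    show "heat_solution a {\<alpha>..\<beta>} {0..S} (\<lambda>x t. F 1 t x) (\<lambda>x t. Fx 1 t x) (\<lambda>x t. F 2 t x)"
      using H[of 1] by (simp add: numeral_2_eq_2)
    show "((\<lambda>s. Fx 0 s x) has_real_derivative Fx 1 t x) (at t within {0..S})" if "x \<in> {\<alpha>..\<beta>}" "t \<in> {0..S}" for x t
      using dFx[of 0 t x] that by simp
    show "((\<lambda>s. Fx 1 s x) has_real_derivative Fx 2 t x) (at t within {0..S})" if "x \<in> {\<alpha>..\<beta>}" "t \<in> {0..S}" for x t
      using dFx[of 1 t x] that by (simp add: numeral_2_eq_2)
    show "((\<lambda>y. F 2 t y) has_real_derivative Fx 2 t x) (at x within {\<alpha>..\<beta>})" if "x \<in> {\<alpha>..\<beta>}" "t \<in> {0..S}" for x t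
      using Fx(1)[of 2 t x] that by simp
  qed (auto intro: cF cFx)
  then show ?thesis by (rule that)
qed

lemma approximate_smooth_heat_vanishing:
  assumes g: "vanishing g" and e: "e > 0"
  obtains u ux v vx w wx where "smooth_heat a {\<alpha>..\<beta>} S u ux v vx w wx"
    "\<And>t. t \<in> {0..S} \<Longrightarrow> u \<alpha> t = 0 \<and> u \<beta> t = 0" "\<And>x. \<bar>u x 0 - g x\<bar> \<le> e"
proof -
  obtain l where lam: "l > 0" "norm ((Res l ^^ 7) g - g) \<le> e" using Res_funpow_approx[OF g e] by blast
  interpret resolvent_family Res l by (rule resolvent_family_Res[OF lam(1)])
  \<comment> \<open>Each time derivative trades one \<open>R\<close> for a \<open>B\<close>. Four
    derivatives use up four factors, and three more \<open>R\<close> stand in front for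
    \<open>P_taylor\<close>; hence the power 7 of the resolvent.\<close>
  define y where "y = (\<lambda>j::nat. if j = 0 then R (R (R (R g))) else if j = 1 then R (R (R (B g)))
      else if j = 2 then R (R (B (B g))) else if j = 3 then R (B (B (B g))) else B (B (B (B g))))"
  define F where "F = (\<lambda>j t. P t (R (R (R (y j)))))"
  have By: "R (R (B (y j))) = R (R (R (y (Suc j))))" if "j \<le> 3" for j
  proof -
    have "j = 0 \<or> j = 1 \<or> j = 2 \<or> j = 3" using that by auto
    then show ?thesis by (auto simp: y_def BR)
  qed
  define M where "M = (\<Sum>j\<le>3. norm (R (B (B (y j)))))"
  have T: "norm (F j t - F j s - (t - s) *\<^sub>R F (Suc j) s) \<le> (t - s)\<^sup>2 * M" if "j \<le> 3" "t \<ge> 0" "s \<ge> 0" for j t s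
  proof -
    have "norm (F j t - F j s - (t - s) *\<^sub>R F (Suc j) s) \<le> (t - s)\<^sup>2 * norm (R (B (B (y j))))"
      using P_taylor[OF that(2,3), of "y j"] By[OF that(1)] by (simp add: F_def)
    also have "\<dots> \<le> (t - s)\<^sup>2 * M"
      unfolding M_def using that by (intro mult_left_mono member_le_sum) auto
    finally show ?thesis .
  qed
  have bv: "bvp l (P t (R (R (y j)))) (F j t)" if "t \<ge> 0" for j t
    using bvp_Res[OF lam(1), of "P t (R (R (y j)))"] by (simp add: F_def P_R[OF that])
  have D: "D2 (F j t) (\<lambda>x. F (Suc j) t x / a x)" if "j \<le> 2" "t \<ge> 0" for j t
  proof -
    have 1: "D2 (F j t) (\<lambda>x. (F j t x - P t (R (R (y j))) x) / (l * a x))"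
      using bv[OF that(2), of j] by (simp add: bvp_def)
    have "F (Suc j) t = P t (R (R (B (y j))))" using By[of j] that by (simp add: F_def)
    also have "\<dots> = B (P t (R (R (y j))))" by (rule P_B[OF that(2)])
    also have "\<dots> = (F j t - P t (R (R (y j)))) /\<^sub>R l" by (simp add: B_def F_def P_R[OF that(2)])
    finally have "F (Suc j) t x = (F j t x - P t (R (R (y j))) x) / l" for x
      by (simp add: divide_inverse mult.commute)
    then show ?thesis
      using second_derivative_on_cong[OF 1, of "\<lambda>x. F (Suc j) t x / a x"] by simp
  qed
  obtain ux vx wx where sm: "smooth_heat a {\<alpha>..\<beta>} S (\<lambda>x t. F 0 t x) ux (\<lambda>x t. F 1 t x) vx (\<lambda>x t. F 2 t x) wx"
    using smooth_heat_of_family[of F M S, OF D T] by blast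
  show ?thesis
  proof (rule that[OF sm])
    show "F 0 t \<alpha> = 0 \<and> F 0 t \<beta> = 0" if "t \<in> {0..S}" for t
      using bv[of t 0] that by (auto simp: bvp_def vanishing_def)
    have "F 0 0 = (Res l ^^ 7) g" by (simp add: F_def P_0 y_def numeral_eq_Suc)
    then show "\<bar>F 0 0 x - g x\<bar> \<le> e" for x
      using order_trans[OF norm_bounded[of "(Res l ^^ 7) g - g" x] lam(2)] by simp
  qed
qed

text \<open>The affine interpolant of the boundary values is a stationary solution for every
  \<open>a\<close> and can be split off. Boundary values are then met exactly; only the initial
  values are approximate.\<close>

lemma approximate_smooth_heat:
  assumes g: "continuous_on {\<alpha>..\<beta>} g" and e: "e > 0"
  obtains u ux v vx w wx where "smooth_heat a {\<alpha>..\<beta>} S u ux v vx w wx"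
    "\<And>t. t \<in> {0..S} \<Longrightarrow> u \<alpha> t = g \<alpha> \<and> u \<beta> t = g \<beta>" "\<And>x. x \<in> {\<alpha>..\<beta>} \<Longrightarrow> \<bar>u x 0 - g x\<bar> \<le> e"
proof -
  define q where "q = (g \<beta> - g \<alpha>) / (\<beta> - \<alpha>)"
  define p where "p = g \<alpha> - q * \<alpha>"
  have pq: "p + q * \<alpha> = g \<alpha>" "p + q * \<beta> = g \<beta>"
  proof -
    show "p + q * \<alpha> = g \<alpha>" by (simp add: p_def)
    have "q * (\<beta> - \<alpha>) = g \<beta> - g \<alpha>" using ab by (simp add: q_def)
    then show "p + q * \<beta> = g \<beta>" by (simp add: p_def algebra_simps)
  qed
  have "continuous_on {\<alpha>..\<beta>} (\<lambda>x. g x - (p + q * x))" by (intro continuous_intros g)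
  then obtain f where f: "vanishing f" "\<And>x. x \<in> {\<alpha>..\<beta>} \<Longrightarrow> apply_bcontfun f x = g x - (p + q * x)"
    by (rule extend_vanishing) (use pq in auto)
  obtain u ux v vx w wx where u: "smooth_heat a {\<alpha>..\<beta>} S u ux v vx w wx"
    "\<And>t. t \<in> {0..S} \<Longrightarrow> u \<alpha> t = 0 \<and> u \<beta> t = 0" "\<And>x. \<bar>u x 0 - f x\<bar> \<le> e"
    using approximate_smooth_heat_vanishing[OF f(1) e, of S] by blast
  show ?thesis
  proof (rule that[OF smooth_heat_add_affine[OF u(1), of p q]])
    show "u \<alpha> t + (p + q * \<alpha>) = g \<alpha> \<and> u \<beta> t + (p + q * \<beta>) = g \<beta>" if "t \<in> {0..S}" for t
      using u(2)[OF that] pq by simp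
    show "\<bar>u x 0 + (p + q * x) - g x\<bar> \<le> e" if "x \<in> {\<alpha>..\<beta>}" for x
      using u(3)[of x] f(2)[OF that] by (simp add: algebra_simps)
  qed
qed

end

subsection \<open>Interior estimates\<close>

text \<open>With \<open>e\<close> a cutoff, \<open>p = u_x\<close>, \<open>v = u_t\<close>, \<open>q = u_tx\<close>, \<open>w = u_tt\<close> and \<open>b = 1 / a\<close>, the left-hand side is, up to a space
  derivative, the time derivative of \<open>A0 e^2 u^2 / a + A1 t e^4 p^2 + A2 t^2 e^6 v^2 / a + t^3 e^8 q^2\<close>. The powers of \<open>t\<close>
  remove the initial values, and each constant lets the dissipation of its term absorb the errors of the next one.\<close>

lemma energy_inequality:
  fixes e e' t a b u p v q w c \<Lambda> S A0 A1 A2 :: real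
  assumes e: "0 \<le> e" "e \<le> 1" and e': "e'\<^sup>2 \<le> c" and t: "0 \<le> t" "t \<le> S" and a: "0 < a" "a \<le> \<Lambda>" and b: "a * b = 1"
    and A: "A2 = 3 + 64 * (S * \<Lambda> * c)" "A1 = A2 * (2 + 36 * (S * \<Lambda> * c))" "A0 = A1 * (1 + 16 * (S * \<Lambda> * c))"
  shows "- 4 * A0 * e * e' * u * p - 2 * A0 * e^2 * p^2 + A1 * e^4 * p^2 - 8 * A1 * t * e^3 * e' * p * v
    - 2 * A1 * t * e^4 * v^2 * b + 2 * A2 * t * e^6 * v^2 * b - 12 * A2 * t^2 * e^5 * e' * v * q - 2 * A2 * t^2 * e^6 * q^2
    + 3 * t^2 * e^8 * q^2 - 16 * t^3 * e^7 * e' * q * w - 2 * t^3 * e^8 * w^2 * b \<le> 4 * A0 * c * u^2"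
proof -
  define Z where "Z = S * \<Lambda> * c"
  have b0: "b > 0" using a b by (metis zero_less_mult_pos zero_less_one)
  have c0: "c \<ge> 0" using e' zero_le_power2 order_trans by blast
  have S0: "S \<ge> 0" "\<Lambda> \<ge> 0" using t a by auto
  have Z0: "Z \<ge> 0" unfolding Z_def using c0 S0 by simp
  have A': "A2 = 3 + 64 * Z" "A1 = A2 * (2 + 36 * Z)" "A0 = A1 * (1 + 16 * Z)" using A by (simp_all add: Z_def)
  have A20: "A2 \<ge> 0" using A' Z0 by simp
  have A10: "A1 \<ge> 0" using A' Z0 A20 by simp
  have A00: "A0 \<ge> 0" using A' Z0 A10 by simp
  \<comment> \<open>The factor left over when squares are completed below, bounded by a number that
    does not depend on the point.\<close>
  have taz: "t * a * e'^2 \<le> Z"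
    unfolding Z_def using t a e' c0 S0 by (intro mult_mono) auto
  have pw: "e ^ (k + j) \<le> e ^ k" for k j using e by (intro power_decreasing) auto
  \<comment> \<open>The squares \<open>s1\<close> to \<open>s4\<close> absorb the four cross terms
    containing \<open>e'\<close>, each using half of one dissipation term.\<close>
  have s1: "0 \<le> A0 * (e * p + 2 * e' * u)^2" using A00 by simp
  have s2: "0 \<le> A1 * t * b * (e^2 * v + 4 * a * e * e' * p)^2" using A10 t b0 by simp
  have s3: "0 \<le> A2 * t^2 * (e^3 * q + 6 * e^2 * e' * v)^2" using A20 by simp
  have s4: "0 \<le> t^3 * b * (e^4 * w + 8 * a * e^3 * e' * q)^2" using t b0 by simp
  have s5: "0 \<le> t^3 * e^8 * w^2 * b" using t e b0 by simp
  have E2: "A1 * t * b * (e^2 * v + 4 * a * e * e' * p)^2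
      = A1 * t * e^4 * v^2 * b + 8 * A1 * t * e^3 * e' * p * v + 16 * A1 * (t * a * e'^2) * (e^2 * p^2)"
    using b by algebra
  have E4: "t^3 * b * (e^4 * w + 8 * a * e^3 * e' * q)^2
      = t^3 * e^8 * w^2 * b + 16 * t^3 * e^7 * e' * q * w + 64 * (t * a * e'^2) * (t^2 * e^6 * q^2)"
    using b by algebra
  have E1: "A0 * (e * p + 2 * e' * u)^2 = A0 * e^2 * p^2 + 4 * A0 * e * e' * u * p + 4 * A0 * (e'^2) * u^2" by algebra
  have E3: "A2 * t^2 * (e^3 * q + 6 * e^2 * e' * v)^2
      = A2 * t^2 * e^6 * q^2 + 12 * A2 * t^2 * e^5 * e' * v * q + 36 * A2 * (t * a * e'^2) * (t * e^4 * v^2 * b)"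
    using b by algebra
  have r1: "16 * A1 * (t * a * e'^2) * (e^2 * p^2) \<le> 16 * A1 * Z * (e^2 * p^2)"
    using taz A10 by (intro mult_right_mono mult_left_mono) auto
  have r2: "A1 * e^4 * p^2 \<le> A1 * (e^2 * p^2)" using pw[of 2 2] A10 by (simp add: mult.assoc mult_left_mono mult_right_mono)
  have r3: "36 * A2 * (t * a * e'^2) * (t * e^4 * v^2 * b) \<le> 36 * A2 * Z * (t * e^4 * v^2 * b)"
    using taz A20 t b0 by (intro mult_right_mono mult_left_mono) auto
  have r4: "2 * A2 * t * e^6 * v^2 * b \<le> 2 * A2 * (t * e^4 * v^2 * b)"
  proof -
    have "2 * A2 * (t * v^2 * b) * e^6 \<le> 2 * A2 * (t * v^2 * b) * e^4"
      using pw[of 4 2] A20 t b0 by (intro mult_left_mono) auto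
    then show ?thesis by (simp add: mult_ac)
  qed
  have r5: "64 * (t * a * e'^2) * (t^2 * e^6 * q^2) \<le> 64 * Z * (t^2 * e^6 * q^2)"
    using taz by (intro mult_right_mono mult_left_mono) auto
  have r6: "3 * t^2 * e^8 * q^2 \<le> 3 * (t^2 * e^6 * q^2)"
  proof -
    have "3 * (t^2 * q^2) * e^8 \<le> 3 * (t^2 * q^2) * e^6" using pw[of 6 2] by (intro mult_left_mono) auto
    then show ?thesis by (simp add: mult_ac)
  qed
  have r7: "4 * A0 * (e'^2) * u^2 \<le> 4 * A0 * c * u^2" using e' A00 by (intro mult_right_mono mult_left_mono) auto
  \<comment> \<open>The other halves are spent exactly: \<open>A0\<close>, \<open>A1\<close>,
    \<open>A2\<close> are chosen such that each dissipation term pays for differentiating the power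
    of \<open>t\<close> in the next energy and for the remainder of the next square.\<close>
  have z1: "A0 * e^2 * p^2 = A1 * (e^2 * p^2) + 16 * A1 * Z * (e^2 * p^2)" unfolding A'(3) by algebra
  have z2: "A1 * t * e^4 * v^2 * b = 2 * A2 * (t * e^4 * v^2 * b) + 36 * A2 * Z * (t * e^4 * v^2 * b)" unfolding A'(2) by algebra
  have z3: "A2 * t^2 * e^6 * q^2 = 3 * (t^2 * e^6 * q^2) + 64 * Z * (t^2 * e^6 * q^2)" unfolding A'(1) by algebra
  show ?thesis
    using s1 s2 s3 s4 s5 r1 r2 r3 r4 r5 r6 r7 z1 z2 z3 unfolding E1 E2 E3 E4 by linarith
qed

section \<open>From energies to a pointwise bound of \<open>u_t\<close>\<close>

context interval_operator
begin

text \<open>A parabola, normalised so that it lies in \<open>[0, 1]\<close> and its slope is at most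
  \<open>1 / (\<beta> - \<alpha>)\<close>. Its zeros at the ends remove the boundary flux.\<close>

definition cutoff :: "real \<Rightarrow> real" where
  "cutoff x = (x - \<alpha>) * (\<beta> - x) / (\<beta> - \<alpha>)\<^sup>2"

definition cutoff' :: "real \<Rightarrow> real" where
  "cutoff' x = (\<alpha> + \<beta> - 2 * x) / (\<beta> - \<alpha>)\<^sup>2"

lemma cutoff_deriv [derivative_intros]: "(cutoff has_real_derivative cutoff' x) (at x within A)"
proof -
  have "((\<lambda>x. (x - \<alpha>) * (\<beta> - x)) has_real_derivative \<alpha> + \<beta> - 2 * x) (at x within A)"
    by (auto intro!: derivative_eq_intros)
  from DERIV_cdivide[OF this, of "(\<beta> - \<alpha>)\<^sup>2"] show ?thesis
    by (simp add: cutoff_def[abs_def] cutoff'_def)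
qed

lemma cutoff_ends [simp]: "cutoff \<alpha> = 0" "cutoff \<beta> = 0"
  by (simp_all add: cutoff_def)

lemma cutoff_bounds: assumes "x \<in> {\<alpha>..\<beta>}" shows "0 \<le> cutoff x" "cutoff x \<le> 1"
proof -
  show "0 \<le> cutoff x" using assms by (simp add: cutoff_def)
  have "(x - \<alpha>) * (\<beta> - x) \<le> (\<beta> - \<alpha>) * (\<beta> - \<alpha>)" using assms by (intro mult_mono) auto
  then show "cutoff x \<le> 1" using ab by (simp add: cutoff_def divide_le_eq_1 power2_eq_square)
qed

lemma cutoff'_bound: assumes "x \<in> {\<alpha>..\<beta>}" shows "\<bar>cutoff' x\<bar> \<le> 1 / (\<beta> - \<alpha>)"
proof -
  have "\<bar>cutoff' x\<bar> = \<bar>\<alpha> + \<beta> - 2 * x\<bar> / (\<beta> - \<alpha>)\<^sup>2" by (simp add: cutoff'_def)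
  also have "\<dots> \<le> (\<beta> - \<alpha>) / (\<beta> - \<alpha>)\<^sup>2" using assms by (intro divide_right_mono) auto
  also have "\<dots> = 1 / (\<beta> - \<alpha>)" using ab by (simp add: power2_eq_square)
  finally show ?thesis .
qed

text \<open>Integrating \<open>energy_inequality\<close> bounds the \<open>L^2\<close> norms of
  \<open>cutoff^3 * v\<close> and \<open>cutoff^4 * vx\<close> at time \<open>t\<close>. In one
  dimension these two control \<open>v\<close> pointwise, and the weights \<open>t^2\<close> and
  \<open>t^3\<close> turn into the singular factor. \<open>K\<close> is the same for all solutions
  on the interval.\<close>

lemma interior_estimate:
  assumes S: "S > 0"
  obtains K where "K \<ge> 0"
    "\<And>u ux v vx w wx M x t. smooth_heat a {\<alpha>..\<beta>} S u ux v vx w wx \<Longrightarrow>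
      (\<And>x t. x \<in> {\<alpha>..\<beta>} \<Longrightarrow> t \<in> {0..S} \<Longrightarrow> \<bar>u x t\<bar> \<le> M) \<Longrightarrow> x \<in> {\<alpha>..\<beta>} \<Longrightarrow> t \<in> {0<..S} \<Longrightarrow>
      cutoff x ^ 7 * (v x t)\<^sup>2 \<le> K * M\<^sup>2 * (1 / t\<^sup>2 + 1 / t ^ 3)"
proof -
  obtain x0 where x0: "x0 \<in> {\<alpha>..\<beta>}" "\<And>y. y \<in> {\<alpha>..\<beta>} \<Longrightarrow> a x0 \<le> a y"
    using continuous_attains_inf[OF _ _ a_cont] ab by auto
  obtain x1 where x1: "x1 \<in> {\<alpha>..\<beta>}" "\<And>y. y \<in> {\<alpha>..\<beta>} \<Longrightarrow> a y \<le> a x1"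
    using continuous_attains_sup[OF _ _ a_cont] ab by auto
  define m \<Lambda> where "m = a x0" and "\<Lambda> = a x1"
  have m: "m > 0" "\<And>y. y \<in> {\<alpha>..\<beta>} \<Longrightarrow> m \<le> a y" using x0 a_pos by (auto simp: m_def)
  have L: "\<Lambda> > 0" "\<And>y. y \<in> {\<alpha>..\<beta>} \<Longrightarrow> a y \<le> \<Lambda>" using x1 a_pos by (auto simp: \<Lambda>_def)
  define c where "c = (1 / (\<beta> - \<alpha>))\<^sup>2"
  have cut: "(cutoff' x)\<^sup>2 \<le> c" if "x \<in> {\<alpha>..\<beta>}" for x
    using cutoff'_bound[OF that] ab unfolding c_def by (metis abs_ge_zero power2_abs power_mono)
  have c0: "c \<ge> 0" by (simp add: c_def)
  define A2 A1 A0 where "A2 = 3 + 64 * (S * \<Lambda> * c)" and "A1 = A2 * (2 + 36 * (S * \<Lambda> * c))" and "A0 = A1 * (1 + 16 * (S * \<Lambda> * c))"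
  have Z: "S * \<Lambda> * c \<ge> 0" using S L c0 by simp
  have A2: "A2 \<ge> 1" using Z by (simp add: A2_def)
  have A1: "A1 \<ge> 0" using Z A2 by (simp add: A1_def)
  have A0: "A0 \<ge> 0" using Z A1 by (simp add: A0_def)
  define D where "D = A0 * (\<beta> - \<alpha>) / m + 4 * A0 * c * (\<beta> - \<alpha>) * S"
  define C1 where "C1 = (7 / (\<beta> - \<alpha>) + 1) * \<Lambda> + 1"
  have C1: "C1 \<ge> 0" using ab L by (simp add: C1_def)
  have D: "D \<ge> 0" using A0 c0 ab S m by (simp add: D_def)
  show ?thesis
  proof
    show "C1 * D \<ge> 0" using C1 D by simp
    fix u ux v vx w wx :: "real \<Rightarrow> real \<Rightarrow> real" and M x t
    assume sm: "smooth_heat a {\<alpha>..\<beta>} S u ux v vx w wx"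
      and M: "\<And>x t. x \<in> {\<alpha>..\<beta>} \<Longrightarrow> t \<in> {0..S} \<Longrightarrow> \<bar>u x t\<bar> \<le> M"
      and x: "x \<in> {\<alpha>..\<beta>}" and t: "t \<in> {0<..S}"
    note sD = smooth_heatD[OF sm]
    have uM: "(u x t)\<^sup>2 \<le> M\<^sup>2" if "x \<in> {\<alpha>..\<beta>}" "t \<in> {0..S}" for x t
      using M[OF that] by (metis abs_ge_zero power2_abs power_mono)
    \<comment> \<open>\<open>F\<close> is the energy density and \<open>Ft\<close> its time
      derivative; \<open>Kf\<close> is the flux and \<open>Kx\<close> its space derivative.
      \<open>energy_inequality\<close> bounds \<open>Ft - Kx\<close> by a multiple of
      \<open>u\<^sup>2\<close>.\<close>
    define F where "F = (\<lambda>t x. A0 * cutoff x ^ 2 * (u x t)\<^sup>2 / a x + A1 * t * cutoff x ^ 4 * (ux x t)\<^sup>2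
      + A2 * t ^ 2 * cutoff x ^ 6 * (v x t)\<^sup>2 / a x + t ^ 3 * cutoff x ^ 8 * (vx x t)\<^sup>2)"
    define Ft where "Ft = (\<lambda>t x. 2 * A0 * cutoff x ^ 2 * u x t * v x t / a x
      + A1 * cutoff x ^ 4 * (ux x t)\<^sup>2 + 2 * A1 * t * cutoff x ^ 4 * ux x t * vx x t
      + 2 * A2 * t * cutoff x ^ 6 * (v x t)\<^sup>2 / a x + 2 * A2 * t ^ 2 * cutoff x ^ 6 * v x t * w x t / a x
      + 3 * t ^ 2 * cutoff x ^ 8 * (vx x t)\<^sup>2 + 2 * t ^ 3 * cutoff x ^ 8 * vx x t * wx x t)"
    define Kf where "Kf = (\<lambda>t x. 2 * A0 * cutoff x ^ 2 * u x t * ux x t + 2 * A1 * t * cutoff x ^ 4 * ux x t * v x t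
      + 2 * A2 * t ^ 2 * cutoff x ^ 6 * v x t * vx x t + 2 * t ^ 3 * cutoff x ^ 8 * vx x t * w x t)"
    define Kx where "Kx = (\<lambda>t x. 2 * A0 * (2 * cutoff x * cutoff' x * u x t * ux x t + cutoff x ^ 2 * (ux x t)\<^sup>2 + cutoff x ^ 2 * u x t * v x t / a x)
      + 2 * A1 * t * (4 * cutoff x ^ 3 * cutoff' x * ux x t * v x t + cutoff x ^ 4 * (v x t)\<^sup>2 / a x + cutoff x ^ 4 * ux x t * vx x t)
      + 2 * A2 * t ^ 2 * (6 * cutoff x ^ 5 * cutoff' x * v x t * vx x t + cutoff x ^ 6 * (vx x t)\<^sup>2 + cutoff x ^ 6 * v x t * w x t / a x)
      + 2 * t ^ 3 * (8 * cutoff x ^ 7 * cutoff' x * vx x t * w x t + cutoff x ^ 8 * (w x t)\<^sup>2 / a x + cutoff x ^ 8 * vx x t * wx x t))"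
    have pt: "Ft s y \<le> Kx s y + 4 * A0 * c * M\<^sup>2" if y: "y \<in> {\<alpha>..\<beta>}" and s: "s \<in> {0..S}" for y s
    proof -
      have "a y * (1 / a y) = 1" using a_pos[OF y] by simp
      from energy_inequality[OF cutoff_bounds[OF y] cut[OF y] _ _ a_pos[OF y] L(2)[OF y] this A2_def A1_def A0_def, of s "u y s" "ux y s" "v y s" "vx y s" "w y s"]
      have "Ft s y - Kx s y \<le> 4 * A0 * c * (u y s)\<^sup>2"
        using s unfolding Ft_def Kx_def by (simp add: algebra_simps)
      also have "\<dots> \<le> 4 * A0 * c * M\<^sup>2" using A0 c0 uM[OF y s] by (intro mult_left_mono) auto
      finally show ?thesis by simp
    qed
    have Fd: "((\<lambda>s. F s y) has_real_derivative Ft s y) (at s within {0..S})" if y: "y \<in> {\<alpha>..\<beta>}" and s: "s \<in> {0..S}" for y s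
    proof -
      note d = heat_solutionD(3)[OF sD(1) y s] heat_solutionD(3)[OF sD(2) y s] sD(3)[OF y s] sD(4)[OF y s]
      show ?thesis unfolding F_def Ft_def divide_inverse
        by (rule derivative_eq_intros d refl | simp)+ (simp add: algebra_simps power2_eq_square)
    qed
    have Kd: "(Kf s has_real_derivative Kx s y) (at y within {\<alpha>..\<beta>})" if y: "y \<in> {\<alpha>..\<beta>}" and s: "s \<in> {0..S}" for y s
    proof -
      note d = heat_solutionD(1,2)[OF sD(1) y s] heat_solutionD(1,2)[OF sD(2) y s] sD(5)[OF y s]
      show ?thesis unfolding Kf_def Kx_def
        by (rule derivative_eq_intros d refl | simp)+ (simp add: algebra_simps power2_eq_square)
    qed
    have cB: "continuous_on ({0..S} \<times> {\<alpha>..\<beta>}) (\<lambda>z. f (snd z) (fst z))"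
      if "continuous_on ({\<alpha>..\<beta>} \<times> {0..S}) (\<lambda>(x, t). f x t)" for f :: "real \<Rightarrow> real \<Rightarrow> real"
    proof -
      have "continuous_on ({0..S} \<times> {\<alpha>..\<beta>}) (\<lambda>z. (snd z, fst z))" by (intro continuous_intros)
      from continuous_on_compose2[OF that this] show ?thesis by (auto simp: image_subset_iff)
    qed
    have ca: "continuous_on ({0..S} \<times> {\<alpha>..\<beta>}) (\<lambda>z. a (snd z))" "continuous_on ({0..S} \<times> {\<alpha>..\<beta>}) (\<lambda>z. cutoff (snd z))"
      by (rule continuous_on_compose2[OF a_cont continuous_on_snd[OF continuous_on_id]]
            continuous_on_compose2[OF DERIV_continuous_on[OF cutoff_deriv] continuous_on_snd[OF continuous_on_id]]; auto)+
    have an: "a (snd z) \<noteq> 0" if "z \<in> {0..S} \<times> {\<alpha>..\<beta>}" for z :: "real \<times> real" using a_pos[of "snd z"] that by (auto simp: mem_Times_iff)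
    note cc = cB[OF sD(6)] cB[OF sD(7)] cB[OF sD(8)] cB[OF sD(9)] cB[OF sD(10)] cB[OF sD(11)] ca
    have cF: "continuous_on ({0..S} \<times> {\<alpha>..\<beta>}) (\<lambda>(t, x). F t x)"
      unfolding F_def case_prod_beta' by (intro continuous_intros cc) (use an in auto)
    have cFt: "continuous_on ({0..S} \<times> {\<alpha>..\<beta>}) (\<lambda>(t, x). Ft t x)"
      unfolding Ft_def case_prod_beta' by (intro continuous_intros cc) (use an in auto)
    have cs: "continuous_on {\<alpha>..\<beta>} (G s)" if "continuous_on ({0..S} \<times> {\<alpha>..\<beta>}) (\<lambda>(t, x). G t x)" "s \<in> {0..S}" for G :: "real \<Rightarrow> real \<Rightarrow> real" and s
    proof -
      have "continuous_on {\<alpha>..\<beta>} (\<lambda>x. (s, x))" by (intro continuous_intros)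
      from continuous_on_compose2[OF that(1) this] show ?thesis using that(2) by (auto simp: image_subset_iff)
    qed
    have iF: "F s integrable_on {\<alpha>..\<beta>}" "Ft s integrable_on {\<alpha>..\<beta>}" if "s \<in> {0..S}" for s
      using cs[OF cF that] cs[OF cFt that] by (auto intro: integrable_continuous_real)
    define \<Phi> where "\<Phi> = (\<lambda>s. integral {\<alpha>..\<beta>} (F s))"
    have \<Phi>d: "(\<Phi> has_real_derivative integral {\<alpha>..\<beta>} (Ft s)) (at s within {0..S})" if s: "s \<in> {0..S}" for s
      using leibniz_rule_field_derivative[of "{0..S}" \<alpha> \<beta> F Ft s] Fd iF cFt s by (simp add: \<Phi>_def)
    have \<Phi>': "integral {\<alpha>..\<beta>} (Ft s) \<le> 4 * A0 * c * M\<^sup>2 * (\<beta> - \<alpha>)" if s: "s \<in> {0..S}" for s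
    proof -
      \<comment> \<open>Every term of the flux contains a power of \<open>cutoff\<close>, so it
        vanishes at both ends and \<open>Kx\<close> integrates to zero.\<close>
      have "(Kx s has_integral Kf s \<beta> - Kf s \<alpha>) {\<alpha>..\<beta>}"
        by (rule fundamental_theorem_of_calculus)
          (use ab Kd[OF _ s] in \<open>auto simp: has_real_derivative_iff_has_vector_derivative[symmetric]\<close>)
      then have "(Kx s has_integral 0) {\<alpha>..\<beta>}" by (simp add: Kf_def)
      from has_integral_add[OF this has_integral_const_real[of "4 * A0 * c * M\<^sup>2" \<alpha> \<beta>]]
      have "((\<lambda>x. Kx s x + 4 * A0 * c * M\<^sup>2) has_integral 4 * A0 * c * M\<^sup>2 * (\<beta> - \<alpha>)) {\<alpha>..\<beta>}"
        using ab by (simp add: mult.commute)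
      then show ?thesis using has_integral_le[OF integrable_integral[OF iF(2)[OF s]]] pt[OF _ s] by blast
    qed
    have t0: "t > 0" "t \<in> {0..S}" using t by auto
    \<comment> \<open>At time 0 the weights leave only the \<open>A0\<close> term, which contains no
      derivative of \<open>u\<close>.\<close>
    have \<Phi>0: "\<Phi> 0 \<le> A0 * M\<^sup>2 / m * (\<beta> - \<alpha>)"
    proof -
      have "F 0 y \<le> A0 * M\<^sup>2 / m" if y: "y \<in> {\<alpha>..\<beta>}" for y
      proof -
        have "cutoff y ^ 2 * (u y 0)\<^sup>2 \<le> 1 * M\<^sup>2"
          using cutoff_bounds[OF y] uM[OF y, of 0] S by (intro mult_mono) (auto intro: power_le_one)
        then have "A0 * (cutoff y ^ 2 * (u y 0)\<^sup>2) / a y \<le> A0 * M\<^sup>2 / m"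
          using A0 m(1) m(2)[OF y] by (intro frac_le mult_left_mono) auto
        then show ?thesis by (simp add: F_def mult.assoc)
      qed
      then have "\<Phi> 0 \<le> integral {\<alpha>..\<beta>} (\<lambda>x. A0 * M\<^sup>2 / m)"
        unfolding \<Phi>_def using iF(1)[of 0] S by (intro integral_le) auto
      then show ?thesis using ab by (simp add: mult_ac)
    qed
    have "\<exists>z\<in>{0<..<t}. \<Phi> t - \<Phi> 0 = (t - 0) * integral {\<alpha>..\<beta>} (Ft z)"
    proof -
      have "\<exists>z\<in>{0<..<t}. \<Phi> t - \<Phi> 0 = (*) (integral {\<alpha>..\<beta>} (Ft z)) (t - 0)"
      proof (rule mvt_simple[OF t0(1)])
        fix s assume "0 \<le> s" "s \<le> t"
        then show "(\<Phi> has_derivative (*) (integral {\<alpha>..\<beta>} (Ft s))) (at s within {0..t})"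
          using DERIV_subset[OF \<Phi>d[of s], of "{0..t}"] t0 by (auto simp: has_field_derivative_def)
      qed
      then show ?thesis by (simp add: mult.commute)
    qed
    then obtain z where z: "z \<in> {0<..<t}" "\<Phi> t - \<Phi> 0 = t * integral {\<alpha>..\<beta>} (Ft z)" by auto
    have "t * integral {\<alpha>..\<beta>} (Ft z) \<le> t * (4 * A0 * c * M\<^sup>2 * (\<beta> - \<alpha>))"
      using \<Phi>'[of z] z t by (intro mult_left_mono) auto
    also have "\<dots> \<le> S * (4 * A0 * c * M\<^sup>2 * (\<beta> - \<alpha>))" using t A0 c0 ab by (intro mult_right_mono) auto
    finally have \<Phi>t: "\<Phi> t \<le> D * M\<^sup>2" using \<Phi>0 z(2) by (simp add: D_def algebra_simps)

    have F0: "F t y \<ge> 0" if y: "y \<in> {\<alpha>..\<beta>}" for y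
      using A0 A1 A2 t0 cutoff_bounds[OF y] a_pos[OF y] by (auto simp: F_def intro!: add_nonneg_nonneg)
    \<comment> \<open>\<open>T * t^2\<close> and \<open>T * t^3\<close> are both at least 1, so
      multiplication by \<open>T\<close> undoes the weights.\<close>
    define T where "T = 1 / t\<^sup>2 + 1 / t ^ 3"
    have T0: "T \<ge> 0" using t0 by (simp add: T_def)
    have HF: "cutoff y ^ 6 * (v y t)\<^sup>2 / a y + cutoff y ^ 8 * (vx y t)\<^sup>2 \<le> T * F t y" if y: "y \<in> {\<alpha>..\<beta>}" for y
    proof -
      define H1 H2 where "H1 = cutoff y ^ 6 * (v y t)\<^sup>2 / a y" and "H2 = cutoff y ^ 8 * (vx y t)\<^sup>2"
      have H: "H1 \<ge> 0" "H2 \<ge> 0" using cutoff_bounds[OF y] a_pos[OF y] by (auto simp: H1_def H2_def)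
      have "1 * (t^2 * H1) \<le> A2 * (t^2 * H1)" using A2 H by (intro mult_right_mono) auto
      moreover have "0 \<le> A0 * cutoff y ^ 2 * (u y t)\<^sup>2 / a y" "0 \<le> A1 * t * cutoff y ^ 4 * (ux y t)\<^sup>2"
        using A0 A1 t0 cutoff_bounds[OF y] a_pos[OF y] by auto
      moreover have "A2 * t ^ 2 * cutoff y ^ 6 * (v y t)\<^sup>2 / a y = A2 * (t^2 * H1)" "t ^ 3 * cutoff y ^ 8 * (vx y t)\<^sup>2 = t^3 * H2"
        by (simp_all add: H1_def H2_def mult_ac)
      ultimately have "t^2 * H1 + t^3 * H2 \<le> F t y" unfolding F_def by linarith
      then have "T * (t^2 * H1 + t^3 * H2) \<le> T * F t y" using T0 by (rule mult_left_mono)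
      moreover have "H1 + H2 \<le> T * (t^2 * H1 + t^3 * H2)"
      proof -
        have "T * (t^2 * H1 + t^3 * H2) = H1 + H2 + (H1 / t + t * H2)"
          using t0 by (simp add: T_def field_simps power2_eq_square power3_eq_cube)
        then show ?thesis using H t0 by simp
      qed
      ultimately show ?thesis by (simp add: H1_def H2_def)
    qed
    \<comment> \<open>The exponent 7 is the mean of 6 and 8: in the derivative of \<open>G\<close>,
      the product \<open>cutoff^7 * v * vx\<close> splits into \<open>cutoff^6 * v\<^sup>2\<close>
      and \<open>cutoff^8 * vx\<^sup>2\<close>.\<close>
    define G where "G = (\<lambda>y. cutoff y ^ 7 * (v y t)\<^sup>2)"
    define Gx where "Gx = (\<lambda>y. 7 * cutoff y ^ 6 * cutoff' y * (v y t)\<^sup>2 + 2 * cutoff y ^ 7 * v y t * vx y t)"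
    have Gd: "(G has_real_derivative Gx y) (at y within {\<alpha>..\<beta>})" if y: "y \<in> {\<alpha>..\<beta>}" for y
    proof -
      note d = heat_solutionD(1)[OF sD(2) y t0(2)]
      show ?thesis unfolding G_def Gx_def
        by (rule derivative_eq_intros d refl | simp)+
    qed
    have Gle: "Gx y \<le> C1 * (T * F t y)" if y: "y \<in> {\<alpha>..\<beta>}" for y
    proof -
      define H1 H2 where "H1 = cutoff y ^ 6 * (v y t)\<^sup>2" and "H2 = cutoff y ^ 8 * (vx y t)\<^sup>2"
      have H: "H1 \<ge> 0" "H2 \<ge> 0" using cutoff_bounds[OF y] by (auto simp: H1_def H2_def)
      have "0 \<le> cutoff y ^ 6 * (v y t - cutoff y * vx y t)\<^sup>2" using cutoff_bounds[OF y] by simp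
      also have "\<dots> = H1 - 2 * cutoff y ^ 7 * v y t * vx y t + H2" unfolding H1_def H2_def by algebra
      finally have 1: "2 * cutoff y ^ 7 * v y t * vx y t \<le> H1 + H2" by simp
      have "7 * cutoff' y * H1 \<le> 7 * (1 / (\<beta> - \<alpha>)) * H1"
        using cutoff'_bound[OF y] H by (intro mult_right_mono) auto
      then have 2: "7 * cutoff y ^ 6 * cutoff' y * (v y t)\<^sup>2 \<le> 7 / (\<beta> - \<alpha>) * H1" by (simp add: H1_def mult_ac)
      have ap: "a y > 0" using a_pos[OF y] .
      have 3: "H1 \<le> \<Lambda> * (H1 / a y)"
      proof -
        have "a y * (H1 / a y) \<le> \<Lambda> * (H1 / a y)" using L(2)[OF y] H ap by (intro mult_right_mono) auto
        then show ?thesis using ap by simp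
      qed
      have "Gx y \<le> (7 / (\<beta> - \<alpha>) + 1) * H1 + H2" using 1 2 by (simp add: Gx_def algebra_simps)
      also have "\<dots> \<le> (7 / (\<beta> - \<alpha>) + 1) * (\<Lambda> * (H1 / a y)) + H2"
        using mult_left_mono[OF 3, of "7 / (\<beta> - \<alpha>) + 1"] ab by simp
      also have "\<dots> \<le> C1 * (H1 / a y + H2)"
      proof -
        have "0 \<le> H1 / a y" "0 \<le> (7 / (\<beta> - \<alpha>) + 1) * \<Lambda> * H2" using H ap ab L by auto
        moreover have "C1 * (h + H2) = (7 / (\<beta> - \<alpha>) + 1) * (\<Lambda> * h) + H2 + (h + (7 / (\<beta> - \<alpha>) + 1) * \<Lambda> * H2)" for h
          unfolding C1_def by (simp only: distrib_right distrib_left mult_1 mult_1_right mult.assoc add.assoc add.commute add.left_commute)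
        ultimately show ?thesis by simp
      qed
      also have "\<dots> \<le> C1 * (T * F t y)" using HF[OF y] C1 by (intro mult_left_mono) (auto simp: H1_def H2_def)
      finally show ?thesis .
    qed
    have "(Gx has_integral G x - G \<alpha>) {\<alpha>..x}"
    proof (rule fundamental_theorem_of_calculus)
      show "\<alpha> \<le> x" using x by simp
      show "(G has_vector_derivative Gx y) (at y within {\<alpha>..x})" if "y \<in> {\<alpha>..x}" for y
        using DERIV_subset[OF Gd[of y], of "{\<alpha>..x}"] that x
        by (auto simp: has_real_derivative_iff_has_vector_derivative[symmetric])
    qed
    then have Gi: "(Gx has_integral G x) {\<alpha>..x}" by (simp add: G_def)
    have iFx: "(\<lambda>y. C1 * (T * F t y)) integrable_on {\<alpha>..\<beta>}"
      by (intro integrable_continuous_real continuous_intros cs[OF cF t0(2)])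
    then have iFx': "(\<lambda>y. C1 * (T * F t y)) integrable_on {\<alpha>..x}" using x by (auto intro: integrable_on_subinterval)
    have "G x \<le> integral {\<alpha>..x} (\<lambda>y. C1 * (T * F t y))"
      by (rule has_integral_le[OF Gi integrable_integral[OF iFx']]) (use Gle x in auto)
    also have "\<dots> \<le> integral {\<alpha>..\<beta>} (\<lambda>y. C1 * (T * F t y))"
      by (rule integral_subset_le[OF _ iFx' iFx]) (use x F0 C1 T0 in auto)
    also have "\<dots> = C1 * (T * \<Phi> t)" by (simp add: \<Phi>_def)
    also have "\<dots> \<le> C1 * (T * (D * M\<^sup>2))" using C1 T0 \<Phi>t by (intro mult_left_mono) auto
    finally show "cutoff x ^ 7 * (v x t)\<^sup>2 \<le> C1 * D * M\<^sup>2 * (1 / t\<^sup>2 + 1 / t ^ 3)"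
      by (simp add: G_def T_def mult_ac)
  qed
qed

end

subsection \<open>Approximation on an exhausting sequence of intervals\<close>

lemma continuous_on_pos_Times:
  fixes f :: "real \<times> real \<Rightarrow> real"
  assumes "\<And>\<alpha> \<beta>. 0 < \<alpha> \<Longrightarrow> \<alpha> < \<beta> \<Longrightarrow> continuous_on ({\<alpha>..\<beta>} \<times> J) f"
  shows "continuous_on ({0<..} \<times> J) f"
  unfolding continuous_on_eq_continuous_within
proof
  fix z :: "real \<times> real" assume z: "z \<in> {0<..} \<times> J"
  define \<alpha> \<beta> where "\<alpha> = fst z / 2" and "\<beta> = 2 * fst z"
  have ab: "0 < \<alpha>" "\<alpha> < fst z" "fst z < \<beta>" "\<alpha> < \<beta>" using z by (auto simp: \<alpha>_def \<beta>_def)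
  have "continuous (at z within {\<alpha>..\<beta>} \<times> J) f"
    using assms[OF ab(1,4)] z ab unfolding continuous_on_eq_continuous_within
    by (elim ballE[where x=z]) (auto simp: mem_Times_iff)
  moreover have "at z within {\<alpha>..\<beta>} \<times> J = at z within {0<..} \<times> J"
  proof (rule at_within_nhd[of _ "{\<alpha><..<\<beta>} \<times> UNIV"])
    show "z \<in> {\<alpha><..<\<beta>} \<times> UNIV" using ab by (simp add: mem_Times_iff)
    show "open ({\<alpha><..<\<beta>} \<times> (UNIV :: real set))" by (intro open_Times) auto
    show "{\<alpha>..\<beta>} \<times> J \<inter> {\<alpha><..<\<beta>} \<times> UNIV - {z} = {0<..} \<times> J \<inter> {\<alpha><..<\<beta>} \<times> UNIV - {z}"
      using ab by auto
  qed
  ultimately show "continuous (at z within {0<..} \<times> J) f" by simp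
qed

lemma continuous_on_Times_initial:
  fixes f :: "real \<times> real \<Rightarrow> real"
  assumes "\<And>s. 0 < s \<Longrightarrow> continuous_on (X \<times> {s..T}) f"
  shows "continuous_on (X \<times> {0<..T}) f"
  unfolding continuous_on_eq_continuous_within
proof
  fix z :: "real \<times> real" assume z: "z \<in> X \<times> {0<..T}"
  define s where "s = snd z / 2"
  have s: "0 < s" "s < snd z" using z by (auto simp: s_def)
  have "continuous (at z within X \<times> {s..T}) f"
    using assms[OF s(1)] z s unfolding continuous_on_eq_continuous_within
    by (elim ballE[where x=z]) (auto simp: mem_Times_iff)
  moreover have "at z within X \<times> {s..T} = at z within X \<times> {0<..T}"
  proof (rule at_within_nhd[of _ "UNIV \<times> {s<..}"])
    show "z \<in> UNIV \<times> {s<..}" using s by (simp add: mem_Times_iff)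
    show "open ((UNIV :: real set) \<times> {s<..})" by (intro open_Times) auto
    show "X \<times> {s..T} \<inter> UNIV \<times> {s<..} - {z} = X \<times> {0<..T} \<inter> UNIV \<times> {s<..} - {z}"
      using s by auto
  qed
  ultimately show "continuous (at z within X \<times> {0<..T}) f" by simp
qed

text \<open>The local first derivatives \<open>g'\<close> may depend on the interval; by uniqueness
  of derivatives each agrees with \<open>deriv\<close>, which serves as a global first
  derivative.\<close>

lemma heat_solution_of_local:
  assumes loc: "\<And>x t. x > 0 \<Longrightarrow> t \<in> J \<Longrightarrow> \<exists>\<alpha> \<beta> g'. \<alpha> < x \<and> x < \<beta> \<and> 
      (\<forall>y\<in>{\<alpha>..\<beta>}. ((\<lambda>x. U x t) has_real_derivative g' y) (at y within {\<alpha>..\<beta>}) \<and> (g' has_real_derivative V y t / a y) (at y within {\<alpha>..\<beta>}))"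
    and time: "\<And>x t. x > 0 \<Longrightarrow> t \<in> J \<Longrightarrow> ((\<lambda>s. U x s) has_real_derivative V x t) (at t within J)"
  shows "heat_solution a {0<..} J U (\<lambda>x t. deriv (\<lambda>y. U y t) x) V"
proof (rule heat_solutionI)
  fix x t :: real assume x: "x \<in> {0<..}" and t: "t \<in> J"
  obtain \<alpha> \<beta> g' where g: "\<alpha> < x" "x < \<beta>"
    "\<And>y. y \<in> {\<alpha>..\<beta>} \<Longrightarrow> ((\<lambda>x. U x t) has_real_derivative g' y) (at y within {\<alpha>..\<beta>})"
    "\<And>y. y \<in> {\<alpha>..\<beta>} \<Longrightarrow> (g' has_real_derivative V y t / a y) (at y within {\<alpha>..\<beta>})"
    using loc[OF _ t, of x] x unfolding greaterThan_iff by blast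
  have at: "at y within {\<alpha>..\<beta>} = at y" if "\<alpha> < y" "y < \<beta>" for y
    by (rule at_within_interior) (use that in auto)
  have d1: "((\<lambda>x. U x t) has_real_derivative g' y) (at y)" if "\<alpha> < y" "y < \<beta>" for y
    using g(3)[of y] at[OF that] that by auto
  have dg: "deriv (\<lambda>y. U y t) y = g' y" if "\<alpha> < y" "y < \<beta>" for y
    by (rule DERIV_imp_deriv[OF d1[OF that]])
  have "((\<lambda>x. U x t) has_real_derivative deriv (\<lambda>y. U y t) x) (at x)" using d1[OF g(1,2)] dg[OF g(1,2)] by simp
  then show "((\<lambda>x. U x t) has_real_derivative deriv (\<lambda>y. U y t) x) (at x within {0<..})"
    by (rule has_field_derivative_at_within)
  have "(g' has_real_derivative V x t / a x) (at x)" using g(4)[of x] at[OF g(1,2)] g(1,2) by auto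
  then have "((\<lambda>x. deriv (\<lambda>y. U y t) x) has_real_derivative V x t / a x) (at x)"
  proof (rule has_field_derivative_transform_within_open)
    show "open {\<alpha><..<\<beta>}" by simp
    show "x \<in> {\<alpha><..<\<beta>}" using g by simp
    show "g' y = deriv (\<lambda>y. U y t) y" if "y \<in> {\<alpha><..<\<beta>}" for y using dg[of y] that by simp
  qed
  then show "((\<lambda>x. deriv (\<lambda>y. U y t) x) has_real_derivative V x t / a x) (at x within {0<..})"
    by (rule has_field_derivative_at_within)
  show "((\<lambda>s. U x s) has_real_derivative V x t) (at t within J)" using time x t by auto
qed

lemma continuous_on_divide_coefficient:
  fixes a :: "real \<Rightarrow> real" and V :: "real \<Rightarrow> real \<Rightarrow> real"
  assumes a: "continuous_on X a" "\<And>x. x \<in> X \<Longrightarrow> a x > 0"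
    and V: "continuous_on (X \<times> J) (\<lambda>(x, t). V x t)"
  shows "continuous_on (X \<times> J) (\<lambda>(x, t). V x t / a x)"
proof -
  have "continuous_on (X \<times> J) (\<lambda>z. a (fst z))"
    by (rule continuous_on_compose2[OF a(1) continuous_on_fst[OF continuous_on_id]]) auto
  moreover have "a (fst z) \<noteq> 0" if "z \<in> X \<times> J" for z :: "real \<times> real"
    using a(2)[of "fst z"] that by (auto simp: mem_Times_iff)
  ultimately have "continuous_on (X \<times> J) (\<lambda>z. (case z of (x, t) \<Rightarrow> V x t) / a (fst z))"
    by (intro continuous_on_divide V) auto
  then show ?thesis by (simp add: case_prod_beta')
qed

lemma heat_solution_continuous_space_derivative:
  assumes a: "continuous_on {0<..} a" "\<And>x. x > 0 \<Longrightarrow> a x > 0"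
    and H: "heat_solution a {0<..} J U Ux V"
    and U: "continuous_on ({0<..} \<times> J) (\<lambda>(x, t). U x t)" and V: "continuous_on ({0<..} \<times> J) (\<lambda>(x, t). V x t)"
  shows "continuous_on ({0<..} \<times> J) (\<lambda>(x, t). Ux x t)"
proof (rule continuous_on_partial_derivative[where u=U and uxx="\<lambda>x t. V x t / a x"])
  fix x t :: real assume xt: "x > 0" "t \<in> J"
  have at: "at x within {0<..} = at x" by (rule at_within_open) (use xt in auto)
  show "((\<lambda>y. U y t) has_real_derivative Ux x t) (at x)" "((\<lambda>y. Ux y t) has_real_derivative V x t / a x) (at x)"
    using heat_solutionD(1,2)[OF H, of x t] xt by (simp_all add: at)
next
  show "continuous_on ({0<..} \<times> J) (\<lambda>(x, t). V x t / a x)"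
    by (rule continuous_on_divide_coefficient[OF a(1) _ V]) (use a(2) in auto)
qed (rule U)

text \<open>\<open>bl\<close> and \<open>bu\<close> are stationary sub- and supersolutions, and
  \<open>gap\<close> makes the uncertainty at the far end negligible against \<open>\<psi>\<close>.
  Barriers and \<open>\<psi>\<close> are asked for on \<open>x > 0\<close> only. There are three
  instances: one with \<open>\<psi> = 1 + x + J x\<close> and \<open>\<kappa> = 1\<close>, two with
  \<open>\<psi> = x\<close> and \<open>\<kappa> = 0\<close>.\<close>

locale half_line_problem =
  fixes a g :: "real \<Rightarrow> real" and T \<kappa> :: real
    and bl bl' bl'' bu bu' bu'' \<psi> \<psi>' \<psi>'' :: "real \<Rightarrow> real"
  assumes T: "T > 0" and \<kappa>: "\<kappa> \<ge> 0"
    and a_cont: "continuous_on {0<..} a" and a_pos: "\<And>x. x > 0 \<Longrightarrow> a x > 0"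
    and g_cont: "continuous_on {0..} g" and g_growth: "\<exists>C. \<forall>x\<ge>0. \<bar>g x\<bar> \<le> C * (1 + x)"
    and bl: "\<And>x. x > 0 \<Longrightarrow> (bl has_real_derivative bl' x) (at x)" "\<And>x. x > 0 \<Longrightarrow> (bl' has_real_derivative bl'' x) (at x)"
      "\<And>x. x > 0 \<Longrightarrow> bl'' x \<ge> 0"
    and bu: "\<And>x. x > 0 \<Longrightarrow> (bu has_real_derivative bu' x) (at x)" "\<And>x. x > 0 \<Longrightarrow> (bu' has_real_derivative bu'' x) (at x)"
      "\<And>x. x > 0 \<Longrightarrow> bu'' x \<le> 0"
    and barrier: "\<And>x. x > 0 \<Longrightarrow> bl x \<le> g x" "\<And>x. x > 0 \<Longrightarrow> g x \<le> bu x"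
    and \<psi>: "\<And>x. x > 0 \<Longrightarrow> (\<psi> has_real_derivative \<psi>' x) (at x)" "\<And>x. x > 0 \<Longrightarrow> (\<psi>' has_real_derivative \<psi>'' x) (at x)"
      "\<And>x. x > 0 \<Longrightarrow> a x * \<psi>'' x \<le> \<kappa> * \<psi> x" and \<psi>_pos: "\<And>x. x > 0 \<Longrightarrow> \<psi> x > 0"
    and gap: "((\<lambda>x. (bu x - bl x) / \<psi> x) \<longlongrightarrow> 0) at_top"
begin

text \<open>The shift by 2 gives a proper interval around 1 already for \<open>n = 0\<close>.
  \<open>lo n\<close> doubles as the tolerance for the initial values.\<close>

definition lo :: "nat \<Rightarrow> real" where "lo n = 1 / (real n + 2)"
definition hi :: "nat \<Rightarrow> real" where "hi n = real n + 2"

lemma lo_pos: "lo n > 0" and lo_hi: "lo n < hi n" and hi_pos: "hi n > 0"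
proof -
  show "lo n > 0" "hi n > 0" by (auto simp: lo_def hi_def)
  have "lo n \<le> 1" by (simp add: lo_def)
  then show "lo n < hi n" by (simp add: hi_def)
qed

lemma lo_antimono: "n \<le> m \<Longrightarrow> lo m \<le> lo n"
  by (simp add: lo_def frac_le)

lemma hi_mono: "n \<le> m \<Longrightarrow> hi n \<le> hi m"
  by (simp add: hi_def)

lemma lo_lim: "lo \<longlonglongrightarrow> 0"
  unfolding lo_def by real_asymp

lemma hi_lim: "filterlim hi at_top sequentially"
  unfolding hi_def by real_asymp

lemma op: "interval_operator \<alpha> \<beta> a" if "0 < \<alpha>" "\<alpha> < \<beta>"
  using that a_pos by unfold_locales (auto intro: continuous_on_subset[OF a_cont])

definition approximant :: "nat \<Rightarrow> (real \<Rightarrow> real \<Rightarrow> real) \<Rightarrow> (real \<Rightarrow> real \<Rightarrow> real) \<Rightarrow> (real \<Rightarrow> real \<Rightarrow> real) \<Rightarrow>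
   (real \<Rightarrow> real \<Rightarrow> real) \<Rightarrow> (real \<Rightarrow> real \<Rightarrow> real) \<Rightarrow> (real \<Rightarrow> real \<Rightarrow> real) \<Rightarrow> bool" where
  "approximant n u ux v vx w wx \<longleftrightarrow> smooth_heat a {lo n..hi n} T u ux v vx w wx \<and>
     (\<forall>t\<in>{0..T}. u (lo n) t = g (lo n) \<and> u (hi n) t = g (hi n)) \<and> (\<forall>x\<in>{lo n..hi n}. \<bar>u x 0 - g x\<bar> \<le> lo n)"

lemma approximant_exists: "\<exists>u ux v vx w wx. approximant n u ux v vx w wx"
proof -
  interpret interval_operator "lo n" "hi n" a by (rule op[OF lo_pos lo_hi])
  have "continuous_on {lo n..hi n} g" using lo_pos[of n] by (intro continuous_on_subset[OF g_cont]) auto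
  from approximate_smooth_heat[OF this lo_pos, of T n] show ?thesis unfolding approximant_def by metis
qed

lemma approximant_upper:
  assumes u: "approximant n u ux v vx w wx"
    and b: "\<And>x. x > 0 \<Longrightarrow> (b has_real_derivative b' x) (at x)" "\<And>x. x > 0 \<Longrightarrow> (b' has_real_derivative b'' x) (at x)"
      "\<And>x. x > 0 \<Longrightarrow> b'' x \<le> 0" and gb: "\<And>x. x > 0 \<Longrightarrow> g x \<le> b x"
    and x: "x \<in> {lo n..hi n}" and t: "t \<in> {0..T}"
  shows "u x t \<le> b x + lo n"
proof -
  have pos: "x > 0" if "lo n \<le> x" for x using lo_pos[of n] that by simp
  have sm: "smooth_heat a {lo n..hi n} T u ux v vx w wx" using u by (simp add: approximant_def)
  show ?thesis
  proof (rule comparison_concave[where b="\<lambda>x. b x + lo n" and b'=b' and b''=b'', OF _ _ smooth_heatD(6)[OF sm] _ _ _ _ _ _ _ x t])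
    show "heat_solution a {lo n<..<hi n} {0<..T} u ux v" by (rule heat_solution_subset[OF smooth_heatD(1)[OF sm]]) auto
    show "((\<lambda>x. b x + lo n) has_real_derivative b' x) (at x)" if "lo n < x" for x
      using DERIV_add[OF b(1)[OF pos] DERIV_const, of x "lo n"] that by simp
    have "continuous_on {lo n..hi n} b"
      using pos b(1) by (intro continuous_at_imp_continuous_on ballI DERIV_isCont) auto
    then show "continuous_on {lo n..hi n} (\<lambda>x. b x + lo n)" by (intro continuous_intros)
    show "u (lo n) t \<le> b (lo n) + lo n" "u (hi n) t \<le> b (hi n) + lo n" if "0 \<le> t" "t \<le> T" for t
      using u gb[OF lo_pos, of n] gb[OF hi_pos, of n] lo_pos[of n] that by (auto simp: approximant_def)
    show "u x 0 \<le> b x + lo n" if "lo n \<le> x" "x \<le> hi n" for x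
    proof -
      have "\<bar>u x 0 - g x\<bar> \<le> lo n" using u that by (simp add: approximant_def)
      then show ?thesis using gb[OF pos[OF that(1)]] by linarith
    qed
  qed (use pos a_pos b in auto)
qed

lemma approximant_lower:
  assumes u: "approximant n u ux v vx w wx"
    and b: "\<And>x. x > 0 \<Longrightarrow> (b has_real_derivative b' x) (at x)" "\<And>x. x > 0 \<Longrightarrow> (b' has_real_derivative b'' x) (at x)"
      "\<And>x. x > 0 \<Longrightarrow> b'' x \<ge> 0" and gb: "\<And>x. x > 0 \<Longrightarrow> b x \<le> g x"
    and x: "x \<in> {lo n..hi n}" and t: "t \<in> {0..T}"
  shows "b x - lo n \<le> u x t"
proof -
  have pos: "x > 0" if "lo n \<le> x" for x using lo_pos[of n] that by simp
  have sm: "smooth_heat a {lo n..hi n} T u ux v vx w wx" using u by (simp add: approximant_def)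
  have "- u x t \<le> - b x + lo n"
  proof (rule comparison_concave[where b="\<lambda>x. - b x + lo n" and b'="\<lambda>x. - b' x" and b''="\<lambda>x. - b'' x" and u="\<lambda>x t. - u x t", OF _ _ _ _ _ _ _ _ _ _ x t])
    show "heat_solution a {lo n<..<hi n} {0<..T} (\<lambda>x t. - u x t) (\<lambda>x t. - ux x t) (\<lambda>x t. - v x t)"
      by (rule heat_solution_subset[OF heat_solution_uminus[OF smooth_heatD(1)[OF sm]]]) auto
    show "continuous_on ({lo n..hi n} \<times> {0..T}) (\<lambda>(x, t). - u x t)"
      using continuous_on_minus[OF smooth_heatD(6)[OF sm]] by (simp add: case_prod_beta')
    show "((\<lambda>x. - b x + lo n) has_real_derivative - b' x) (at x)" if "lo n < x" for x
      using DERIV_add[OF DERIV_minus[OF b(1)[OF pos]] DERIV_const, of x "lo n"] that by simp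
    show "((\<lambda>x. - b' x) has_real_derivative - b'' x) (at x)" if "lo n < x" for x
      using DERIV_minus[OF b(2)[OF pos], of x] that by simp
    have "continuous_on {lo n..hi n} b"
      using pos b(1) by (intro continuous_at_imp_continuous_on ballI DERIV_isCont) auto
    then show "continuous_on {lo n..hi n} (\<lambda>x. - b x + lo n)" by (intro continuous_intros)
    show "- u (lo n) t \<le> - b (lo n) + lo n" "- u (hi n) t \<le> - b (hi n) + lo n" if "0 \<le> t" "t \<le> T" for t
      using u gb[OF lo_pos, of n] gb[OF hi_pos, of n] lo_pos[of n] that by (auto simp: approximant_def)
    show "- u x 0 \<le> - b x + lo n" if "lo n \<le> x" "x \<le> hi n" for x
    proof -
      have "\<bar>u x 0 - g x\<bar> \<le> lo n" using u that by (simp add: approximant_def)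
      then show ?thesis using gb[OF pos[OF that(1)]] by linarith
    qed
  qed (use pos a_pos b in auto)
  then show ?thesis by simp
qed

text \<open>Continuity at \<open>0\<close> controls small \<open>x\<close>, linear growth the rest.
  Affine functions solve the equation however \<open>a\<close> degenerates at \<open>0\<close>, so
  the approximating solutions inherit this bound.\<close>

lemma g_near_0:
  assumes "\<epsilon> > 0"
  obtains M where "M \<ge> 0" "\<And>x. x \<ge> 0 \<Longrightarrow> \<bar>g x - g 0\<bar> \<le> \<epsilon> + M * x"
proof -
  obtain C where C: "\<And>x. x \<ge> 0 \<Longrightarrow> \<bar>g x\<bar> \<le> C * (1 + x)" using g_growth by blast
  have C0: "C \<ge> 0" using C[of 0] by simp
  obtain d where d: "d > 0" "\<And>x. x \<ge> 0 \<Longrightarrow> \<bar>x\<bar> < d \<Longrightarrow> \<bar>g x - g 0\<bar> < \<epsilon>"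
    using g_cont assms unfolding continuous_on_iff by (metis atLeast_iff dist_real_def diff_zero order_refl)
  \<comment> \<open>For \<open>x \<ge> d\<close> the constant \<open>2 * C\<close> is at most
    \<open>2 * C * x / d\<close>; the second summand is the growth rate of \<open>g\<close>.\<close>
  define M where "M = 2 * C / d + C"
  have M: "M \<ge> 0" using C0 d by (simp add: M_def)
  have "\<bar>g x - g 0\<bar> \<le> \<epsilon> + M * x" if x: "x \<ge> 0" for x
  proof (cases "x < d")
    case True
    then have "\<bar>g x - g 0\<bar> < \<epsilon>" using d x by simp
    moreover have "0 \<le> M * x" using M x by simp
    ultimately show ?thesis by simp
  next
    case False
    have "\<bar>g x - g 0\<bar> \<le> C * (1 + x) + C" using C[OF x] C[of 0] by simp
    also have "\<dots> = 2 * C * 1 + C * x" by (simp add: algebra_simps)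
    also have "\<dots> \<le> 2 * C * (x / d) + C * x" using C0 False d by (intro add_right_mono mult_left_mono) auto
    also have "\<dots> = M * x" by (simp add: M_def algebra_simps)
    finally show ?thesis using assms by simp
  qed
  then show ?thesis using that M by blast
qed

text \<open>The bound depends on the interval only through \<open>lo n\<close>. It yields attainment
  of \<open>g 0\<close> at the degenerate end, and the left boundary estimate when two approximants
  are compared.\<close>

lemma approximant_near_0:
  assumes u: "approximant n u ux v vx w wx" and M: "\<And>x. x \<ge> 0 \<Longrightarrow> \<bar>g x - g 0\<bar> \<le> \<epsilon> + M * x"
    and x: "x \<in> {lo n..hi n}" and t: "t \<in> {0..T}"
  shows "\<bar>u x t - g 0\<bar> \<le> \<epsilon> + M * x + lo n"
proof -
  have "u x t \<le> (g 0 + \<epsilon> + M * x) + lo n"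
    by (rule approximant_upper[OF u _ _ _ _ x t, of _ "\<lambda>_. M" "\<lambda>_. 0"])
      (use M in \<open>auto intro!: derivative_eq_intros simp: abs_le_iff algebra_simps less_imp_le\<close>)
  moreover have "(g 0 - \<epsilon> - M * x) - lo n \<le> u x t"
    by (rule approximant_lower[OF u _ _ _ _ x t, of _ "\<lambda>_. - M" "\<lambda>_. 0"])
      (use M in \<open>auto intro!: derivative_eq_intros simp: abs_le_iff algebra_simps less_imp_le\<close>)
  ultimately show ?thesis by (simp add: abs_le_iff)
qed

lemma approximant_barriers:
  assumes u: "approximant n u ux v vx w wx" and x: "x \<in> {lo n..hi n}" and t: "t \<in> {0..T}"
  shows "bl x - lo n \<le> u x t" "u x t \<le> bu x + lo n"
  by (rule approximant_lower[OF u bl barrier(1) x t] approximant_upper[OF u bu barrier(2) x t]; assumption)+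

text \<open>Comparison on the smaller interval: at its left end both functions are close to
  \<open>g 0\<close>, at its right end both lie between the barriers up to \<open>lo n\<close>, and
  initially both are close to \<open>g\<close>. The sign \<open>\<tau>\<close> covers both orders
  with one proof.\<close>

lemma approximant_difference_upper:
  assumes u: "approximant n u ux v vx w wx" and u': "approximant m u' ux' v' vx' w' wx'" and nm: "n \<le> m"
    and M: "\<And>x. x \<ge> 0 \<Longrightarrow> \<bar>g x - g 0\<bar> \<le> \<epsilon> + M * x" "M \<ge> 0" "\<epsilon> \<ge> 0"
    and sgn: "\<tau> = 1 \<or> \<tau> = - 1"
    and x: "x \<in> {lo n..hi n}" and t: "t \<in> {0..T}"
  shows "\<tau> * (u x t - u' x t) \<le> 2 * (\<epsilon> + M * lo n) + 2 * lo n + (bu (hi n) - bl (hi n)) / \<psi> (hi n) * exp (\<kappa> * t) * \<psi> x"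
proof -
  have pos: "x > 0" if "lo n \<le> x" for x using lo_pos[of n] that by simp
  have sm: "smooth_heat a {lo n..hi n} T u ux v vx w wx" and sm': "smooth_heat a {lo m..hi m} T u' ux' v' vx' w' wx'"
    using u u' by (simp_all add: approximant_def)
  have sub: "{lo n..hi n} \<subseteq> {lo m..hi m}" using lo_antimono[OF nm] hi_mono[OF nm] by auto
  note sd = smooth_heat_diff[OF sm smooth_heat_subset[OF sm' sub]]
  \<comment> \<open>Chosen such that \<open>?\<delta> * \<psi> (hi n)\<close> is the distance of the
    barriers at the right end.\<close>
  let ?\<delta> = "(bu (hi n) - bl (hi n)) / \<psi> (hi n)"
  let ?\<omega> = "2 * (\<epsilon> + M * lo n) + 2 * lo n"
  have \<delta>: "?\<delta> \<ge> 0" using barrier[OF hi_pos, of n] \<psi>_pos[OF hi_pos, of n] by (intro divide_nonneg_nonneg) (auto intro: order_trans)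
  have \<omega>: "?\<omega> \<ge> 0" using M lo_pos[of n] by (simp add: mult_nonneg_nonneg)
  have p0: "0 \<le> ?\<delta> * \<psi> y" if "lo n \<le> y" for y using \<delta> \<psi>_pos[OF pos[OF that]] by (intro mult_nonneg_nonneg) auto
  have lm: "lo m \<le> lo n" by (rule lo_antimono[OF nm])
  have ends: "lo n \<in> {lo n..hi n}" "hi n \<in> {lo n..hi n}" using lo_hi[of n] by auto
  have L: "\<bar>u (lo n) t - u' (lo n) t\<bar> \<le> ?\<omega>" if t: "t \<in> {0..T}" for t
  proof -
    have "u (lo n) t = g (lo n)" using u t by (auto simp: approximant_def)
    then show ?thesis using M(1)[OF less_imp_le[OF lo_pos], of n] approximant_near_0[OF u' M(1) _ t, of "lo n"] sub ends lm lo_pos[of n] by auto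
  qed
  have R: "\<bar>u (hi n) t - u' (hi n) t\<bar> \<le> ?\<omega> + ?\<delta> * \<psi> (hi n)" if t: "t \<in> {0..T}" for t
  proof -
    have e: "?\<delta> * \<psi> (hi n) = bu (hi n) - bl (hi n)" using \<psi>_pos[OF hi_pos, of n] by simp
    have "u (hi n) t = g (hi n)" using u t by (auto simp: approximant_def)
    moreover have "0 \<le> M * lo n" using M lo_pos[of n] by simp
    moreover have "bl (hi n) - lo m \<le> u' (hi n) t" "u' (hi n) t \<le> bu (hi n) + lo m"
      using approximant_barriers[OF u' _ t, of "hi n"] sub ends by auto
    ultimately show ?thesis unfolding e using barrier[OF hi_pos, of n] lm lo_pos[of n] M(3)
      by (simp add: abs_le_iff algebra_simps)
  qed
  have I: "\<bar>u y 0 - u' y 0\<bar> \<le> ?\<omega>" if y: "y \<in> {lo n..hi n}" for y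
  proof -
    have "\<bar>u y 0 - g y\<bar> \<le> lo n" "\<bar>u' y 0 - g y\<bar> \<le> lo m" using u u' y sub by (auto simp: approximant_def)
    moreover have "0 \<le> M * lo n" using M lo_pos[of n] by simp
    ultimately show ?thesis using lm M(3) unfolding distrib_left by linarith
  qed
  have H: "heat_solution a {lo n..hi n} {0..T} (\<lambda>x t. \<tau> * (u x t - u' x t)) (\<lambda>x t. \<tau> * (ux x t - ux' x t)) (\<lambda>x t. \<tau> * (v x t - v' x t))"
    using sgn smooth_heatD(1)[OF sd] heat_solution_uminus[OF smooth_heatD(1)[OF sd]] by auto
  have cpsi: "continuous_on {lo n..hi n} \<psi>" using pos \<psi>(1) by (intro continuous_at_imp_continuous_on ballI DERIV_isCont) auto
  show ?thesis
  proof (rule comparison_upper[where u="\<lambda>x t. \<tau> * (u x t - u' x t)" and b="\<lambda>_. ?\<omega>" and b'="\<lambda>_. 0" and b''="\<lambda>_. 0" and a=a and \<psi>=\<psi> and \<psi>'=\<psi>' and \<psi>''=\<psi>'', OF _ _ _ _ _ _ _ _ _ _ cpsi _ \<kappa> \<delta> _ _ _ x t])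
    show "heat_solution a {lo n<..<hi n} {0<..T} (\<lambda>x t. \<tau> * (u x t - u' x t)) (\<lambda>x t. \<tau> * (ux x t - ux' x t)) (\<lambda>x t. \<tau> * (v x t - v' x t))"
      by (rule heat_solution_subset[OF H]) auto
    show "continuous_on ({lo n..hi n} \<times> {0..T}) (\<lambda>(x, t). \<tau> * (u x t - u' x t))"
      using continuous_on_mult_left[OF smooth_heatD(6)[OF sd], of \<tau>] by (simp add: case_prod_beta')
    show "\<tau> * (u (lo n) t - u' (lo n) t) \<le> ?\<omega> + ?\<delta> * \<psi> (lo n)" if "0 \<le> t" "t \<le> T" for t
      using L[of t] p0[of "lo n"] that sgn by (auto simp: abs_le_iff)
    show "\<tau> * (u (hi n) t - u' (hi n) t) \<le> ?\<omega> + ?\<delta> * \<psi> (hi n)" if "0 \<le> t" "t \<le> T" for t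
      using R[of t] that sgn by (auto simp: abs_le_iff)
    show "\<tau> * (u y 0 - u' y 0) \<le> ?\<omega> + ?\<delta> * \<psi> y" if "lo n \<le> y" "y \<le> hi n" for y
      using I[of y] p0[of y] that sgn by (auto simp: abs_le_iff)
    show "0 \<le> \<psi> x" if "lo n \<le> x" for x using \<psi>_pos[OF pos[OF that]] by simp
  qed (use pos a_pos \<psi> in auto)
qed

lemma approximant_difference:
  assumes "approximant n u ux v vx w wx" "approximant m u' ux' v' vx' w' wx'" "n \<le> m"
    and "\<And>x. x \<ge> 0 \<Longrightarrow> \<bar>g x - g 0\<bar> \<le> \<epsilon> + M * x" "M \<ge> 0" "\<epsilon> \<ge> 0" "x \<in> {lo n..hi n}" "t \<in> {0..T}"
  shows "\<bar>u x t - u' x t\<bar> \<le> 2 * (\<epsilon> + M * lo n) + 2 * lo n + (bu (hi n) - bl (hi n)) / \<psi> (hi n) * exp (\<kappa> * t) * \<psi> x"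
  using approximant_difference_upper[OF assms(1-6) _ assms(7,8), of 1] approximant_difference_upper[OF assms(1-6) _ assms(7,8), of "- 1"]
  by (simp add: abs_le_iff)

end

subsection \<open>Existence on the half-line\<close>

context interval_operator
begin

lemma uniform_limit_divide:
  fixes f :: "nat \<Rightarrow> real \<Rightarrow> real"
  assumes f: "uniform_limit {\<alpha>..\<beta>} f g sequentially"
  shows "uniform_limit {\<alpha>..\<beta>} (\<lambda>n x. f n x / a x) (\<lambda>x. g x / a x) sequentially"
proof (rule uniform_limitI)
  fix e :: real assume "e > 0"
  obtain x0 where x0: "x0 \<in> {\<alpha>..\<beta>}" "\<And>y. y \<in> {\<alpha>..\<beta>} \<Longrightarrow> a x0 \<le> a y"
    using continuous_attains_inf[OF _ _ a_cont] ab by auto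
  have "e * a x0 > 0" using a_pos[OF x0(1)] \<open>e > 0\<close> by simp
  from uniform_limitD[OF f this]
  show "\<forall>\<^sub>F n in sequentially. \<forall>x\<in>{\<alpha>..\<beta>}. dist (f n x / a x) (g x / a x) < e"
  proof eventually_elim
    case (elim n)
    show ?case
    proof
      fix y assume y: "y \<in> {\<alpha>..\<beta>}"
      have ay: "a y > 0" using a_pos[OF y] .
      have "\<bar>f n y - g y\<bar> < e * a x0" using elim y by (simp add: dist_real_def)
      also have "\<dots> \<le> e * a y" using x0(2)[OF y] \<open>e > 0\<close> by simp
      finally have "\<bar>f n y - g y\<bar> / a y < e" using ay by (simp add: divide_less_eq)
      then show "dist (f n y / a y) (g y / a y) < e"
        using ay by (simp add: dist_real_def diff_divide_distrib[symmetric] abs_divide)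
    qed
  qed
qed

end

context half_line_problem
begin

text \<open>On a fixed compact set the error in \<open>approximant_difference\<close> tends to
  \<open>2 * \<epsilon>\<close> as \<open>n\<close> grows, and \<open>\<epsilon>\<close> is free;
  \<open>e / 8\<close> leaves ample room.\<close>

lemma approximants_Cauchy:
  assumes A: "\<And>n. approximant n (u n) (ux n) (v n) (vx n) (w n) (wx n)"
    and ab: "0 < \<alpha>" "\<alpha> < \<beta>" and e: "e > 0"
  obtains N where "lo N \<le> \<alpha>" "\<beta> \<le> hi N"
    "\<And>n m x t. N \<le> n \<Longrightarrow> N \<le> m \<Longrightarrow> x \<in> {\<alpha>..\<beta>} \<Longrightarrow> t \<in> {0..T} \<Longrightarrow> \<bar>u n x t - u m x t\<bar> \<le> e"
proof -
  have "continuous_on {\<alpha>..\<beta>} \<psi>" by (intro continuous_at_imp_continuous_on ballI, rule DERIV_isCont[OF \<psi>(1)]) (use ab in auto)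
  then obtain xm where xm: "xm \<in> {\<alpha>..\<beta>}" "\<And>y. y \<in> {\<alpha>..\<beta>} \<Longrightarrow> \<psi> y \<le> \<psi> xm"
    using continuous_attains_sup[of "{\<alpha>..\<beta>}" \<psi>] ab by auto
  have "e / 8 > 0" using e by simp
  from g_near_0[OF this] obtain M where M: "M \<ge> 0" "\<And>x. x \<ge> 0 \<Longrightarrow> \<bar>g x - g 0\<bar> \<le> e / 8 + M * x" by blast
  define Bd where "Bd = (\<lambda>n. 2 * (e / 8 + M * lo n) + 2 * lo n + (bu (hi n) - bl (hi n)) / \<psi> (hi n) * exp (\<kappa> * T) * \<psi> xm)"
  have gl: "(\<lambda>n. (bu (hi n) - bl (hi n)) / \<psi> (hi n)) \<longlonglongrightarrow> 0"
    using filterlim_compose[OF gap hi_lim] by simp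
  have "Bd \<longlonglongrightarrow> 2 * (e / 8 + M * 0) + 2 * 0 + 0 * exp (\<kappa> * T) * \<psi> xm"
    unfolding Bd_def by (intro tendsto_intros lo_lim gl)
  then have "\<forall>\<^sub>F n in sequentially. Bd n < e"
    by (rule order_tendstoD(2)) (use e in simp)
  moreover have "\<forall>\<^sub>F n in sequentially. lo n < \<alpha>" by (rule order_tendstoD(2)[OF lo_lim ab(1)])
  moreover have "\<forall>\<^sub>F n in sequentially. \<beta> \<le> hi n"
    using hi_lim unfolding filterlim_at_top by blast
  ultimately have "\<forall>\<^sub>F n in sequentially. Bd n < e \<and> lo n < \<alpha> \<and> \<beta> \<le> hi n"
    by eventually_elim auto
  then obtain N where N: "\<And>n. n \<ge> N \<Longrightarrow> Bd n < e \<and> lo n < \<alpha> \<and> \<beta> \<le> hi n"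
    unfolding eventually_sequentially by blast
  have main: "\<bar>u n x t - u m x t\<bar> \<le> e" if "N \<le> n" "n \<le> m" "x \<in> {\<alpha>..\<beta>}" "t \<in> {0..T}" for n m x t
  proof -
    have xin: "x \<in> {lo n..hi n}" using N[OF that(1)] that(3) by auto
    have \<delta>: "(bu (hi n) - bl (hi n)) / \<psi> (hi n) \<ge> 0"
      using barrier[OF hi_pos, of n] \<psi>_pos[OF hi_pos, of n] by (intro divide_nonneg_nonneg) (auto intro: order_trans)
    have "\<bar>u n x t - u m x t\<bar> \<le> 2 * (e / 8 + M * lo n) + 2 * lo n + (bu (hi n) - bl (hi n)) / \<psi> (hi n) * exp (\<kappa> * t) * \<psi> x"
      by (rule approximant_difference[OF A A that(2) M(2) M(1) _ xin that(4)]) (use e in auto)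
    also have "\<dots> \<le> Bd n"
    proof -
      have "d * exp (\<kappa> * t) * p \<le> d * exp (\<kappa> * T) * q" if "0 \<le> d" "p \<le> q" "0 \<le> p" for d p q :: real
        using that \<kappa> \<open>t \<in> {0..T}\<close> by (intro mult_mono) (auto intro: mult_left_mono)
      from this[OF \<delta> xm(2)[OF that(3)]] show ?thesis
        unfolding Bd_def using \<psi>_pos[of x] ab that(3) by (intro add_left_mono) auto
    qed
    also have "\<dots> \<le> e" using N[OF that(1)] by simp
    finally show ?thesis .
  qed
  have "\<bar>u n x t - u m x t\<bar> \<le> e" if "N \<le> n" "N \<le> m" "x \<in> {\<alpha>..\<beta>}" "t \<in> {0..T}" for n m x t
    using main[of n m x t] main[of m n x t] that by (cases "n \<le> m") (auto simp: abs_minus_commute)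
  then show ?thesis using that[of N] N[of N] by auto
qed

text \<open>The difference of two approximants is itself a smooth solution on a slightly larger
  interval, so \<open>interior_estimate\<close> converts uniform smallness of
  \<open>u n - u m\<close> into that of \<open>v n - v m\<close>, away from
  \<open>t = 0\<close>.\<close>

lemma approximants_time_derivative_Cauchy:
  assumes A: "\<And>n. approximant n (u n) (ux n) (v n) (vx n) (w n) (wx n)"
    and ab: "0 < \<alpha>" "\<alpha> < \<beta>" and s: "0 < s" and e: "e > 0"
  obtains N where "\<And>n m x t. N \<le> n \<Longrightarrow> N \<le> m \<Longrightarrow> x \<in> {\<alpha>..\<beta>} \<Longrightarrow> t \<in> {s..T} \<Longrightarrow> \<bar>v n x t - v m x t\<bar> < e"
proof -
  define \<alpha>' \<beta>' where "\<alpha>' = \<alpha> / 2" and "\<beta>' = 2 * \<beta>"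
  have ab': "0 < \<alpha>'" "\<alpha>' < \<alpha>" "\<beta> < \<beta>'" "\<alpha>' < \<beta>'" using ab by (auto simp: \<alpha>'_def \<beta>'_def)
  interpret I: interval_operator \<alpha>' \<beta>' a by (rule op[OF ab'(1,4)])
  obtain K where K: "K \<ge> 0" "\<And>u ux v vx w wx M x t. smooth_heat a {\<alpha>'..\<beta>'} T u ux v vx w wx \<Longrightarrow>
      (\<And>x t. x \<in> {\<alpha>'..\<beta>'} \<Longrightarrow> t \<in> {0..T} \<Longrightarrow> \<bar>u x t\<bar> \<le> M) \<Longrightarrow> x \<in> {\<alpha>'..\<beta>'} \<Longrightarrow> t \<in> {0<..T} \<Longrightarrow>
      I.cutoff x ^ 7 * (v x t)\<^sup>2 \<le> K * M\<^sup>2 * (1 / t\<^sup>2 + 1 / t ^ 3)"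
    using I.interior_estimate[OF T] by blast
  have "continuous_on {\<alpha>..\<beta>} I.cutoff" by (rule DERIV_continuous_on[OF I.cutoff_deriv])
  then obtain y0 where y0: "y0 \<in> {\<alpha>..\<beta>}" "\<And>y. y \<in> {\<alpha>..\<beta>} \<Longrightarrow> I.cutoff y0 \<le> I.cutoff y"
    using continuous_attains_inf[of "{\<alpha>..\<beta>}" I.cutoff] ab by auto
  define c where "c = I.cutoff y0 ^ 7"
  have cy0: "I.cutoff y0 > 0" using y0(1) ab' by (auto simp: I.cutoff_def)
  then have c: "c > 0" by (simp add: c_def)
  define Q where "Q = 1 / s\<^sup>2 + 1 / s ^ 3"
  have Q: "Q > 0" using s by (simp add: Q_def add_pos_pos)
  \<comment> \<open>Makes \<open>K * \<mu>\<^sup>2 * Q < c * e\<^sup>2\<close>, where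
    \<open>c\<close> is the least value of \<open>cutoff ^ 7\<close> on the inner interval; the
    added 1 covers \<open>K = 0\<close>.\<close>
  define \<mu> where "\<mu> = sqrt (c * e\<^sup>2 / (K * Q + 1))"
  have KQ: "K * Q + 1 > 0" using K Q by (simp add: add_nonneg_pos)
  have \<mu>: "\<mu> > 0" "\<mu>\<^sup>2 = c * e\<^sup>2 / (K * Q + 1)" using c e KQ by (auto simp: \<mu>_def)
  have small: "K * \<mu>\<^sup>2 * Q < c * e\<^sup>2"
  proof -
    have "K * \<mu>\<^sup>2 * Q = c * e\<^sup>2 * (K * Q) / (K * Q + 1)" by (simp add: \<mu>(2))
    also have "\<dots> < c * e\<^sup>2" using c e KQ by (simp add: divide_less_eq)
    finally show ?thesis .
  qed
  obtain N where N: "lo N \<le> \<alpha>'" "\<beta>' \<le> hi N"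
    "\<And>n m x t. N \<le> n \<Longrightarrow> N \<le> m \<Longrightarrow> x \<in> {\<alpha>'..\<beta>'} \<Longrightarrow> t \<in> {0..T} \<Longrightarrow> \<bar>u n x t - u m x t\<bar> \<le> \<mu>"
    using approximants_Cauchy[OF A ab'(1,4) \<mu>(1)] by blast
  have "\<bar>v n x t - v m x t\<bar> < e" if nm: "N \<le> n" "N \<le> m" and x: "x \<in> {\<alpha>..\<beta>}" and t: "t \<in> {s..T}" for n m x t
  proof -
    have sub: "{\<alpha>'..\<beta>'} \<subseteq> {lo n..hi n}" "{\<alpha>'..\<beta>'} \<subseteq> {lo m..hi m}"
      using N(1,2) lo_antimono[OF nm(1)] lo_antimono[OF nm(2)] hi_mono[OF nm(1)] hi_mono[OF nm(2)] by auto
    have sm: "smooth_heat a {lo n..hi n} T (u n) (ux n) (v n) (vx n) (w n) (wx n)" for n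
      using A[of n] by (simp add: approximant_def)
    note sd = smooth_heat_diff[OF smooth_heat_subset[OF sm sub(1)] smooth_heat_subset[OF sm sub(2)]]
    have t': "t \<in> {0<..T}" "s \<le> t" "0 < t" using t s by auto
    have "I.cutoff x ^ 7 * (v n x t - v m x t)\<^sup>2 \<le> K * \<mu>\<^sup>2 * (1 / t\<^sup>2 + 1 / t ^ 3)"
      by (rule K(2)[OF sd _ _ t'(1)]) (use N(3)[OF nm] x ab' in auto)
    also have "\<dots> \<le> K * \<mu>\<^sup>2 * Q"
      unfolding Q_def using K(1) s t'
      by (intro mult_left_mono add_mono frac_le power_mono mult_pos_pos zero_less_power) auto
    also have "\<dots> < c * e\<^sup>2" by (rule small)
    finally have 1: "I.cutoff x ^ 7 * (v n x t - v m x t)\<^sup>2 < c * e\<^sup>2" .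
    have "c * (v n x t - v m x t)\<^sup>2 \<le> I.cutoff x ^ 7 * (v n x t - v m x t)\<^sup>2"
      unfolding c_def using y0(2)[OF x] cy0 by (intro mult_right_mono power_mono) auto
    with 1 have "c * (v n x t - v m x t)\<^sup>2 < c * e\<^sup>2" by simp
    then have "(v n x t - v m x t)\<^sup>2 < e\<^sup>2" using c by simp
    then have "\<bar>v n x t - v m x t\<bar>\<^sup>2 < e\<^sup>2" by simp
    then show ?thesis by (rule power2_less_imp_less) (use e in simp)
  qed
  then show ?thesis using that by blast
qed

text \<open>Locally uniform limits of \<open>u n\<close> and \<open>v n\<close> carry all
  regularity, since \<open>v n / a\<close> is the second space derivative of \<open>u n\<close>. The
  point \<open>x = 0\<close> lies outside every approximating interval; the value there is set to
  \<open>g 0\<close>, and its continuous attainment comes from affine bounds uniform in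
  \<open>n\<close>.\<close>

lemma existence:
  "\<exists>U Ux V. continuous_on ({0..} \<times> {0..T}) (\<lambda>(x, t). U x t) \<and> heat_solution a {0<..} {0<..T} U Ux V \<and>
     continuous_on ({0<..} \<times> {0<..T}) (\<lambda>(x, t). Ux x t) \<and> continuous_on ({0<..} \<times> {0<..T}) (\<lambda>(x, t). V x t) \<and>
     (\<forall>t\<in>{0..T}. U 0 t = g 0) \<and> (\<forall>x\<ge>0. U x 0 = g x) \<and>
     (\<forall>x>0. \<forall>t\<in>{0..T}. bl x \<le> U x t \<and> U x t \<le> bu x)"
proof -
  obtain u ux v vx w wx where A: "\<And>n. approximant n (u n) (ux n) (v n) (vx n) (w n) (wx n)"
    using approximant_exists by metis
  have sm: "smooth_heat a {lo n..hi n} T (u n) (ux n) (v n) (vx n) (w n) (wx n)" for n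
    using A[of n] by (simp add: approximant_def)
  define U where "U = (\<lambda>x t. if x \<le> 0 then g 0 else lim (\<lambda>n. u n x t))"
  define V where "V = (\<lambda>x t. lim (\<lambda>n. v n x t))"
  have inside: "\<forall>\<^sub>F n in sequentially. {\<alpha>..\<beta>} \<subseteq> {lo n..hi n}" if "0 < \<alpha>" for \<alpha> \<beta>
  proof -
    have "\<forall>\<^sub>F n in sequentially. lo n < \<alpha>" by (rule order_tendstoD(2)[OF lo_lim that])
    moreover have "\<forall>\<^sub>F n in sequentially. \<beta> \<le> hi n"
      using hi_lim unfolding filterlim_at_top by blast
    ultimately show ?thesis by eventually_elim auto
  qed
  have uU: "uniform_limit ({\<alpha>..\<beta>} \<times> {0..T}) (\<lambda>n (x, t). u n x t) (\<lambda>(x, t). U x t) sequentially"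
    if ab: "0 < \<alpha>" "\<alpha> < \<beta>" for \<alpha> \<beta>
  proof -
    have "uniformly_Cauchy_on ({\<alpha>..\<beta>} \<times> {0..T}) (\<lambda>n (x, t). u n x t)"
    proof (rule uniformly_Cauchy_onI)
      fix e :: real assume "e > 0"
      then have "e / 2 > 0" by simp
      obtain N where "lo N \<le> \<alpha>" "\<beta> \<le> hi N" and
        N: "\<And>n m x t. N \<le> n \<Longrightarrow> N \<le> m \<Longrightarrow> x \<in> {\<alpha>..\<beta>} \<Longrightarrow> t \<in> {0..T} \<Longrightarrow> \<bar>u n x t - u m x t\<bar> \<le> e / 2"
        using approximants_Cauchy[OF A ab \<open>e / 2 > 0\<close>] by blast
      have "dist (u m x t) (u n x t) < e" if "m \<ge> N" "n \<ge> N" "x \<in> {\<alpha>..\<beta>}" "t \<in> {0..T}" for m n x t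
        using N[of m n x t] that \<open>e > 0\<close> by (simp add: dist_real_def)
      then show "\<exists>M. \<forall>z\<in>{\<alpha>..\<beta>} \<times> {0..T}. \<forall>m\<ge>M. \<forall>n\<ge>M. dist (case z of (x, t) \<Rightarrow> u m x t) (case z of (x, t) \<Rightarrow> u n x t) < e"
        by (intro exI[of _ N]) auto
    qed
    then have "uniform_limit ({\<alpha>..\<beta>} \<times> {0..T}) (\<lambda>n (x, t). u n x t) (\<lambda>z. lim (\<lambda>n. case z of (x, t) \<Rightarrow> u n x t)) sequentially"
      using Cauchy_uniformly_convergent uniformly_convergent_uniform_limit_iff by blast
    then show ?thesis
      by (rule uniform_limit_cong'[THEN iffD1, rotated 2]) (use ab in \<open>auto simp: U_def\<close>)
  qed
  have vV: "uniform_limit ({\<alpha>..\<beta>} \<times> {s..T}) (\<lambda>n (x, t). v n x t) (\<lambda>(x, t). V x t) sequentially"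
    if ab: "0 < \<alpha>" "\<alpha> < \<beta>" and s: "0 < s" for \<alpha> \<beta> s
  proof -
    have "uniformly_Cauchy_on ({\<alpha>..\<beta>} \<times> {s..T}) (\<lambda>n (x, t). v n x t)"
    proof (rule uniformly_Cauchy_onI)
      fix e :: real assume "e > 0"
      obtain N where
        N: "\<And>n m x t. N \<le> n \<Longrightarrow> N \<le> m \<Longrightarrow> x \<in> {\<alpha>..\<beta>} \<Longrightarrow> t \<in> {s..T} \<Longrightarrow> \<bar>v n x t - v m x t\<bar> < e"
        using approximants_time_derivative_Cauchy[OF A ab s \<open>e > 0\<close>] by blast
      then show "\<exists>M. \<forall>z\<in>{\<alpha>..\<beta>} \<times> {s..T}. \<forall>m\<ge>M. \<forall>n\<ge>M. dist (case z of (x, t) \<Rightarrow> v m x t) (case z of (x, t) \<Rightarrow> v n x t) < e"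
        by (intro exI[of _ N]) (auto simp: dist_real_def)
    qed
    then have "uniform_limit ({\<alpha>..\<beta>} \<times> {s..T}) (\<lambda>n (x, t). v n x t) (\<lambda>z. lim (\<lambda>n. case z of (x, t) \<Rightarrow> v n x t)) sequentially"
      using Cauchy_uniformly_convergent uniformly_convergent_uniform_limit_iff by blast
    then show ?thesis
      by (rule uniform_limit_cong'[THEN iffD1, rotated 2]) (auto simp: V_def)
  qed
  have ulim: "(\<lambda>n. u n x t) \<longlonglongrightarrow> U x t" if "x > 0" "t \<in> {0..T}" for x t
    using tendsto_uniform_limitI[OF uU[of x "x + 1"], of "(x, t)"] that by simp
  have cU: "continuous_on ({0<..} \<times> {0..T}) (\<lambda>(x, t). U x t)"
  proof (rule continuous_on_pos_Times)
    fix \<alpha> \<beta> :: real assume ab: "0 < \<alpha>" "\<alpha> < \<beta>"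
    show "continuous_on ({\<alpha>..\<beta>} \<times> {0..T}) (\<lambda>(x, t). U x t)"
    proof (rule uniform_limit_theorem[OF _ uU[OF ab]])
      show "\<forall>\<^sub>F n in sequentially. continuous_on ({\<alpha>..\<beta>} \<times> {0..T}) (\<lambda>(x, t). u n x t)"
        using inside[OF ab(1), of \<beta>]
        by eventually_elim (auto intro: continuous_on_subset[OF smooth_heatD(6)[OF sm]])
    qed simp
  qed
  have cV: "continuous_on ({0<..} \<times> {0<..T}) (\<lambda>(x, t). V x t)"
  proof (rule continuous_on_pos_Times, rule continuous_on_Times_initial)
    fix \<alpha> \<beta> s :: real assume ab: "0 < \<alpha>" "\<alpha> < \<beta>" and s: "0 < s"
    show "continuous_on ({\<alpha>..\<beta>} \<times> {s..T}) (\<lambda>(x, t). V x t)"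
    proof (rule uniform_limit_theorem[OF _ vV[OF ab s]])
      show "\<forall>\<^sub>F n in sequentially. continuous_on ({\<alpha>..\<beta>} \<times> {s..T}) (\<lambda>(x, t). v n x t)"
        using inside[OF ab(1), of \<beta>]
        by eventually_elim (use s in \<open>auto intro!: continuous_on_subset[OF smooth_heatD(8)[OF sm]]\<close>)
    qed simp
  qed
  have space: "\<exists>\<alpha> \<beta> g'. \<alpha> < x \<and> x < \<beta> \<and> (\<forall>y\<in>{\<alpha>..\<beta>}. ((\<lambda>x. U x t) has_real_derivative g' y) (at y within {\<alpha>..\<beta>}) \<and>
        (g' has_real_derivative V y t / a y) (at y within {\<alpha>..\<beta>}))" if x: "x > 0" and t: "t \<in> {0<..T}" for x t
  proof -
    define \<alpha> \<beta> where "\<alpha> = x / 2" and "\<beta> = 2 * x"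
    have ab: "0 < \<alpha>" "\<alpha> < x" "x < \<beta>" "\<alpha> < \<beta>" using x by (auto simp: \<alpha>_def \<beta>_def)
    interpret I: interval_operator \<alpha> \<beta> a by (rule op[OF ab(1,4)])
    obtain N where N: "\<And>n. n \<ge> N \<Longrightarrow> {\<alpha>..\<beta>} \<subseteq> {lo n..hi n}"
      using inside[OF ab(1), of \<beta>] unfolding eventually_sequentially by blast
    have t0: "t \<in> {0..T}" "0 < t" using t by auto
    have L1: "uniform_limit {\<alpha>..\<beta>} (\<lambda>n x. u (n + N) x t) (\<lambda>x. U x t) sequentially"
    proof (rule uniform_limitI)
      fix e :: real assume "e > 0"
      from sequentially_offset[OF uniform_limitD[OF uU[OF ab(1,4)] this], of N]
      show "\<forall>\<^sub>F n in sequentially. \<forall>x\<in>{\<alpha>..\<beta>}. dist (u (n + N) x t) (U x t) < e"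
        by eventually_elim (use t0 in auto)
    qed
    have L2': "uniform_limit {\<alpha>..\<beta>} (\<lambda>n x. v (n + N) x t) (\<lambda>x. V x t) sequentially"
    proof (rule uniform_limitI)
      fix e :: real assume "e > 0"
      from sequentially_offset[OF uniform_limitD[OF vV[OF ab(1,4) t0(2)] this], of N]
      show "\<forall>\<^sub>F n in sequentially. \<forall>x\<in>{\<alpha>..\<beta>}. dist (v (n + N) x t) (V x t) < e"
        by eventually_elim (use t0 in auto)
    qed
    note L2 = I.uniform_limit_divide[OF L2']
    obtain g' where "\<And>y. y \<in> {\<alpha>..\<beta>} \<Longrightarrow> ((\<lambda>x. U x t) has_real_derivative g' y) (at y within {\<alpha>..\<beta>})"
      "\<And>y. y \<in> {\<alpha>..\<beta>} \<Longrightarrow> (g' has_real_derivative V y t / a y) (at y within {\<alpha>..\<beta>})"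
    proof (rule C2_uniform_limit[OF ab(4) _ _ L1 L2])
      fix n y assume y: "y \<in> {\<alpha>..\<beta>}"
      have sub: "{\<alpha>..\<beta>} \<subseteq> {lo (n + N)..hi (n + N)}" using N[of "n + N"] by simp
      have "heat_solution a {\<alpha>..\<beta>} {0..T} (u (n + N)) (ux (n + N)) (v (n + N))"
        using heat_solution_subset[OF smooth_heatD(1)[OF sm] sub order_refl] .
      from heat_solutionD(1,2)[OF this y t0(1)]
      show "((\<lambda>x. u (n + N) x t) has_real_derivative ux (n + N) y t) (at y within {\<alpha>..\<beta>})"
        "((\<lambda>x. ux (n + N) x t) has_real_derivative v (n + N) y t / a y) (at y within {\<alpha>..\<beta>})" .
    qed blast
    then show ?thesis using ab(2,3) by blast
  qed
  have time: "((\<lambda>s. U x s) has_real_derivative V x t) (at t within {0<..T})" if x: "x > 0" and t: "t \<in> {0<..T}" for x t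
  proof -
    define s where "s = t / 2"
    have s: "0 < s" "s < t" using t by (auto simp: s_def)
    obtain N where N: "\<And>n. n \<ge> N \<Longrightarrow> {x..x+1} \<subseteq> {lo n..hi n}"
      using inside[OF x, of "x + 1"] unfolding eventually_sequentially by blast
    have "((\<lambda>s. U x s) has_real_derivative V x t) (at t within {s..T})"
    proof (rule derivative_uniform_limit[where F="\<lambda>n. u n x" and F'="\<lambda>n. v n x" and N=N])
      fix n r assume n: "n \<ge> N" and r: "r \<in> {s..T}"
      have "x \<in> {lo n..hi n}" using N[OF n] by auto
      then show "(u n x has_real_derivative v n x r) (at r within {s..T})"
        using DERIV_subset[OF heat_solutionD(3)[OF smooth_heatD(1)[OF sm]], of x n r "{s..T}"] r s by auto
    next
      show "(\<lambda>n. u n x r) \<longlonglongrightarrow> U x r" if "r \<in> {s..T}" for r using ulim[OF x] that s by auto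
      show "uniform_limit {s..T} (\<lambda>n. v n x) (V x) sequentially"
      proof (rule uniform_limitI)
        fix e :: real assume "e > 0"
        have "x < x + 1" by simp
        from uniform_limitD[OF vV[OF x this s(1)] \<open>e > 0\<close>]
        show "\<forall>\<^sub>F n in sequentially. \<forall>r\<in>{s..T}. dist (v n x r) (V x r) < e"
          by eventually_elim auto
      qed
      show "t \<in> {s..T}" using s t by auto
    qed
    moreover have "at t within {s..T} = at t within {0<..T}"
    proof (rule at_within_nhd[of _ "{s<..}"])
      show "{s..T} \<inter> {s<..} - {t} = {0<..T} \<inter> {s<..} - {t}" using s by auto
    qed (use s in auto)
    ultimately show ?thesis by simp
  qed
  define Ux where "Ux = (\<lambda>x t. deriv (\<lambda>y. U y t) x)"
  have heat: "heat_solution a {0<..} {0<..T} U Ux V"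
    unfolding Ux_def by (rule heat_solution_of_local[OF space time])
  have cUx: "continuous_on ({0<..} \<times> {0<..T}) (\<lambda>(x, t). Ux x t)"
    by (rule heat_solution_continuous_space_derivative[OF a_cont a_pos heat _ cV]) (auto intro: continuous_on_subset[OF cU])
  \<comment> \<open>In the limit the term \<open>lo n\<close> disappears. The bound is uniform in
    \<open>t\<close>, so it gives continuity at the corner \<open>(0, 0)\<close> as well.\<close>
  have near0: "\<bar>U x t - g 0\<bar> \<le> \<epsilon> + M * x" if M: "\<And>x. x \<ge> 0 \<Longrightarrow> \<bar>g x - g 0\<bar> \<le> \<epsilon> + M * x" and x: "x > 0" and t: "t \<in> {0..T}" for \<epsilon> M x t
  proof (rule LIMSEQ_le)
    show "(\<lambda>n. \<bar>u n x t - g 0\<bar>) \<longlonglongrightarrow> \<bar>U x t - g 0\<bar>" by (intro tendsto_intros ulim x t)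
    have "(\<lambda>n. \<epsilon> + M * x + lo n) \<longlonglongrightarrow> \<epsilon> + M * x + 0" by (intro tendsto_intros lo_lim)
    then show "(\<lambda>n. \<epsilon> + M * x + lo n) \<longlonglongrightarrow> \<epsilon> + M * x" by simp
    obtain N where N: "\<And>n. n \<ge> N \<Longrightarrow> {x..x+1} \<subseteq> {lo n..hi n}"
      using inside[OF x, of "x + 1"] unfolding eventually_sequentially by blast
    have xin: "x \<in> {lo n..hi n}" if "n \<ge> N" for n using N[OF that] by auto
    show "\<exists>N. \<forall>n\<ge>N. \<bar>u n x t - g 0\<bar> \<le> \<epsilon> + M * x + lo n"
      using approximant_near_0[OF A M xin t] by blast
  qed
  have bounds: "bl x \<le> U x t \<and> U x t \<le> bu x" if x: "x > 0" and t: "t \<in> {0..T}" for x t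
  proof -
    obtain N where N: "\<And>n. n \<ge> N \<Longrightarrow> {x..x+1} \<subseteq> {lo n..hi n}"
      using inside[OF x, of "x + 1"] unfolding eventually_sequentially by blast
    have xin: "x \<in> {lo n..hi n}" if "n \<ge> N" for n using N[OF that] by auto
    have "(\<lambda>n. bl x - lo n) \<longlonglongrightarrow> bl x - 0" "(\<lambda>n. bu x + lo n) \<longlonglongrightarrow> bu x + 0" by (intro tendsto_intros lo_lim)+
    then show ?thesis
      using LIMSEQ_le[OF _ ulim[OF x t], of "\<lambda>n. bl x - lo n" "bl x"] LIMSEQ_le[OF ulim[OF x t], of "\<lambda>n. bu x + lo n" "bu x"]
        approximant_barriers[OF A xin t] by auto
  qed
  have init: "U x 0 = g x" if x: "x > 0" for x
  proof -
    have t: "0 \<in> {0..T}" using T by simp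
    obtain N where N: "\<And>n. n \<ge> N \<Longrightarrow> {x..x+1} \<subseteq> {lo n..hi n}"
      using inside[OF x, of "x + 1"] unfolding eventually_sequentially by blast
    have "(\<lambda>n. u n x 0 - g x) \<longlonglongrightarrow> 0"
    proof (rule Lim_null_comparison[OF _ lo_lim])
      have "norm (u n x 0 - g x) \<le> lo n" if "n \<ge> N" for n
        using A[of n] N[OF that] by (auto simp: approximant_def)
      then show "\<forall>\<^sub>F n in sequentially. norm (u n x 0 - g x) \<le> lo n" unfolding eventually_sequentially by blast
    qed
    then have "(\<lambda>n. u n x 0) \<longlonglongrightarrow> g x" by (rule LIM_zero_cancel)
    then show ?thesis using ulim[OF x t] LIMSEQ_unique by blast
  qed
  have cU0: "continuous_on ({0..} \<times> {0..T}) (\<lambda>(x, t). U x t)"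
    unfolding continuous_on_eq_continuous_within
  proof
    fix z :: "real \<times> real" assume z: "z \<in> {0..} \<times> {0..T}"
    show "continuous (at z within {0..} \<times> {0..T}) (\<lambda>(x, t). U x t)"
    proof (cases "fst z = 0")
      case True
      then obtain t where zt: "z = (0, t)" "t \<in> {0..T}" using z by (cases z) auto
      have "((\<lambda>(x, t). U x t) \<longlongrightarrow> g 0) (at z within {0..} \<times> {0..T})"
      proof (rule tendstoI)
        fix e :: real assume e: "e > 0"
        then have "e / 2 > 0" by simp
        from g_near_0[OF this] obtain M where M: "M \<ge> 0" "\<And>x. x \<ge> 0 \<Longrightarrow> \<bar>g x - g 0\<bar> \<le> e / 2 + M * x" by blast
        have "((\<lambda>z. M * fst z) \<longlongrightarrow> M * fst z) (at z within {0..} \<times> {0..T})"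
          by (intro tendsto_intros)
        then have "\<forall>\<^sub>F z in at z within {0..} \<times> {0..T}. M * fst z < e / 2"
          by (rule order_tendstoD(2)) (use zt e in simp)
        moreover have "\<forall>\<^sub>F y in at z within {0..} \<times> {0..T}. y \<in> {0..} \<times> {0..T}" by (simp add: eventually_at_filter)
        ultimately show "\<forall>\<^sub>F z in at z within {0..} \<times> {0..T}. dist (case z of (x, t) \<Rightarrow> U x t) (g 0) < e"
        proof eventually_elim
          case (elim y)
          obtain x t where y: "y = (x, t)" "x \<ge> 0" "t \<in> {0..T}" using elim(2) by auto
          show ?case
          proof (cases "x = 0")
            case True
            then show ?thesis using e y by (simp add: U_def)
          next
            case False
            then have "\<bar>U x t - g 0\<bar> \<le> e / 2 + M * x" using near0[OF M(2), of x t] y by simp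
            then show ?thesis using elim(1) y by (simp add: dist_real_def)
          qed
        qed
      qed
      then show ?thesis by (simp add: continuous_within zt U_def)
    next
      case False
      then have zp: "z \<in> {0<..} \<times> {0..T}" using z by (cases z) auto
      have "continuous (at z within {0<..} \<times> {0..T}) (\<lambda>(x, t). U x t)"
        using cU zp unfolding continuous_on_eq_continuous_within by blast
      moreover have "at z within {0<..} \<times> {0..T} = at z within {0..} \<times> {0..T}"
      proof (rule at_within_nhd[of _ "{0<..} \<times> UNIV"])
        show "z \<in> {0<..} \<times> UNIV" using zp by (simp add: mem_Times_iff)
        show "open ({0<..} \<times> (UNIV :: real set) :: (real \<times> real) set)" by (intro open_Times) auto
        show "{0<..} \<times> {0..T} \<inter> {0<..} \<times> UNIV - {z} = {0..} \<times> {0..T} \<inter> {0<..} \<times> UNIV - {z}" by auto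
      qed
      ultimately show ?thesis by simp
    qed
  qed
  have "U x 0 = g x" if "x \<ge> 0" for x using init[of x] that by (cases "x = 0") (auto simp: U_def)
  moreover have "U 0 t = g 0" for t by (simp add: U_def)
  ultimately show ?thesis using cU0 heat cUx cV bounds by blast
qed

end

subsection \<open>Time reversal, uniqueness and time integrals\<close>

lemma continuous_on_nonneg_Times:
  fixes f :: "real \<times> real \<Rightarrow> real"
  assumes "\<And>R. 0 < R \<Longrightarrow> continuous_on ({0..R} \<times> J) f"
  shows "continuous_on ({0..} \<times> J) f"
  unfolding continuous_on_eq_continuous_within
proof
  fix z :: "real \<times> real" assume z: "z \<in> {0..} \<times> J"
  define R where "R = fst z + 1"
  have R: "0 < R" "fst z < R" using z by (auto simp: R_def)
  have "continuous (at z within {0..R} \<times> J) f"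
    using assms[OF R(1)] z R unfolding continuous_on_eq_continuous_within
    by (elim ballE[where x=z]) (auto simp: mem_Times_iff)
  moreover have "at z within {0..R} \<times> J = at z within {0..} \<times> J"
  proof (rule at_within_nhd[of _ "{..<R} \<times> UNIV"])
    show "z \<in> {..<R} \<times> UNIV" using R by (simp add: mem_Times_iff)
    show "open ({..<R} \<times> (UNIV :: real set))" by (intro open_Times) auto
    show "{0..R} \<times> J \<inter> {..<R} \<times> UNIV - {z} = {0..} \<times> J \<inter> {..<R} \<times> UNIV - {z}" by auto
  qed
  ultimately show "continuous (at z within {0..} \<times> J) f" by simp
qed

lemma continuous_on_reverse_time:
  fixes f :: "real \<Rightarrow> real \<Rightarrow> real"
  assumes "continuous_on (X \<times> J) (\<lambda>(x, t). f x t)" "\<And>t. t \<in> J' \<Longrightarrow> T - t \<in> J"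
  shows "continuous_on (X \<times> J') (\<lambda>(x, t). f x (T - t))"
proof -
  have "continuous_on (X \<times> J') (\<lambda>z. (fst z, T - snd z))" by (intro continuous_intros)
  from continuous_on_compose2[OF assms(1) this] show ?thesis
    using assms(2) by (auto simp: case_prod_beta' image_subset_iff)
qed

lemma derivative_reverse_time:
  assumes "(f has_real_derivative d) (at (T - t) within J)" "\<And>t. t \<in> J' \<Longrightarrow> T - t \<in> J"
  shows "((\<lambda>s. f (T - s)) has_real_derivative - d) (at t within J')"
proof -
  have sub: "(\<lambda>s. T - s) ` J' \<subseteq> J" using assms(2) by auto
  have "((\<lambda>s. T - s) has_real_derivative - 1) (at t within J')" by (auto intro!: derivative_eq_intros)
  from DERIV_image_chain[OF DERIV_subset[OF assms(1) sub] this] show ?thesis by (simp add: o_def)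
qed

text \<open>Time is reversed: \<open>t\<close> below is the paper's \<open>T - t\<close>, and \<open>a\<close> is \<open>\<sigma>\<^sup>2 / 2\<close>.\<close>

definition forward_solution :: "(real \<Rightarrow> real) \<Rightarrow> real \<Rightarrow> (real \<Rightarrow> real) \<Rightarrow> (real \<Rightarrow> real \<Rightarrow> real) \<Rightarrow> bool" where
  "forward_solution a T g U \<longleftrightarrow> continuous_on ({0..} \<times> {0..T}) (\<lambda>(x, t). U x t) \<and>
     (\<exists>Ux V. heat_solution a {0<..} {0<..T} U Ux V \<and> continuous_on ({0<..} \<times> {0<..T}) (\<lambda>(x, t). Ux x t) \<and>
       continuous_on ({0<..} \<times> {0<..T}) (\<lambda>(x, t). V x t)) \<and>
     (\<forall>t\<in>{0..T}. U 0 t = g 0) \<and> (\<forall>x\<ge>0. U x 0 = g x)"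

lemma forward_solutionI:
  assumes "continuous_on ({0..} \<times> {0..T}) (\<lambda>(x, t). U x t)" "heat_solution a {0<..} {0<..T} U Ux V"
    "continuous_on ({0<..} \<times> {0<..T}) (\<lambda>(x, t). Ux x t)" "continuous_on ({0<..} \<times> {0<..T}) (\<lambda>(x, t). V x t)"
    "\<And>t. t \<in> {0..T} \<Longrightarrow> U 0 t = g 0" "\<And>x. x \<ge> 0 \<Longrightarrow> U x 0 = g x"
  shows "forward_solution a T g U"
  unfolding forward_solution_def
  by (intro conjI exI[of _ Ux] exI[of _ V] assms ballI allI impI)

lemma forward_solution_add:
  assumes "forward_solution a T g U" "forward_solution a T h W"
  shows "forward_solution a T (\<lambda>x. g x + h x) (\<lambda>x t. U x t + W x t)"
proof -
  have c: "continuous_on S (\<lambda>(x, t). f x t + f' x t)" if "continuous_on S (\<lambda>(x, t). f x t)" "continuous_on S (\<lambda>(x, t). f' x t)"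
    for S and f f' :: "real \<Rightarrow> real \<Rightarrow> real"
    using continuous_on_add[OF that] by (simp add: case_prod_beta')
  obtain Ux V where U: "heat_solution a {0<..} {0<..T} U Ux V" "continuous_on ({0<..} \<times> {0<..T}) (\<lambda>(x, t). Ux x t)"
    "continuous_on ({0<..} \<times> {0<..T}) (\<lambda>(x, t). V x t)" using assms(1) unfolding forward_solution_def by blast
  obtain Wx Z where W: "heat_solution a {0<..} {0<..T} W Wx Z" "continuous_on ({0<..} \<times> {0<..T}) (\<lambda>(x, t). Wx x t)"
    "continuous_on ({0<..} \<times> {0<..T}) (\<lambda>(x, t). Z x t)" using assms(2) unfolding forward_solution_def by blast
  have "continuous_on ({0..} \<times> {0..T}) (\<lambda>(x, t). U x t)" "continuous_on ({0..} \<times> {0..T}) (\<lambda>(x, t). W x t)"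
    using assms by (simp_all add: forward_solution_def)
  then show ?thesis
    using assms by (intro forward_solutionI[OF c heat_solution_add[OF U(1) W(1)] c[OF U(2) W(2)] c[OF U(3) W(3)]])
      (auto simp: forward_solution_def)
qed

lemma forward_solution_uminus:
  assumes "forward_solution a T g U"
  shows "forward_solution a T (\<lambda>x. - g x) (\<lambda>x t. - U x t)"
proof -
  have c: "continuous_on S (\<lambda>(x, t). - f x t)" if "continuous_on S (\<lambda>(x, t). f x t)"
    for S and f :: "real \<Rightarrow> real \<Rightarrow> real"
    using continuous_on_minus[OF that] by (simp add: case_prod_beta')
  obtain Ux V where U: "heat_solution a {0<..} {0<..T} U Ux V" "continuous_on ({0<..} \<times> {0<..T}) (\<lambda>(x, t). Ux x t)"
    "continuous_on ({0<..} \<times> {0<..T}) (\<lambda>(x, t). V x t)" using assms(1) unfolding forward_solution_def by blast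
  have "continuous_on ({0..} \<times> {0..T}) (\<lambda>(x, t). U x t)" using assms by (simp add: forward_solution_def)
  then show ?thesis
    using assms by (intro forward_solutionI[OF c heat_solution_uminus[OF U(1)] c[OF U(2)] c[OF U(3)]])
      (auto simp: forward_solution_def)
qed

lemma classical_solution_of_forward:
  assumes a: "continuous_on {0<..} a" "\<And>x. x > 0 \<Longrightarrow> a x > 0" "\<And>x. a x = 1/2 * (\<sigma> x)\<^sup>2"
    and U: "forward_solution a T g U"
  shows "classical_solution T \<sigma> g (\<lambda>x t. U x (T - t))"
proof -
  obtain Ux V where H: "heat_solution a {0<..} {0<..T} U Ux V" and cUx: "continuous_on ({0<..} \<times> {0<..T}) (\<lambda>(x, t). Ux x t)"
    and cV: "continuous_on ({0<..} \<times> {0<..T}) (\<lambda>(x, t). V x t)" using U unfolding forward_solution_def by blast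
  have cU: "continuous_on ({0..} \<times> {0..T}) (\<lambda>(x, t). U x t)" using U by (simp add: forward_solution_def)
  have at: "at x within {0<..} = at x" if "x > 0" for x :: real by (rule at_within_open) (use that in auto)
  have tm: "T - t \<in> {0<..T}" if "t \<in> {0..<T}" for t using that by auto
  have cUxx: "continuous_on ({0<..} \<times> {0<..T}) (\<lambda>(x, t). V x t / a x)"
    by (rule continuous_on_divide_coefficient[OF a(1) _ cV]) (use a(2) in auto)
  have cU': "continuous_on ({0<..} \<times> {0<..T}) (\<lambda>(x, t). U x t)" by (rule continuous_on_subset[OF cU]) auto
  have rev: "continuous_on ({0<..} \<times> {0..<T}) (\<lambda>(x, t). f x (T - t))"
    if "continuous_on ({0<..} \<times> {0<..T}) (\<lambda>(x, t). f x t)" for f :: "real \<Rightarrow> real \<Rightarrow> real"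
    by (rule continuous_on_reverse_time[OF that tm])
  have cV': "continuous_on ({0<..} \<times> {0..<T}) (\<lambda>(x, t). - V x (T - t))"
    using continuous_on_minus[OF rev[OF cV]] by (simp add: case_prod_beta')
  have "C21_derivs T (\<lambda>x t. U x (T - t)) (\<lambda>x t. Ux x (T - t)) (\<lambda>x t. V x (T - t) / a x) (\<lambda>x t. - V x (T - t))"
    unfolding C21_derivs_def
  proof (intro conjI allI impI ballI)
    fix x t :: real assume x: "x > 0" and t: "t \<in> {0..<T}"
    show "((\<lambda>y. U y (T - t)) has_real_derivative Ux x (T - t)) (at x)"
      "((\<lambda>y. Ux y (T - t)) has_real_derivative V x (T - t) / a x) (at x)"
      using heat_solutionD(1,2)[OF H _ tm[OF t], of x] x by (simp_all add: at)
    show "((\<lambda>s. U x (T - s)) has_real_derivative - V x (T - t)) (at t within {0..<T})"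
      by (rule derivative_reverse_time[OF heat_solutionD(3)[OF H _ tm[OF t]] tm]) (use x in auto)
  next
    fix f assume "f \<in> {\<lambda>x t. U x (T - t), \<lambda>x t. Ux x (T - t), \<lambda>x t. V x (T - t) / a x, \<lambda>x t. - V x (T - t)}"
    then show "continuous_on ({0<..} \<times> {0..<T}) (\<lambda>(x, t). f x t)"
      using rev[OF cU'] rev[OF cUx] rev[OF cUxx] cV' by auto
  qed
  moreover have "\<forall>x>0. \<forall>t\<in>{0..<T}. - V x (T - t) + 1/2 * (\<sigma> x)\<^sup>2 * (V x (T - t) / a x) = 0"
    unfolding a(3)[symmetric]
  proof (intro allI impI ballI)
    fix x t :: real assume "x > 0"
    then have "a x \<noteq> 0" using a(2)[of x] by simp
    then show "- V x (T - t) + a x * (V x (T - t) / a x) = 0" by simp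
  qed
  moreover have "continuous_on ({0..} \<times> {0..T}) (\<lambda>(x, t). U x (T - t))"
    by (rule continuous_on_reverse_time[OF cU]) auto
  ultimately have "continuous_on ({0..} \<times> {0..T}) (\<lambda>(x, t). U x (T - t)) \<and>
      (\<exists>ux uxx ut. C21_derivs T (\<lambda>x t. U x (T - t)) ux uxx ut \<and> (\<forall>x>0. \<forall>t\<in>{0..<T}. ut x t + 1/2 * (\<sigma> x)\<^sup>2 * uxx x t = 0))"
    by blast
  moreover have "\<forall>t\<in>{0..T}. U 0 (T - t) = g 0" "\<forall>x\<ge>0. U x (T - T) = g x"
    using U by (auto simp: forward_solution_def)
  ultimately show ?thesis unfolding classical_solution_def by blast
qed

lemma forward_solution_of_classical:
  assumes a: "\<And>x. x > 0 \<Longrightarrow> a x > 0" "\<And>x. a x = 1/2 * (\<sigma> x)\<^sup>2" and T: "T > 0"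
    and u: "classical_solution T \<sigma> g u"
  shows "forward_solution a T g (\<lambda>x t. u x (T - t))"
proof -
  obtain ux uxx ut where C: "C21_derivs T u ux uxx ut" and eq: "\<forall>x>0. \<forall>t\<in>{0..<T}. ut x t + 1/2 * (\<sigma> x)\<^sup>2 * uxx x t = 0"
    using u unfolding classical_solution_def by blast
  have tm: "T - t \<in> {0..<T}" if "t \<in> {0<..T}" for t using that by auto
  have eq': "uxx x t = - ut x t / a x" if "x > 0" "t \<in> {0..<T}" for x t
  proof -
    have "ut x t + a x * uxx x t = 0" using eq[rule_format, OF that] unfolding a(2)[symmetric] .
    then have "a x * uxx x t = - ut x t" by linarith
    then show ?thesis using a(1)[OF that(1)] by (simp add: field_simps)
  qed
  have c: "continuous_on ({0<..} \<times> {0..<T}) (\<lambda>(x, t). ux x t)" "continuous_on ({0<..} \<times> {0..<T}) (\<lambda>(x, t). ut x t)"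
    using C unfolding C21_derivs_def by auto
  have H: "heat_solution a {0<..} {0<..T} (\<lambda>x t. u x (T - t)) (\<lambda>x t. ux x (T - t)) (\<lambda>x t. - ut x (T - t))"
  proof (rule heat_solutionI)
    fix x t :: real assume x: "x \<in> {0<..}" and t: "t \<in> {0<..T}"
    have D: "((\<lambda>y. u y (T - t)) has_real_derivative ux x (T - t)) (at x)"
      "((\<lambda>y. ux y (T - t)) has_real_derivative uxx x (T - t)) (at x)"
      "((\<lambda>s. u x s) has_real_derivative ut x (T - t)) (at (T - t) within {0..<T})"
      using C x tm[OF t] unfolding C21_derivs_def by auto
    show "((\<lambda>y. u y (T - t)) has_real_derivative ux x (T - t)) (at x within {0<..})"
      using D(1) by (rule has_field_derivative_at_within)
    show "((\<lambda>y. ux y (T - t)) has_real_derivative - ut x (T - t) / a x) (at x within {0<..})"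
      using D(2) eq'[of x "T - t"] x tm[OF t] by (auto intro: has_field_derivative_at_within)
    show "((\<lambda>s. u x (T - s)) has_real_derivative - ut x (T - t)) (at t within {0<..T})"
      by (rule derivative_reverse_time[OF D(3) tm])
  qed
  have rev: "continuous_on ({0<..} \<times> {0<..T}) (\<lambda>(x, t). f x (T - t))"
    if "continuous_on ({0<..} \<times> {0..<T}) (\<lambda>(x, t). f x t)" for f :: "real \<Rightarrow> real \<Rightarrow> real"
    by (rule continuous_on_reverse_time[OF that tm])
  have cV': "continuous_on ({0<..} \<times> {0<..T}) (\<lambda>(x, t). - ut x (T - t))"
    using continuous_on_minus[OF rev[OF c(2)]] by (simp add: case_prod_beta')
  have "continuous_on ({0..} \<times> {0..T}) (\<lambda>(x, t). u x t)" using u by (simp add: classical_solution_def)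
  then have "continuous_on ({0..} \<times> {0..T}) (\<lambda>(x, t). u x (T - t))"
    by (rule continuous_on_reverse_time) auto
  then show ?thesis
    by (rule forward_solutionI[OF _ H rev[OF c(1)] cV']) (use u T in \<open>auto simp: classical_solution_def\<close>)
qed

lemma (in half_line_problem) forward_solution_exists:
  obtains U where "forward_solution a T g U" "\<And>x t. x > 0 \<Longrightarrow> t \<in> {0..T} \<Longrightarrow> bl x \<le> U x t \<and> U x t \<le> bu x"
  using existence unfolding forward_solution_def by blast

text \<open>On \<open>[0, R]\<close> the linear bound at \<open>x = R\<close> is
  \<open>\<delta> * \<psi> R\<close> with \<open>\<delta> = C * (1 + R) / \<psi> R\<close>.
  Comparison gives \<open>U \<le> \<delta> * exp t * \<psi>\<close>, and by \<open>lim\<close> the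
  factor \<open>\<delta>\<close> tends to 0 as \<open>R\<close> grows.\<close>

lemma forward_solution_zero_le:
  assumes U: "forward_solution a T (\<lambda>x. 0) U" and a: "\<And>x. x > 0 \<Longrightarrow> a x > 0"
    and C: "\<And>x t. x \<ge> 0 \<Longrightarrow> t \<in> {0..T} \<Longrightarrow> U x t \<le> C * (1 + x)" "C \<ge> 0"
    and \<psi>: "\<And>x. (\<psi> has_real_derivative \<psi>' x) (at x)" "\<And>x. (\<psi>' has_real_derivative \<psi>'' x) (at x)"
      "\<And>x. x > 0 \<Longrightarrow> a x * \<psi>'' x \<le> \<psi> x" and \<psi>_pos: "\<And>x. x \<ge> 0 \<Longrightarrow> \<psi> x > 0"
    and lim: "((\<lambda>x. C * (1 + x) / \<psi> x) \<longlongrightarrow> 0) at_top"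
    and x: "x \<ge> 0" and t: "t \<in> {0..T}"
  shows "U x t \<le> 0"
proof -
  obtain Ux V where H: "heat_solution a {0<..} {0<..T} U Ux V" using U unfolding forward_solution_def by blast
  have cU: "continuous_on ({0..} \<times> {0..T}) (\<lambda>(x, t). U x t)" using U by (simp add: forward_solution_def)
  have c\<psi>: "continuous_on S \<psi>" for S by (intro continuous_at_imp_continuous_on ballI, rule DERIV_isCont[OF \<psi>(1)])
  have "U x t \<le> C * (1 + R) / \<psi> R * exp (1 * t) * \<psi> x" if R: "R \<ge> max x 1" for R
  proof -
    have Rp: "R > 0" "R \<ge> x" using R by auto
    have \<delta>: "0 \<le> C * (1 + R) / \<psi> R" using C Rp \<psi>_pos[of R] by simp
    have "U x t \<le> 0 + C * (1 + R) / \<psi> R * exp (1 * t) * \<psi> x"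
    proof (rule comparison_upper[where u=U and \<alpha>=0 and \<beta>=R and a=a and \<psi>=\<psi> and \<psi>'=\<psi>' and \<psi>''=\<psi>'' and b="\<lambda>_. 0" and b'="\<lambda>_. 0" and b''="\<lambda>_. 0", OF _ _ _ _ _ _ _ \<psi>(1,2) _ c\<psi> _ _ \<delta>])
      show "heat_solution a {0<..<R} {0<..T} U Ux V" by (rule heat_solution_subset[OF H]) auto
      show "continuous_on ({0..R} \<times> {0..T}) (\<lambda>(x, t). U x t)" by (rule continuous_on_subset[OF cU]) auto
      show "U 0 t \<le> 0 + C * (1 + R) / \<psi> R * \<psi> 0" if "0 \<le> t" "t \<le> T" for t
      proof -
        have "0 \<le> C * (1 + R) / \<psi> R * \<psi> 0" using \<psi>_pos[of 0] by (intro mult_nonneg_nonneg \<delta>) simp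
        moreover have "U 0 t = 0" using U that by (simp add: forward_solution_def)
        ultimately show ?thesis by linarith
      qed
      show "U R t \<le> 0 + C * (1 + R) / \<psi> R * \<psi> R" if "0 \<le> t" "t \<le> T" for t
        using C(1)[of R t] Rp \<psi>_pos[of R] that by simp
      show "U x 0 \<le> 0 + C * (1 + R) / \<psi> R * \<psi> x" if "0 \<le> x" for x
      proof -
        have "0 \<le> C * (1 + R) / \<psi> R * \<psi> x" using \<psi>_pos[OF that] by (intro mult_nonneg_nonneg \<delta>) simp
        moreover have "U x 0 = 0" using U that by (simp add: forward_solution_def)
        ultimately show ?thesis by linarith
      qed
      show "0 \<le> \<psi> x" if "0 \<le> x" for x using \<psi>_pos[OF that] by simp
      show "x \<in> {0..R}" using x Rp by simp
    qed (use a \<psi> t in auto)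
    then show ?thesis by simp
  qed
  then have ev: "\<forall>\<^sub>F R in at_top. U x t \<le> C * (1 + R) / \<psi> R * exp (1 * t) * \<psi> x"
    by (intro eventually_at_top_linorderI[of "max x 1"])
  have "((\<lambda>R. C * (1 + R) / \<psi> R * exp (1 * t) * \<psi> x) \<longlongrightarrow> 0 * exp (1 * t) * \<psi> x) at_top"
    by (intro tendsto_intros lim)
  then have "((\<lambda>R. C * (1 + R) / \<psi> R * exp (1 * t) * \<psi> x) \<longlongrightarrow> 0) at_top" by simp
  from tendsto_lowerbound[OF this ev] show ?thesis by simp
qed

text \<open>Formally \<open>a\<close> times the second derivative of the integral is the integral of
  \<open>U_t\<close>, that is \<open>U x t - g x\<close>. Derivatives of \<open>U\<close> may blow
  up as time tends to 0, so integration starts at \<open>s n > 0\<close>, where differentiation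
  under the integral is legitimate, and \<open>C2_uniform_limit\<close> lets \<open>s n\<close> tend
  to 0.\<close>

lemma time_integral_second_derivative:
  assumes op: "interval_operator \<alpha> \<beta> a" and \<alpha>: "0 < \<alpha>"
    and U: "forward_solution a T g U" and t: "t \<in> {0<..T}"
  shows "second_derivative_on {\<alpha>..\<beta>} (\<lambda>x. integral {0..t} (U x)) (\<lambda>x. (U x t - g x) / a x)"
proof -
  interpret I: interval_operator \<alpha> \<beta> a by (rule op)
  obtain Ux V where H: "heat_solution a {0<..} {0<..T} U Ux V" and cUx: "continuous_on ({0<..} \<times> {0<..T}) (\<lambda>(x, t). Ux x t)"
    and cV: "continuous_on ({0<..} \<times> {0<..T}) (\<lambda>(x, t). V x t)" using U unfolding forward_solution_def by blast
  have cU: "continuous_on ({0..} \<times> {0..T}) (\<lambda>(x, t). U x t)" and init: "\<And>x. x \<ge> 0 \<Longrightarrow> U x 0 = g x"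
    using U by (simp_all add: forward_solution_def)
  \<comment> \<open>The shift by 2 keeps \<open>s n\<close> strictly below \<open>t\<close>.\<close>
  define s where "s = (\<lambda>n::nat. t / (real n + 2))"
  have s: "0 < s n" "s n < t" "s n \<in> {0..T}" for n
  proof -
    show 1: "0 < s n" using t by (simp add: s_def)
    have "t / (real n + 2) < t / 1" using t by (intro divide_strict_left_mono) auto
    then show 2: "s n < t" by (simp add: s_def)
    show "s n \<in> {0..T}" using 1 2 t by simp
  qed
  have slim: "s \<longlonglongrightarrow> 0" unfolding s_def by real_asymp
  have pos: "x > 0" if "x \<in> {\<alpha>..\<beta>}" for x using that \<alpha> by simp
  have cs: "continuous_on {r..r'} (U x)" if "x \<ge> 0" "0 \<le> r" "r' \<le> T" for x r r'
  proof -
    have "continuous_on {r..r'} (\<lambda>t. (x, t))" by (intro continuous_intros)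
    from continuous_on_compose2[OF cU this] show ?thesis using that by (auto simp: image_subset_iff)
  qed
  have iU: "U x integrable_on {r..r'}" if "x \<ge> 0" "0 \<le> r" "r' \<le> T" for x r r'
    by (rule integrable_continuous_real[OF cs[OF that]])
  have sub: "{\<alpha>..\<beta>} \<times> {s n..t} \<subseteq> {0<..} \<times> {0<..T}" for n using \<alpha> s[of n] t by auto
  have d1: "((\<lambda>x. integral {s n..t} (U x)) has_real_derivative integral {s n..t} (Ux x)) (at x within {\<alpha>..\<beta>})"
    if x: "x \<in> {\<alpha>..\<beta>}" for n x
  proof -
    have "((\<lambda>x. integral (cbox (s n) t) (U x)) has_real_derivative integral (cbox (s n) t) (Ux x)) (at x within {\<alpha>..\<beta>})"
    proof (rule leibniz_rule_field_derivative[OF _ _ _ x])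
      show "((\<lambda>x. U x r) has_real_derivative Ux y r) (at y within {\<alpha>..\<beta>})" if "y \<in> {\<alpha>..\<beta>}" "r \<in> cbox (s n) t" for y r
        by (rule DERIV_subset[OF heat_solutionD(1)[OF H]]) (use that pos s[of n] t \<alpha> in auto)
      show "U y integrable_on cbox (s n) t" if "y \<in> {\<alpha>..\<beta>}" for y
        using iU[of y "s n" t] pos[OF that] s[of n] t by simp
      show "continuous_on ({\<alpha>..\<beta>} \<times> cbox (s n) t) (\<lambda>(x, t). Ux x t)"
        using continuous_on_subset[OF cUx sub] by simp
    qed simp
    then show ?thesis by simp
  qed
  have ca: "continuous_on ({\<alpha>..\<beta>} \<times> {s n..t}) (\<lambda>(x, t). V x t / a x)" for n
    by (rule continuous_on_divide_coefficient[OF I.a_cont I.a_pos continuous_on_subset[OF cV sub]])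
  have d2: "((\<lambda>x. integral {s n..t} (Ux x)) has_real_derivative (U x t - U x (s n)) / a x) (at x within {\<alpha>..\<beta>})"
    if x: "x \<in> {\<alpha>..\<beta>}" for n x
  proof -
    have "((\<lambda>x. integral (cbox (s n) t) (Ux x)) has_real_derivative integral (cbox (s n) t) (\<lambda>r. V x r / a x)) (at x within {\<alpha>..\<beta>})"
    proof (rule leibniz_rule_field_derivative[OF _ _ _ x])
      show "((\<lambda>x. Ux x r) has_real_derivative V y r / a y) (at y within {\<alpha>..\<beta>})" if "y \<in> {\<alpha>..\<beta>}" "r \<in> cbox (s n) t" for y r
        by (rule DERIV_subset[OF heat_solutionD(2)[OF H]]) (use that pos s[of n] t \<alpha> in auto)
      show "Ux y integrable_on cbox (s n) t" if "y \<in> {\<alpha>..\<beta>}" for y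
      proof -
        have "continuous_on {s n..t} (\<lambda>r. (y, r))" by (intro continuous_intros)
        from continuous_on_compose2[OF continuous_on_subset[OF cUx sub[of n]] this]
        have "continuous_on {s n..t} (Ux y)" using that by (auto simp: image_subset_iff)
        then show ?thesis using integrable_continuous_real by simp
      qed
      show "continuous_on ({\<alpha>..\<beta>} \<times> cbox (s n) t) (\<lambda>(x, t). V x t / a x)" using ca by simp
    qed simp
    moreover have I: "((\<lambda>r. V x r / a x) has_integral (U x t / a x - U x (s n) / a x)) {s n..t}"
    proof (rule fundamental_theorem_of_calculus)
      show "s n \<le> t" using s[of n] by simp
      fix r assume r: "r \<in> {s n..t}"
      have "((\<lambda>s. U x s) has_real_derivative V x r) (at r within {s n..t})"
        by (rule DERIV_subset[OF heat_solutionD(3)[OF H]]) (use r x pos s[of n] t in auto)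
      from DERIV_cdivide[OF this, of "a x"]
      show "((\<lambda>r. U x r / a x) has_vector_derivative V x r / a x) (at r within {s n..t})"
        by (simp add: has_real_derivative_iff_has_vector_derivative)
    qed
    ultimately show ?thesis unfolding cbox_interval integral_unique[OF I] diff_divide_distrib by simp
  qed
  obtain B where B: "\<And>x r. x \<in> {\<alpha>..\<beta>} \<Longrightarrow> r \<in> {0..T} \<Longrightarrow> \<bar>U x r\<bar> \<le> B"
  proof -
    have "continuous_on ({\<alpha>..\<beta>} \<times> {0..T}) (\<lambda>(x, t). U x t)" by (rule continuous_on_subset[OF cU]) (use \<alpha> in auto)
    from compact_imp_bounded[OF compact_continuous_image[OF this compact_Times[OF compact_Icc compact_Icc]]]
    obtain B where "\<forall>z\<in>(\<lambda>(x, t). U x t) ` ({\<alpha>..\<beta>} \<times> {0..T}). norm z \<le> B" unfolding bounded_iff by blast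
    then show ?thesis using that[of B] by force
  qed
  have L1: "uniform_limit {\<alpha>..\<beta>} (\<lambda>n x. integral {s n..t} (U x)) (\<lambda>x. integral {0..t} (U x)) sequentially"
  proof (rule uniform_limitI)
    fix e :: real assume e: "e > 0"
    have "(\<lambda>n. (\<bar>B\<bar> + 1) * s n) \<longlonglongrightarrow> (\<bar>B\<bar> + 1) * 0" by (intro tendsto_intros slim)
    then have "\<forall>\<^sub>F n in sequentially. (\<bar>B\<bar> + 1) * s n < e" by (rule order_tendstoD(2)) (use e in simp)
    then show "\<forall>\<^sub>F n in sequentially. \<forall>x\<in>{\<alpha>..\<beta>}. dist (integral {s n..t} (U x)) (integral {0..t} (U x)) < e"
    proof eventually_elim
      case (elim n)
      show ?case
      proof
        fix x assume x: "x \<in> {\<alpha>..\<beta>}"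
        have x0: "x \<ge> 0" using pos[OF x] by simp
        have "integral {0..s n} (U x) + integral {s n..t} (U x) = integral {0..t} (U x)"
          by (rule Henstock_Kurzweil_Integration.integral_combine) (use s[of n] iU[OF x0, of 0 t] t in auto)
        then have "dist (integral {s n..t} (U x)) (integral {0..t} (U x)) = norm (integral {0..s n} (U x))"
          by (simp add: dist_real_def)
        also have "\<dots> \<le> \<bar>B\<bar> * (s n - 0)"
          by (rule integral_bound[OF _ cs[OF x0]]) (use s[of n] t B[OF x] in \<open>auto intro: order_trans[OF _ abs_ge_self]\<close>)
        also have "\<dots> \<le> (\<bar>B\<bar> + 1) * s n" using s[of n] by (simp add: algebra_simps)
        finally show "dist (integral {s n..t} (U x)) (integral {0..t} (U x)) < e" using elim by simp
      qed
    qed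
  qed
  have cU': "continuous_on ({\<alpha>..\<beta>} \<times> {0..T}) (\<lambda>(x, t). U x t)"
    by (rule continuous_on_subset[OF cU]) (use \<alpha> in auto)
  have L0: "uniform_limit {\<alpha>..\<beta>} (\<lambda>n x. U x (s n)) (\<lambda>x. U x 0) sequentially"
    by (rule continuous_on_Times_imp_uniform_limit[OF cU' compact_Icc s(3) _ slim]) (use t in auto)
  have "uniform_limit {\<alpha>..\<beta>} (\<lambda>n x. U x t - U x (s n)) (\<lambda>x. U x t - U x 0) sequentially"
  proof (rule uniform_limitI)
    fix e :: real assume "e > 0"
    from uniform_limitD[OF L0 this]
    show "\<forall>\<^sub>F n in sequentially. \<forall>x\<in>{\<alpha>..\<beta>}. dist (U x t - U x (s n)) (U x t - U x 0) < e"
      by eventually_elim (auto simp: dist_real_def abs_minus_commute)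
  qed
  note L2 = I.uniform_limit_divide[OF this]
  have "second_derivative_on {\<alpha>..\<beta>} (\<lambda>x. integral {0..t} (U x)) (\<lambda>x. (U x t - U x 0) / a x)"
  proof (rule C2_uniform_limit[OF I.ab d1 d2 L1 L2])
    fix h assume h: "\<And>x. x \<in> {\<alpha>..\<beta>} \<Longrightarrow> ((\<lambda>x. integral {0..t} (U x)) has_real_derivative h x) (at x within {\<alpha>..\<beta>})"
      "\<And>x. x \<in> {\<alpha>..\<beta>} \<Longrightarrow> (h has_real_derivative (U x t - U x 0) / a x) (at x within {\<alpha>..\<beta>})"
    show "second_derivative_on {\<alpha>..\<beta>} (\<lambda>x. integral {0..t} (U x)) (\<lambda>x. (U x t - U x 0) / a x)"
      by (rule second_derivative_onI[OF h])
  qed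
  then show ?thesis by (rule second_derivative_on_cong) (use init pos in \<open>auto simp: less_imp_le\<close>)
qed

subsection \<open>The integral condition\<close>

lemma antiderivative_real:
  fixes f :: "real \<Rightarrow> real"
  assumes "continuous_on UNIV f"
  obtains F where "\<And>x. (F has_real_derivative f x) (at x)" "F 0 = 0"
proof -
  have "isCont f x" for x using assms by (simp add: continuous_on_eq_continuous_at)
  then obtain F where F: "\<And>x. (F has_vector_derivative f x) (at x)"
    using einterval_antiderivative[of "-\<infinity>" "\<infinity>" f] by auto
  then have F': "(F has_real_derivative f x) (at x)" for x
    by (simp add: has_real_derivative_iff_has_vector_derivative)
  show ?thesis
  proof
    show "((\<lambda>x. F x - F 0) has_real_derivative f x) (at x)" for x
      using DERIV_diff[OF F'[of x] DERIV_const[of "F 0"]] by simp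
  qed simp
qed

lemma mono_at_top:
  fixes I :: "real \<Rightarrow> real"
  assumes mono: "mono I" and unb: "\<not> bdd_above (range I)"
  shows "filterlim I at_top at_top"
  unfolding filterlim_at_top
proof
  fix Z
  obtain x where "I x > Z" using unb unfolding bdd_above_def by (auto simp: not_le)
  then show "\<forall>\<^sub>F x in at_top. Z \<le> I x"
    by (intro eventually_at_top_linorderI[of x]) (use monoD[OF mono] in \<open>fastforce intro: order_trans less_imp_le\<close>)
qed

lemma mono_bounded_tendsto:
  fixes I :: "real \<Rightarrow> real"
  assumes mono: "mono I" and bdd: "bdd_above (range I)"
  shows "(I \<longlongrightarrow> Sup (range I)) at_top"
proof (rule order_tendstoI)
  fix y assume "y < Sup (range I)"
  then obtain x where x: "y < I x" using less_cSup_iff[OF _ bdd] by auto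
  show "\<forall>\<^sub>F x in at_top. y < I x"
    by (intro eventually_at_top_linorderI[of x]) (use x monoD[OF mono] in \<open>fastforce intro: less_le_trans\<close>)
next
  fix y assume y: "Sup (range I) < y"
  have "I x < y" for x using cSup_upper[OF _ bdd, of "I x"] y by auto
  then show "\<forall>\<^sub>F x in at_top. I x < y" by simp
qed

lemma locally_Holder_on_continuous:
  assumes H: "locally_Holder_on {0..} \<alpha> f" and \<alpha>: "\<alpha> > 0"
  shows "continuous_on {0<..} f"
proof (rule continuous_at_imp_continuous_on, rule ballI)
  fix x :: real assume "x \<in> {0<..}"
  then have x: "x > 0" by simp
  define K where "K = {x / 2..2 * x}"
  have "compact K \<and> K \<subseteq> {0..}" using x by (auto simp: K_def)
  from H[unfolded locally_Holder_on_def, rule_format, OF this]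
  obtain L where "\<forall>y\<in>K. \<forall>z\<in>K. \<bar>f y - f z\<bar> \<le> L * \<bar>y - z\<bar> powr \<alpha>" by auto
  then have L: "\<bar>f y - f z\<bar> \<le> L * \<bar>y - z\<bar> powr \<alpha>" if "y \<in> K" "z \<in> K" for y z using that by simp
  have "(\<lambda>y. f y - f x) \<midarrow>x\<rightarrow> 0"
  proof (rule Lim_null_comparison)
    have "\<forall>\<^sub>F y in at x. y \<in> {x / 2<..<2 * x}"
      by (rule eventually_at_in_open') (use x in auto)
    then show "\<forall>\<^sub>F y in at x. norm (f y - f x) \<le> L * \<bar>y - x\<bar> powr \<alpha>"
      by eventually_elim (use x in \<open>auto intro!: L simp: K_def\<close>)
    have "((\<lambda>y. \<bar>y - x\<bar> powr \<alpha>) \<longlongrightarrow> 0) (at x)"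
      by (rule tendsto_zero_powrI[where b=\<alpha>]) (use \<alpha> in \<open>auto intro!: tendsto_eq_intros\<close>)
    from tendsto_mult[OF tendsto_const[of L] this]
    show "((\<lambda>y. L * \<bar>y - x\<bar> powr \<alpha>) \<longlongrightarrow> 0) (at x)" by simp
  qed
  then show "isCont f x" unfolding isCont_def by (rule LIM_zero_cancel)
qed

text \<open>\<open>p\<close> is the density \<open>(x - 1)\<^sup>+ / \<sigma>\<^sup>2\<close>, truncated so that the degeneracy of \<open>\<sigma>\<close> at \<open>0\<close> plays no role;
  the integral in the theorem diverges iff \<open>I = \<integral> p\<close> is unbounded.\<close>

locale diffusion =
  fixes \<sigma> a p I J :: "real \<Rightarrow> real"
  assumes \<sigma>_cont: "continuous_on {0<..} \<sigma>" and \<sigma>_nz: "\<And>x. x > 0 \<Longrightarrow> \<sigma> x \<noteq> 0" and a_def: "\<And>x. a x = 1/2 * (\<sigma> x)\<^sup>2"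
    and p_def: "\<And>x. p x = (max 1 x - 1) / (\<sigma> (max 1 x))\<^sup>2"
    and I: "\<And>x. (I has_real_derivative p x) (at x)" "I 0 = 0"
    and J: "\<And>x. (J has_real_derivative I x) (at x)" "J 0 = 0"
begin

lemma a_cont: "continuous_on {0<..} a"
  unfolding a_def by (intro continuous_intros \<sigma>_cont)

lemma a_pos: "x > 0 \<Longrightarrow> a x > 0"
  using \<sigma>_nz[of x] by (simp add: a_def)

lemma p_nonneg: "p x \<ge> 0"
  by (simp add: p_def)

lemma a_p: "x > 0 \<Longrightarrow> a x * (2 * p x) = max 1 x - 1"
  using \<sigma>_nz[of x] by (cases "x \<le> 1") (auto simp: a_def p_def max_def)

lemma I_mono: "mono I"
  by (rule monoI) (use I(1) p_nonneg DERIV_nonneg_imp_nondecreasing in blast)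

lemma J_mono: assumes "0 \<le> x" "x \<le> y" shows "J x \<le> J y"
proof (rule DERIV_nonneg_imp_nondecreasing[OF assms(2)])
  fix z assume "x \<le> z"
  then show "\<exists>d. (J has_real_derivative d) (at z) \<and> 0 \<le> d"
    using J(1)[of z] monoD[OF I_mono, of 0 z] I(2) assms by auto
qed

lemma J_nonneg: "x \<ge> 0 \<Longrightarrow> J x \<ge> 0"
  using J_mono[of 0 x] J(2) by simp

text \<open>For \<open>x \<ge> 2\<close> the integrand lies between \<open>p\<close> and
  \<open>2 * p\<close>, because \<open>x - 1 \<le> x \<le> 2 * (x - 1)\<close>, and
  \<open>[1, 2]\<close> contributes a finite amount by continuity.\<close>

lemma integral_infinite_iff:
  "(\<integral>\<^sup>+x\<in>{1..}. ennreal (x / (\<sigma> x)\<^sup>2) \<partial>lborel) = \<infinity> \<longleftrightarrow> \<not> bdd_above (range I)"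
proof
  have p_meas: "p \<in> borel_measurable borel"
  proof (rule borel_measurable_continuous_onI)
    show "continuous_on UNIV p" unfolding p_def
    proof (intro continuous_intros continuous_on_compose2[OF \<sigma>_cont])
      show "\<forall>x\<in>UNIV. (\<sigma> (max 1 x))\<^sup>2 \<noteq> 0" using \<sigma>_nz by auto
    qed auto
  qed
  show "\<not> bdd_above (range I)" if inf: "(\<integral>\<^sup>+x\<in>{1..}. ennreal (x / (\<sigma> x)\<^sup>2) \<partial>lborel) = \<infinity>"
  proof
    assume bdd: "bdd_above (range I)"
    have "continuous_on {1..2} (\<lambda>x. x / (\<sigma> x)\<^sup>2)"
      by (intro continuous_intros continuous_on_subset[OF \<sigma>_cont]) (use \<sigma>_nz in auto)
    then obtain M where M: "\<And>x. x \<in> {1..2} \<Longrightarrow> x / (\<sigma> x)\<^sup>2 \<le> M"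
      using continuous_attains_sup[of "{1..2::real}" "\<lambda>x. x / (\<sigma> x)\<^sup>2"] by fastforce
    have le: "ennreal (x / (\<sigma> x)\<^sup>2) * indicator {1..} x \<le> ennreal M * indicator {1..2} x + ennreal (2 * p x) * indicator {1..} x" for x
    proof -
      consider "x < 1" | "1 \<le> x" "x \<le> 2" | "x > 2" by linarith
      then show ?thesis
      proof cases
        case 2
        then show ?thesis using M[of x] by (auto simp: indicator_def intro!: order_trans[OF ennreal_leI add_increasing2])
      next
        case 3
        then have "x / (\<sigma> x)\<^sup>2 \<le> (2 * (x - 1)) / (\<sigma> x)\<^sup>2" by (intro divide_right_mono) auto
        also have "\<dots> = 2 * p x" using 3 by (simp add: p_def max_def)
        finally show ?thesis using 3 by (simp add: ennreal_leI)
      qed (auto simp: indicator_def)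
    qed
    have m2: "(\<lambda>x. 2 * p x) \<in> borel_measurable borel" using p_meas by simp
    have "(\<integral>\<^sup>+x\<in>{1..}. ennreal (x / (\<sigma> x)\<^sup>2) \<partial>lborel) \<le> (\<integral>\<^sup>+x. ennreal M * indicator {1..2} x + ennreal (2 * p x) * indicator {1..} x \<partial>lborel)"
      by (rule nn_integral_mono) (use le in auto)
    also have "\<dots> = (\<integral>\<^sup>+x. ennreal M * indicator {1..2::real} x \<partial>lborel) + (\<integral>\<^sup>+x. ennreal (2 * p x) * indicator {1..} x \<partial>lborel)"
      by (rule nn_integral_add) (use m2 in auto)
    also have "(\<integral>\<^sup>+x. ennreal M * indicator {1..2::real} x \<partial>lborel) = ennreal M * emeasure lborel {1..2::real}"
      by (rule nn_integral_cmult_indicator) auto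
    also have "(\<integral>\<^sup>+x. ennreal (2 * p x) * indicator {1..} x \<partial>lborel) = ennreal (2 * Sup (range I) - 2 * I 1)"
    proof (rule nn_integral_FTC_atLeast[OF m2])
      show "((\<lambda>x. 2 * I x) has_real_derivative 2 * p x) (at x)" for x by (intro DERIV_cmult I)
      show "((\<lambda>x. 2 * I x) \<longlongrightarrow> 2 * Sup (range I)) at_top"
        by (intro tendsto_intros mono_bounded_tendsto I_mono bdd)
    qed (use p_nonneg in auto)
    also have "ennreal M * emeasure lborel {1..2::real} + ennreal (2 * Sup (range I) - 2 * I 1) < \<infinity>"
      by (simp add: ennreal_mult_less_top)
    finally show False using inf by simp
  qed
  show "(\<integral>\<^sup>+x\<in>{1..}. ennreal (x / (\<sigma> x)\<^sup>2) \<partial>lborel) = \<infinity>" if unb: "\<not> bdd_above (range I)"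
  proof (rule ccontr)
    assume "(\<integral>\<^sup>+x\<in>{1..}. ennreal (x / (\<sigma> x)\<^sup>2) \<partial>lborel) \<noteq> \<infinity>"
    then obtain r where r: "(\<integral>\<^sup>+x\<in>{1..}. ennreal (x / (\<sigma> x)\<^sup>2) \<partial>lborel) = ennreal r" "r \<ge> 0"
      by (cases "(\<integral>\<^sup>+x\<in>{1..}. ennreal (x / (\<sigma> x)\<^sup>2) \<partial>lborel)") auto
    have "I b - I 1 \<le> r" if b: "b \<ge> 1" for b
    proof -
      have "ennreal (I b - I 1) = (\<integral>\<^sup>+x. ennreal (p x) * indicator {1..b} x \<partial>lborel)"
        by (rule nn_integral_FTC_Icc[symmetric]) (use p_meas I(1) p_nonneg b in \<open>auto intro: has_field_derivative_at_within\<close>)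
      also have "\<dots> \<le> (\<integral>\<^sup>+x\<in>{1..}. ennreal (x / (\<sigma> x)\<^sup>2) \<partial>lborel)"
      proof (rule nn_integral_mono)
        fix x :: real
        show "ennreal (p x) * indicator {1..b} x \<le> ennreal (x / (\<sigma> x)\<^sup>2) * indicator {1..} x"
        proof (cases "x \<in> {1..b}")
          case True
          then have "p x \<le> x / (\<sigma> x)\<^sup>2" by (auto simp: p_def max_def intro!: divide_right_mono)
          then show ?thesis using True by (simp add: ennreal_leI)
        qed simp
      qed
      finally show ?thesis using r by (simp add: ennreal_le_iff)
    qed
    then have "I x \<le> r + I 1" for x
      using monoD[OF I_mono, of x "max x 1"] by (smt (verit) max.cobounded1 max.cobounded2)
    then show False using unb unfolding bdd_above_def by blast
  qed
qed

text \<open>By l'Hopital's rule the limit is that of \<open>C / (1 + I x)\<close>: unboundedness of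
  \<open>I\<close> is what makes \<open>\<psi> = 1 + x + J x\<close> grow faster than
  linearly.\<close>

lemma ratio_at_top:
  assumes "\<not> bdd_above (range I)"
  shows "((\<lambda>x. C * (1 + x) / (1 + x + J x)) \<longlongrightarrow> 0) at_top"
proof (rule lhospital_at_top_at_top[where f'="\<lambda>_. C" and g'="\<lambda>x. 1 + I x"])
  have I_lim: "filterlim I at_top at_top" by (rule mono_at_top[OF I_mono assms])
  show "filterlim (\<lambda>x. 1 + x + J x) at_top at_top"
  proof (rule filterlim_at_top_mono)
    show "filterlim (\<lambda>x::real. x) at_top at_top" by (rule filterlim_ident)
    show "\<forall>\<^sub>F x in at_top. x \<le> 1 + x + J x"
      by (rule eventually_at_top_linorderI[of 0]) (use J_nonneg in force)
  qed
  show "\<forall>\<^sub>F x in at_top. 1 + I x \<noteq> 0"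
    using filterlim_at_top_dense[THEN iffD1, OF I_lim, rule_format, of 0] by eventually_elim auto
  show "\<forall>\<^sub>F x in at_top. ((\<lambda>x. C * (1 + x)) has_real_derivative C) (at x)"
    by (intro always_eventually allI) (auto intro!: derivative_eq_intros)
  show "\<forall>\<^sub>F x in at_top. ((\<lambda>x. 1 + x + J x) has_real_derivative 1 + I x) (at x)"
    by (intro always_eventually allI) (auto intro!: derivative_eq_intros J)
  have "filterlim (\<lambda>x. 1 + I x) at_top at_top"
    by (rule filterlim_tendsto_add_at_top[OF tendsto_const I_lim])
  then show "((\<lambda>x. C / (1 + I x)) \<longlongrightarrow> 0) at_top"
    by (intro tendsto_divide_0[OF tendsto_const] filterlim_at_top_imp_at_infinity)
qed

lemma psi_derivs:
  "((\<lambda>x. 1 + x + J x) has_real_derivative 1 + I x) (at x)" "((\<lambda>x. 1 + I x) has_real_derivative p x) (at x)"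
  by (auto intro!: derivative_eq_intros I J)

text \<open>\<open>a * p\<close> is only \<open>(x - 1)\<^sup>+ / 2\<close>, which the linear part
  of \<open>\<psi>\<close> dominates, so \<open>\<kappa> = 1\<close> will do. The constant 1 keeps
  \<open>\<psi>\<close> positive at \<open>0\<close>.\<close>

lemma psi_super: "x > 0 \<Longrightarrow> a x * p x \<le> 1 + x + J x"
proof -
  assume x: "x > 0"
  have "a x * p x = (max 1 x - 1) / 2" using a_p[OF x] by simp
  also have "\<dots> \<le> x" using x by (simp add: max_def)
  also have "x \<le> 1 + x + J x" using J_nonneg[of x] x by simp
  finally show ?thesis .
qed

lemma unique_solution:
  assumes unb: "\<not> bdd_above (range I)" and T: "T > 0"
    and g: "\<And>x. x \<ge> 0 \<Longrightarrow> g x \<ge> 0" "continuous_on {0..} g" "\<And>x. x \<ge> 0 \<Longrightarrow> g x \<le> C * (1 + x)" and C: "C > 0"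
  shows "has_unique_linear_growth_solution T \<sigma> g"
proof -
  \<comment> \<open>The barriers are affine, hence stationary solutions. Their gap is linear in
    \<open>x\<close> and therefore of smaller order than \<open>\<psi>\<close>.\<close>
  interpret half_line_problem a g T 1 "\<lambda>x. - C * (1 + x)" "\<lambda>_. - C" "\<lambda>_. 0" "\<lambda>x. C * (1 + x)" "\<lambda>_. C" "\<lambda>_. 0"
    "\<lambda>x. 1 + x + J x" "\<lambda>x. 1 + I x" p
  proof
    show "\<exists>C. \<forall>x\<ge>0. \<bar>g x\<bar> \<le> C * (1 + x)" using g by (intro exI[of _ C]) auto
    show "- C * (1 + x) \<le> g x" if "x > 0" for x
    proof -
      have "0 \<le> C * (1 + x)" using C that by simp
      then show ?thesis using g(1)[of x] that by simp
    qed
    show "1 + x + J x > 0" if "x > 0" for x using J_nonneg[of x] that by simp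
    have "((\<lambda>x. (2 * C) * (1 + x) / (1 + x + J x)) \<longlongrightarrow> 0) at_top" by (rule ratio_at_top[OF unb])
    then show "((\<lambda>x. (C * (1 + x) - - C * (1 + x)) / (1 + x + J x)) \<longlongrightarrow> 0) at_top" by (simp add: algebra_simps)
  qed (use T a_cont a_pos g psi_derivs psi_super in \<open>auto intro!: derivative_eq_intros\<close>)
  obtain U where U: "forward_solution a T g U"
    "\<And>x t. x > 0 \<Longrightarrow> t \<in> {0..T} \<Longrightarrow> - C * (1 + x) \<le> U x t \<and> U x t \<le> C * (1 + x)"
    using forward_solution_exists by blast
  have Ub: "\<bar>U x t\<bar> \<le> C * (1 + x)" if "x \<ge> 0" "t \<in> {0..T}" for x t
  proof (cases "x = 0")
    case True
    then show ?thesis using U(1) g(1)[of 0] g(3)[of 0] that by (simp add: forward_solution_def)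
  next
    case False
    then show ?thesis using U(2)[of x t] that by (simp add: abs_le_iff)
  qed
  let ?u = "\<lambda>x t. U x (T - t)"
  have "classical_solution T \<sigma> g ?u"
    by (rule classical_solution_of_forward[OF a_cont a_pos a_def U(1)])
  moreover have "linear_growth T ?u"
    unfolding linear_growth_def using C Ub by (intro exI[of _ C]) auto
  moreover have "v x t = ?u x t" if v: "classical_solution T \<sigma> g v" "linear_growth T v" and x: "x \<ge> 0" and t: "t \<in> {0..T}" for v x t
  proof -
    let ?V = "\<lambda>x t. v x (T - t)"
    have V: "forward_solution a T g ?V" by (rule forward_solution_of_classical[OF a_pos a_def T v(1)])
    obtain C' where C': "C' > 0" "\<And>x t. x \<ge> 0 \<Longrightarrow> t \<in> {0..T} \<Longrightarrow> \<bar>v x t\<bar> \<le> C' * (1 + x)"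
      using v(2) unfolding linear_growth_def by blast
    have b: "\<bar>U x t - ?V x t\<bar> \<le> (C + C') * (1 + x)" if "x \<ge> 0" "t \<in> {0..T}" for x t
      using Ub[OF that] C'(2)[OF that(1), of "T - t"] that by (simp add: algebra_simps)
    \<comment> \<open>Applied below to the difference of two solutions and to its negative, both of
      which have zero data and linear growth.\<close>
    have le: "D x (T - t) \<le> 0" if D: "forward_solution a T (\<lambda>x. 0) D"
      and Db: "\<And>x t. x \<ge> 0 \<Longrightarrow> t \<in> {0..T} \<Longrightarrow> D x t \<le> (C + C') * (1 + x)" for D
      by (rule forward_solution_zero_le[OF D a_pos Db _ psi_derivs psi_super _ ratio_at_top[OF unb] x])
        (use C C' J_nonneg t in \<open>auto intro: add_pos_nonneg\<close>)
    have "forward_solution a T (\<lambda>x. g x + - g x) (\<lambda>x t. U x t + - ?V x t)"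
      by (rule forward_solution_add[OF U(1) forward_solution_uminus[OF V]])
    then have D1: "forward_solution a T (\<lambda>x. 0) (\<lambda>x t. U x t - ?V x t)" by simp
    have D2: "forward_solution a T (\<lambda>x. 0) (\<lambda>x t. - (U x t - ?V x t))" using forward_solution_uminus[OF D1] by simp
    have "U x (T - t) - v x t \<le> 0" using le[OF D1] b by (force simp: abs_le_iff)
    moreover have "- (U x (T - t) - v x t) \<le> 0" using le[OF D2] b by (force simp: abs_le_iff)
    ultimately show ?thesis by simp
  qed
  ultimately show ?thesis unfolding has_unique_linear_growth_solution_def by blast
qed

lemma nonzero_solution:
  assumes bdd: "bdd_above (range I)" and T: "T > 0"
  obtains W K x where "forward_solution a T (\<lambda>x. 0) W" "\<And>x t. x \<ge> 0 \<Longrightarrow> t \<in> {0..T} \<Longrightarrow> \<bar>W x t\<bar> \<le> K * (1 + x)" "K \<ge> 0"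
    "x \<ge> 0" "W x T \<noteq> 0"
proof -
  define c where "c = Sup (range I)"
  have Ic: "I x \<le> c" for x unfolding c_def by (rule cSup_upper[OF _ bdd]) auto
  have c0: "c \<ge> 0" using Ic[of 0] I(2) by simp
  define \<phi> where "\<phi> = (\<lambda>x::real. max 1 x - 1)"
  \<comment> \<open>\<open>c\<close> is the limit of \<open>I\<close>, so
    \<open>\<theta>' = 2 * (I - c)\<close> increases to 0. The factor 2 comes from
    \<open>a = \<sigma>\<^sup>2 / 2\<close> and gives
    \<open>a * \<theta>'' = \<phi>\<close>.\<close>
  define \<theta> where "\<theta> = (\<lambda>x. 2 * (J x - c * x))"
  have \<theta>': "(\<theta> has_real_derivative 2 * (I x - c)) (at x)" for x
    unfolding \<theta>_def by (auto intro!: derivative_eq_intros J)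
  have \<theta>'': "((\<lambda>x. 2 * (I x - c)) has_real_derivative 2 * p x) (at x)" for x
    by (auto intro!: derivative_eq_intros I)
  have \<theta>_cont: "continuous_on S \<theta>" for S by (intro continuous_at_imp_continuous_on ballI, rule DERIV_isCont[OF \<theta>'])
  have \<theta>0: "\<theta> 0 = 0" by (simp add: \<theta>_def J)
  have \<theta>_le: "\<theta> x \<le> 0" if "x \<ge> 0" for x
  proof -
    have "\<theta> x \<le> \<theta> 0"
      by (rule DERIV_nonpos_imp_nonincreasing[OF that]) (use \<theta>' Ic in \<open>force intro: exI[of _ "2 * (I _ - c)"]\<close>)
    then show ?thesis by (simp add: \<theta>0)
  qed
  have \<theta>_ge: "- (2 * c * x) \<le> \<theta> x" if "x \<ge> 0" for x using J_nonneg[OF that] by (simp add: \<theta>_def)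
  have \<theta>_lim: "((\<lambda>x. - \<theta> x / x) \<longlongrightarrow> 0) at_top"
  proof (rule lhospital_at_top_at_top[where f'="\<lambda>x. - (2 * (I x - c))" and g'="\<lambda>_. 1"])
    show "\<forall>\<^sub>F x in at_top. ((\<lambda>x. - \<theta> x) has_real_derivative - (2 * (I x - c))) (at x)"
      by (intro always_eventually allI DERIV_minus \<theta>')
    have "((\<lambda>x. - (2 * (I x - c)) / 1) \<longlongrightarrow> - (2 * (c - c)) / 1) at_top"
      unfolding c_def by (intro tendsto_intros mono_bounded_tendsto I_mono bdd) simp
    then show "((\<lambda>x. - (2 * (I x - c)) / 1) \<longlongrightarrow> 0) at_top" by simp
  qed (auto intro!: always_eventually derivative_eq_intros filterlim_ident)
  have inv_lim: "((\<lambda>x::real. 1 / x) \<longlongrightarrow> 0) at_top" by real_asymp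
  have shift: "((\<lambda>x. x - 1) has_real_derivative 1) (at x)" for x :: real by (auto intro!: derivative_eq_intros)
  \<comment> \<open>\<open>\<phi>\<close> lies between the affine solutions \<open>x - 1\<close> and
    \<open>x\<close>. Their gap 1 is \<open>o(x)\<close>, so \<open>\<psi> = x\<close> with
    \<open>\<kappa> = 0\<close> suffices.\<close>
  interpret P1: half_line_problem a \<phi> T 0 "\<lambda>x. x - 1" "\<lambda>_. 1" "\<lambda>_. 0" "\<lambda>x. x" "\<lambda>_. 1" "\<lambda>_. 0" "\<lambda>x. x" "\<lambda>_. 1" "\<lambda>_. 0"
  proof
    show "continuous_on {0..} \<phi>" unfolding \<phi>_def by (intro continuous_intros)
    show "\<exists>C. \<forall>x\<ge>0. \<bar>\<phi> x\<bar> \<le> C * (1 + x)" by (intro exI[of _ 1]) (auto simp: \<phi>_def)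
    show "((\<lambda>x::real. (x - (x - 1)) / x) \<longlongrightarrow> 0) at_top" using inv_lim by simp
  qed (simp_all add: T a_cont a_pos \<phi>_def shift)
  \<comment> \<open>\<open>\<theta>\<close> is convex and nonpositive on \<open>x > 0\<close>, so it
    is its own lower barrier, with upper barrier 0; the gap \<open>- \<theta>\<close> is
    \<open>o(x)\<close> by \<open>\<theta>_lim\<close>.\<close>
  interpret P2: half_line_problem a \<theta> T 0 \<theta> "\<lambda>x. 2 * (I x - c)" "\<lambda>x. 2 * p x" "\<lambda>x. 0" "\<lambda>_. 0" "\<lambda>_. 0" "\<lambda>x. x" "\<lambda>_. 1" "\<lambda>_. 0"
  proof
    show "\<exists>C. \<forall>x\<ge>0. \<bar>\<theta> x\<bar> \<le> C * (1 + x)"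
    proof (intro exI[of _ "2 * c"] allI impI)
      fix x :: real assume "x \<ge> 0"
      then have "\<bar>\<theta> x\<bar> \<le> 2 * c * x" using \<theta>_le[of x] \<theta>_ge[of x] by linarith
      also have "\<dots> \<le> 2 * c * (1 + x)" using c0 by (intro mult_left_mono) auto
      finally show "\<bar>\<theta> x\<bar> \<le> 2 * c * (1 + x)" .
    qed
    show "(\<theta> has_real_derivative 2 * (I x - c)) (at x)" "((\<lambda>x. 2 * (I x - c)) has_real_derivative 2 * p x) (at x)" for x
      by (rule \<theta>' \<theta>'')+
    show "((\<lambda>x. (0 - \<theta> x) / x) \<longlongrightarrow> 0) at_top" using \<theta>_lim by simp
  qed (simp_all add: T a_cont a_pos \<theta>_cont \<theta>_le p_nonneg less_imp_le)
  obtain U1 where U1: "forward_solution a T \<phi> U1" "\<And>x t. x > 0 \<Longrightarrow> t \<in> {0..T} \<Longrightarrow> x - 1 \<le> U1 x t \<and> U1 x t \<le> x"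
    using P1.forward_solution_exists by blast
  obtain U2 where U2: "forward_solution a T \<theta> U2" "\<And>x t. x > 0 \<Longrightarrow> t \<in> {0..T} \<Longrightarrow> \<theta> x \<le> U2 x t \<and> U2 x t \<le> 0"
    using P2.forward_solution_exists by blast
  obtain U2x V2 where H2: "heat_solution a {0<..} {0<..T} U2 U2x V2" and cV2: "continuous_on ({0<..} \<times> {0<..T}) (\<lambda>(x, t). V2 x t)"
    using U2(1) unfolding forward_solution_def by blast
  have cU1: "continuous_on ({0..} \<times> {0..T}) (\<lambda>(x, t). U1 x t)" and cU2: "continuous_on ({0..} \<times> {0..T}) (\<lambda>(x, t). U2 x t)"
    using U1(1) U2(1) by (simp_all add: forward_solution_def)
  have U1b: "\<bar>U1 x t\<bar> \<le> 1 + x" if "x \<ge> 0" "t \<in> {0..T}" for x t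
  proof (cases "x = 0")
    case True
    then show ?thesis using U1(1) that by (simp add: forward_solution_def \<phi>_def)
  next
    case False
    then show ?thesis using U1(2)[of x t] that by (simp add: abs_le_iff)
  qed
  have U2b: "\<theta> x \<le> U2 x t \<and> U2 x t \<le> 0" if "x \<ge> 0" "t \<in> {0..T}" for x t
    using U2 that by (cases "x = 0") (auto simp: forward_solution_def \<theta>0)
  have cs: "continuous_on {0..T} (U1 x)" if "x \<ge> 0" for x
  proof -
    have "continuous_on {0..T} (\<lambda>t. (x, t))" by (intro continuous_intros)
    from continuous_on_compose2[OF cU1 this] show ?thesis using that by (auto simp: image_subset_iff)
  qed
  define Y where "Y = (\<lambda>x t. integral {0..t} (U1 x))"
  have Yt: "((\<lambda>s. Y x s) has_real_derivative U1 x t) (at t within {0..T})" if "x \<ge> 0" "t \<in> {0..T}" for x t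
    unfolding Y_def by (rule integral_has_real_derivative[OF cs[OF that(1)] that(2)])
  have YLip: "\<bar>Y x s - Y x t\<bar> \<le> (1 + x) * \<bar>s - t\<bar>" if "x \<ge> 0" "s \<in> {0..T}" "t \<in> {0..T}" for x s t
    using field_differentiable_bound[of "{0..T}" "\<lambda>s. Y x s" "U1 x" "1 + x" s t] Yt U1b that by auto
  have Y0: "Y x 0 = 0" for x by (simp add: Y_def)
  define W where "W = (\<lambda>x t. Y x t + \<theta> x - U2 x t)"
  have cY: "continuous_on ({0..} \<times> {0..T}) (\<lambda>(x, t). Y x t)"
  proof (rule continuous_on_nonneg_Times, rule continuous_on_Times_Lipschitz)
    fix R t :: real assume R: "R > 0" and t: "t \<in> {0..T}"
    have "continuous_on ({0..R} \<times> cbox 0 t) (\<lambda>(x, t). U1 x t)" by (rule continuous_on_subset[OF cU1]) (use t in auto)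
    from integral_continuous_on_param[OF this] show "continuous_on {0..R} (\<lambda>x. Y x t)" by (simp add: Y_def)
    have "\<bar>Y x s - Y x t\<bar> \<le> (1 + R) * (\<bar>s - t\<bar> + (s - t)\<^sup>2)" if "s \<in> {0..T}" "x \<in> {0..R}" for s x
    proof -
      have "\<bar>Y x s - Y x t\<bar> \<le> (1 + x) * \<bar>s - t\<bar>" using YLip that t by auto
      also have "\<dots> \<le> (1 + R) * (\<bar>s - t\<bar> + (s - t)\<^sup>2)" using that by (intro mult_mono) auto
      finally show ?thesis .
    qed
    then show "\<exists>K. \<forall>s\<in>{0..T}. \<forall>x\<in>{0..R}. \<bar>Y x s - Y x t\<bar> \<le> K * (\<bar>s - t\<bar> + (s - t)\<^sup>2)" by blast
  qed
  have c\<theta>: "continuous_on ({0..} \<times> {0..T}) (\<lambda>z. \<theta> (fst z))"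
    by (rule continuous_on_compose2[OF \<theta>_cont[of UNIV] continuous_on_fst[OF continuous_on_id]]) auto
  have cW: "continuous_on ({0..} \<times> {0..T}) (\<lambda>(x, t). W x t)"
    using continuous_on_diff[OF continuous_on_add[OF cY c\<theta>] cU2] by (simp add: W_def case_prod_beta')
  have space: "\<exists>\<alpha> \<beta> g'. \<alpha> < x \<and> x < \<beta> \<and> (\<forall>y\<in>{\<alpha>..\<beta>}. ((\<lambda>x. W x t) has_real_derivative g' y) (at y within {\<alpha>..\<beta>}) \<and>
        (g' has_real_derivative (U1 y t - V2 y t) / a y) (at y within {\<alpha>..\<beta>}))" if x: "x > 0" and t: "t \<in> {0<..T}" for x t
  proof -
    define \<alpha> \<beta> where "\<alpha> = x / 2" and "\<beta> = 2 * x"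
    have ab: "0 < \<alpha>" "\<alpha> < x" "x < \<beta>" "\<alpha> < \<beta>" using x by (auto simp: \<alpha>_def \<beta>_def)
    have 1: "second_derivative_on {\<alpha>..\<beta>} (\<lambda>x. Y x t) (\<lambda>x. (U1 x t - \<phi> x) / a x)"
      unfolding Y_def by (rule time_integral_second_derivative[OF P1.op[OF ab(1,4)] ab(1) U1(1) t])
    have 2: "second_derivative_on {\<alpha>..\<beta>} \<theta> (\<lambda>x. 2 * p x)"
      by (rule second_derivative_onI[OF has_field_derivative_at_within[OF \<theta>'] has_field_derivative_at_within[OF \<theta>'']])
    have 3: "second_derivative_on {\<alpha>..\<beta>} (\<lambda>x. U2 x t) (\<lambda>x. V2 x t / a x)"
    proof (rule second_derivative_onI)
      have "heat_solution a {\<alpha>..\<beta>} {0<..T} U2 U2x V2" by (rule heat_solution_subset[OF H2]) (use ab in auto)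
      from heat_solutionD(1,2)[OF this _ t]
      show "((\<lambda>x. U2 x t) has_real_derivative U2x y t) (at y within {\<alpha>..\<beta>})"
        "((\<lambda>x. U2x x t) has_real_derivative V2 y t / a y) (at y within {\<alpha>..\<beta>})" if "y \<in> {\<alpha>..\<beta>}" for y
        using that by blast+
    qed
    have "second_derivative_on {\<alpha>..\<beta>} (\<lambda>x. 1 * (1 * Y x t + 1 * \<theta> x) + (-1) * U2 x t)
        (\<lambda>x. 1 * (1 * ((U1 x t - \<phi> x) / a x) + 1 * (2 * p x)) + (-1) * (V2 x t / a x))"
      by (intro second_derivative_on_lincomb 1 2 3)
    \<comment> \<open>The data cancel because \<open>2 * p = \<phi> / a\<close>. What remains is
      \<open>(U1 - V2) / a\<close>, and \<open>U1 - V2\<close> is also the time derivative of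
      \<open>W\<close>.\<close>
    moreover have "1 * (1 * ((U1 y t - \<phi> y) / a y) + 1 * (2 * p y)) + (-1) * (V2 y t / a y) = (U1 y t - V2 y t) / a y"
      if "y \<in> {\<alpha>..\<beta>}" for y
    proof -
      have y: "y > 0" using that ab by simp
      have "2 * p y = \<phi> y / a y" using a_p[OF y] a_pos[OF y] by (simp add: \<phi>_def field_simps)
      then show ?thesis by (simp add: diff_divide_distrib)
    qed
    ultimately have "second_derivative_on {\<alpha>..\<beta>} (\<lambda>x. 1 * (1 * Y x t + 1 * \<theta> x) + (-1) * U2 x t) (\<lambda>y. (U1 y t - V2 y t) / a y)"
      by (rule second_derivative_on_cong)
    then have "second_derivative_on {\<alpha>..\<beta>} (\<lambda>x. W x t) (\<lambda>y. (U1 y t - V2 y t) / a y)" by (simp add: W_def)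
    then show ?thesis using ab(2,3) unfolding second_derivative_on_def by blast
  qed
  have time: "((\<lambda>s. W x s) has_real_derivative U1 x t - V2 x t) (at t within {0<..T})" if x: "x > 0" and t: "t \<in> {0<..T}" for x t
  proof -
    have "((\<lambda>s. Y x s) has_real_derivative U1 x t) (at t within {0<..T})"
      by (rule DERIV_subset[OF Yt]) (use x t in auto)
    moreover have "((\<lambda>s. U2 x s) has_real_derivative V2 x t) (at t within {0<..T})"
      by (rule heat_solutionD(3)[OF H2]) (use x t in auto)
    ultimately show ?thesis unfolding W_def by (auto intro!: derivative_eq_intros)
  qed
  note HW = heat_solution_of_local[OF space time]
  have cU1': "continuous_on ({0<..} \<times> {0<..T}) (\<lambda>(x, t). U1 x t)" by (rule continuous_on_subset[OF cU1]) auto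
  have cVW: "continuous_on ({0<..} \<times> {0<..T}) (\<lambda>(x, t). U1 x t - V2 x t)"
    using continuous_on_diff[OF cU1' cV2] by (simp add: case_prod_beta')
  have cW': "continuous_on ({0<..} \<times> {0<..T}) (\<lambda>(x, t). W x t)" by (rule continuous_on_subset[OF cW]) auto
  have FW: "forward_solution a T (\<lambda>x. 0) W"
  proof (rule forward_solutionI[OF cW HW heat_solution_continuous_space_derivative[OF a_cont a_pos HW cW' cVW] cVW])
    show "W 0 t = 0" if "t \<in> {0..T}" for t
    proof -
      have "Y 0 t = integral {0..t} (\<lambda>_. 0)" unfolding Y_def
        by (rule integral_cong) (use U1(1) that in \<open>auto simp: forward_solution_def \<phi>_def\<close>)
      then show ?thesis using U2(1) that by (simp add: W_def forward_solution_def \<theta>0)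
    qed
    show "W x 0 = 0" if "x \<ge> 0" for x
      using U2(1) that by (simp add: W_def forward_solution_def Y0)
  qed
  have Wb: "\<bar>W x t\<bar> \<le> (T + 2 * c) * (1 + x)" if x: "x \<ge> 0" and t: "t \<in> {0..T}" for x t
  proof -
    have "\<bar>Y x t\<bar> \<le> (1 + x) * t" using YLip[OF x t, of 0] t by (simp add: Y0)
    also have "\<dots> \<le> (1 + x) * T" using x t by (intro mult_left_mono) auto
    finally have "\<bar>Y x t\<bar> \<le> (1 + x) * T" .
    moreover have "\<bar>\<theta> x - U2 x t\<bar> \<le> 2 * c * x" using U2b[OF x t] \<theta>_ge[OF x] by auto
    ultimately have "\<bar>W x t\<bar> \<le> (1 + x) * T + 2 * c * x" unfolding W_def by linarith
    also have "\<dots> \<le> (T + 2 * c) * (1 + x)" using c0 by (simp add: algebra_simps)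
    finally show ?thesis .
  qed
  \<comment> \<open>At time \<open>T\<close> one has \<open>Y \<ge> T * (x - 1)\<close>,
    \<open>\<theta> > - (T / 2 * x)\<close> and \<open>U2 \<le> 0\<close>; for \<open>x > 2\<close>
    this leaves \<open>W x T > 0\<close>.\<close>
  have "\<forall>\<^sub>F x in at_top. - \<theta> x / x < T / 2" by (rule order_tendstoD(2)[OF \<theta>_lim]) (use T in simp)
  then have "\<forall>\<^sub>F x in at_top. - \<theta> x / x < T / 2 \<and> x > 2" using eventually_gt_at_top[of 2] by eventually_elim auto
  then obtain x where x: "- \<theta> x / x < T / 2" "x > 2" by (auto dest: eventually_happens)
  have "Y x T \<ge> T * (x - 1)"
  proof -
    have "integral {0..T} (\<lambda>_. x - 1) \<le> integral {0..T} (U1 x)"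
      by (rule integral_le) (use U1(2)[of x] x cs[of x] in \<open>auto intro: integrable_continuous_real\<close>)
    then show ?thesis using T by (simp add: Y_def)
  qed
  moreover have "- \<theta> x < T / 2 * x"
  proof -
    have "(- \<theta> x / x) * x < T / 2 * x" using x by (intro mult_strict_right_mono) auto
    then show ?thesis using x by simp
  qed
  moreover have "U2 x T \<le> 0" using U2b[of x T] x T by simp
  moreover have "T * (x - 1) \<ge> T / 2 * x"
  proof -
    have "T * (x / 2) \<le> T * (x - 1)" using x T by (intro mult_left_mono) auto
    then show ?thesis by simp
  qed
  ultimately have "W x T > 0" by (simp add: W_def)
  then show ?thesis using that[OF FW Wb, of x] x T c0 by simp
qed

text \<open>Adding a nonzero solution with zero data to any solution gives a second one, whatever
  \<open>g\<close> is. As time is reversed, \<open>W x T \<noteq> 0\<close> is a difference at the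
  original time 0.\<close>

lemma not_unique_solution:
  assumes bdd: "bdd_above (range I)" and T: "T > 0"
  shows "\<not> has_unique_linear_growth_solution T \<sigma> g"
proof
  assume "has_unique_linear_growth_solution T \<sigma> g"
  then obtain u where u: "classical_solution T \<sigma> g u" "linear_growth T u"
    "\<And>v x t. classical_solution T \<sigma> g v \<Longrightarrow> linear_growth T v \<Longrightarrow> x \<ge> 0 \<Longrightarrow> t \<in> {0..T} \<Longrightarrow> v x t = u x t"
    unfolding has_unique_linear_growth_solution_def by blast
  obtain W K x where W: "forward_solution a T (\<lambda>x. 0) W" "\<And>x t. x \<ge> 0 \<Longrightarrow> t \<in> {0..T} \<Longrightarrow> \<bar>W x t\<bar> \<le> K * (1 + x)" "K \<ge> 0"
    and x: "x \<ge> 0" "W x T \<noteq> 0"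
    using nonzero_solution[OF bdd T] by metis
  have "forward_solution a T (\<lambda>x. g x + 0) (\<lambda>x t. u x (T - t) + W x t)"
    by (rule forward_solution_add[OF forward_solution_of_classical[OF a_pos a_def T u(1)] W(1)])
  then have "forward_solution a T g (\<lambda>x t. u x (T - t) + W x t)" by simp
  from classical_solution_of_forward[OF a_cont a_pos a_def this]
  have v: "classical_solution T \<sigma> g (\<lambda>x t. u x t + W x (T - t))" by simp
  obtain C where C: "C > 0" "\<And>x t. x \<ge> 0 \<Longrightarrow> t \<in> {0..T} \<Longrightarrow> \<bar>u x t\<bar> \<le> C * (1 + x)"
    using u(2) unfolding linear_growth_def by blast
  have "\<bar>u x t + W x (T - t)\<bar> \<le> (C + K) * (1 + x)" if "x \<ge> 0" "t \<in> {0..T}" for x t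
    using C(2)[OF that] W(2)[OF that(1), of "T - t"] that by (simp add: algebra_simps)
  then have "linear_growth T (\<lambda>x t. u x t + W x (T - t))"
    unfolding linear_growth_def using C(1) W(3) by (intro exI[of _ "C + K"]) auto
  from u(3)[OF v this x(1), of 0] x(2) T show False by simp
qed

end

theorem theorem2:
  fixes T :: real and \<sigma> g :: "real \<Rightarrow> real"
  assumes T_pos: "T > 0"
    and sigma_nonzero: "\<forall>x>0. \<sigma> x \<noteq> 0"
    and sigma_zero: "\<forall>x\<le>0. \<sigma> x = 0"
    and sigma_L1_loc: "L1_loc_pos (\<lambda>x. 1 / (\<sigma> x)\<^sup>2)"
    and sigma_nonneg: "\<forall>x\<ge>0. \<sigma> x \<ge> 0"
    and sigma_Holder: "locally_Holder_on {0..} (1/2) \<sigma>"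
    and g_nonneg: "\<forall>x\<ge>0. g x \<ge> 0"
    and g_continuous: "continuous_on {0..} g"
    and g_growth: "\<exists>C>0. \<forall>x\<ge>0. g x \<le> C * (1 + x)"
  shows "has_unique_linear_growth_solution T \<sigma> g \<longleftrightarrow>
    (\<integral>\<^sup>+x\<in>{1..}. ennreal (x / (\<sigma> x)\<^sup>2) \<partial>lborel) = \<infinity>"
proof -
  have \<sigma>_cont: "continuous_on {0<..} \<sigma>" by (rule locally_Holder_on_continuous[OF sigma_Holder]) simp
  \<comment> \<open>Evaluation at \<open>max 1 x\<close> makes \<open>p\<close> continuous on the
    whole line, so global antiderivatives vanishing at 0 exist.\<close>
  define p where "p = (\<lambda>x. (max 1 x - 1) / (\<sigma> (max 1 x))\<^sup>2)"
  have "continuous_on UNIV p" unfolding p_def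
  proof (intro continuous_intros continuous_on_compose2[OF \<sigma>_cont])
    show "\<forall>x\<in>UNIV. (\<sigma> (max 1 x))\<^sup>2 \<noteq> 0" using sigma_nonzero by auto
  qed auto
  then obtain I where I: "\<And>x. (I has_real_derivative p x) (at x)" "I 0 = 0" using antiderivative_real by blast
  have "continuous_on UNIV I" by (intro continuous_at_imp_continuous_on ballI, rule DERIV_isCont[OF I(1)])
  then obtain J where J: "\<And>x. (J has_real_derivative I x) (at x)" "J 0 = 0" using antiderivative_real by blast
  interpret diffusion \<sigma> "\<lambda>x. 1/2 * (\<sigma> x)\<^sup>2" p I J
    by unfold_locales (use \<sigma>_cont sigma_nonzero I J in \<open>auto simp: p_def\<close>)
  obtain C where C: "C > 0" "\<forall>x\<ge>0. g x \<le> C * (1 + x)" using g_growth by blast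
  have "has_unique_linear_growth_solution T \<sigma> g" if "\<not> bdd_above (range I)"
    by (rule unique_solution[OF that T_pos _ g_continuous _ C(1)]) (use g_nonneg C(2) in auto)
  moreover have "\<not> has_unique_linear_growth_solution T \<sigma> g" if "bdd_above (range I)"
    by (rule not_unique_solution[OF that T_pos])
  ultimately have "has_unique_linear_growth_solution T \<sigma> g \<longleftrightarrow> \<not> bdd_above (range I)"
    by (cases "bdd_above (range I)") simp_all
  then show ?thesis unfolding integral_infinite_iff .
qed

end
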